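(* Let $X$ be a locally compact metric space and $k\in\mathbb N$. For each $T\in M_{k,\mathrm{loc}}(X)$ we have $$|\widehat T(\omega)|\le\int_X\|\omega\|_x\,\mathrm d\|T\|(x)$$ for every $\omega\in\overline\Gamma^k_c(X)$, where $\widehat T:\overline\Gamma_c^k(X)\to\mathbb R$ is the unique sequentially continuous linear functional with $\widehat T\circ\bar\iota=T$.
   Context: **Lipschitz spaces.** For a metric space $X$, $\mathrm{LIP}_\infty(X)$ is the Banach space of bounded Lipschitz functions $f:X\to\mathbb R$ with norm $L(f)=\max\{\mathrm{Lip}(f),\|f\|_\infty\}$, and $\mathrm{LIP}_c(X)$ is the space of compactly supported Lipschitz functions. $\overline{\mathrm{LIP}}_\infty(X)$ is the quotient of $\mathrm{LIP}_\infty(X)$ by the constant functions, with the quotient norm $\bar L(\bar f)=\inf_{c\in\mathbb R}L(f-c)$; $q:f\mapsto\bar f$ is the quotient map. Put $\mathcal D^k(X)=\mathrm{LIP}_c(X)\times\mathrm{LIP}_\infty(X)^k$. **Currents.** $f_n\to f$ in $\mathrm{LIP}_c(X)$ means $\sup_n\mathrm{Lip}(f_n)<\infty$, $\bigcup_n\mathrm{spt} f_n$ is precompact and $f_n\to f$ uniformly. $f_n\to f$ in $\mathrm{LIP}_\infty(X)$ means $\sup_n\mathrm{Lip}(f_n)<\infty$ and $f_n\to f$ uniformly on every compact set. Convergence in $\mathcal D^k(X)$ is componentwise. A metric $k$-current is a $(k+1)$-linear functional $T:\mathcal D^k(X)\to\mathbb R$ that is sequentially continuous and local: $T(\pi_0,\dots,\pi_k)=0$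 whenever some $\pi_i$, $i\in\{1,\dots,k\}$, is constant in a neighborhood of $\mathrm{spt}\,\pi_0$. $T$ has locally finite mass, $T\in M_{k,\mathrm{loc}}(X)$, if there is a Radon measure $\mu$ on $X$ with $|T(\pi_0,\dots,\pi_k)|\le\mathrm{Lip}(\pi_1)\cdots\mathrm{Lip}(\pi_k)\int_X|\pi_0|\,\mathrm d\mu$ for all $(\pi_0,\dots,\pi_k)\in\mathcal D^k(X)$; the mass measure $\|T\|$ is the minimal such measure. **Polylipschitz functions.** $\hat\otimes_\pi$ is the completed projective tensor product of Banach spaces. $\mathrm{Poly}^k(X)$ is the $(k+1)$-fold projective tensor product of $\mathrm{LIP}_\infty(X)$, and $\overline{\mathrm{Poly}}^k(X)=\mathrm{LIP}_\infty(X)\hat\otimes_\pi\overline{\mathrm{LIP}}_\infty(X)\hat\otimes_\pi\cdots\hat\otimes_\pi\overline{\mathrm{LIP}}_\infty(X)$ ($k$ factors $\overline{\mathrm{LIP}}_\infty(X)$). $Q=\mathrm{id}\otimes q\otimes\cdots\otimes q:\mathrm{Poly}^k(X)\to\overline{\mathrm{Poly}}^k(X)$ is the quotient map. For $\pi\in\mathrm{Poly}^k(X)$, $\mathrm{Rep}(\pi)$ is the set of sequences $(\pi_0^j,\dots,\pi_k^j)_j$ in $\mathrm{LIP}_\infty(X)^{k+1}$ with $\sum_jL(\pi_0^j)\cdots L(\pi_k^j)<\infty$ and $\pi=\sum_j\pi_0^j\otimes\cdots\otimes\pi_k^j$. For $U\subset V$, restriction of functions induces a linear map $\bar\rho_{U,V}:\overline{\mathrm{Poly}}^k(V)\to\overline{\mathrm{Poly}}^k(U)$.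 **Convergence.** $\pi^n\to\pi$ in $\mathrm{Poly}^k(X)$ if for all compact $V_0\times\cdots\times V_k\subset X^{k+1}$ there are $(\pi_0^{j,n},\dots,\pi_k^{j,n})_j\in\mathrm{Rep}(\pi^n-\pi)$ with $\sum_j\sup_nL(\pi_0^{j,n})\cdots L(\pi_k^{j,n})<\infty$ and $\lim_n\sum_j\|\pi_0^{j,n}|_{V_0}\|_\infty\cdots\|\pi_k^{j,n}|_{V_k}\|_\infty=0$. $\bar\pi^n\to\bar\pi$ in $\overline{\mathrm{Poly}}^k(X)$ if there are $\pi^n\in Q^{-1}(\bar\pi^n)$, $\pi\in Q^{-1}(\bar\pi)$ with $\pi^n\to\pi$ in $\mathrm{Poly}^k(X)$. **Polylipschitz forms.** The spaces $\overline{\mathrm{Poly}}^k(U)$, $U\subset X$ open, with the maps $\bar\rho_{U,V}$ form a presheaf. Its étalé space is the space of germs $[\bar\pi]_x$, with basis of open sets $\{[\bar\pi]_x:x\in U\}$ ($U$ open, $\bar\pi\in\overline{\mathrm{Poly}}^k(U)$). $\overline\Gamma^k(X)$ is the space of continuous global sections; $\mathrm{spt}\,\omega$ is the closure of $\{x:\omega(x)\ne0\}$ and $\overline\Gamma^k_c(X)$ is the subspace of compactly supported ones. A family $\{\bar\pi_U\in\overline{\mathrm{Poly}}^k(U)\}_{U\in\mathcal U}$, with $\mathcal U$ a locally finite open cover, is overlap-compatible with $\omega$ if for each $x$ there is $U\in\mathcal U$ containing $x$ with $\omega(x)=[\bar\pi_U]_x$, and $\bar\rho_{U\cap V,U}(\bar\pi_U)=\bar\rho_{U\cap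 V,V}(\bar\pi_V)$ whenever $U\cap V\neq\varnothing$. $\omega_n\to\omega$ in $\overline\Gamma^k_c(X)$ if there are a compact $K\subset X$, a locally finite open cover $\mathcal U$ of $X$ by precompact sets, and for each $n$ a family $\{\bar\pi^n_U\}_{U\in\mathcal U}$ overlap-compatible with $\omega_n-\omega$, such that $\mathrm{spt}(\omega_n-\omega)\subset K$ for all $n$ and $\bar\pi^n_U\to0$ in $\overline{\mathrm{Poly}}^k(U)$ for each $U$. $\bar\iota:\mathcal D^k(X)\to\overline\Gamma^k_c(X)$ is $\bar\iota(\pi_0,\dots,\pi_k)(x)=[\pi_0\otimes\bar\pi_1\otimes\cdots\otimes\bar\pi_k]_x$. It is known (established in the paper) that each metric $k$-current $T$ admits exactly one sequentially continuous linear $\widehat T:\overline\Gamma^k_c(X)\to\mathbb R$ with $\widehat T\circ\bar\iota=T$. **Pointwise norm.** For $\bar\pi\in\overline{\mathrm{Poly}}^k(U)$ and $E\subset U$ let $$\mathrm{Lip}_k(\bar\pi;E)=\inf\Big\{\sup_{x\in E}\sum_j|\pi_0^j(x)|\,\mathrm{Lip}(\pi_1^j|_E)\cdots\mathrm{Lip}(\pi_k^j|_E):(\pi_0^j,\dots,\pi_k^j)_j\in\mathrm{Rep}(\pi)\Big\}$$ for any $\pi\in Q^{-1}(\bar\pi)$ (independent of the choice of $\pi$). For a section $\omega$ and $x\in X$, $\|\omega\|_x=\lim_{r\to0}\mathrm{Lip}_k(\bar\pi;B_r(x))$, where $\bar\pi\in\overline{\mathrm{Poly}}^k(U)$, $U$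 a neighborhood of $x$, satisfies $[\bar\pi]_x=\omega(x)$. *)

theory Defs
  imports "HOL-Analysis.Analysis" "HOL-Analysis.Finite_Function_Topology"
begin

section \<open>Completed projective tensor products\<close>

text \<open>
  The Banach spaces below are indexed by open sets \<open>U\<close> of a metric space, so they are carrier-based
  rather than types.
\<close>

record 'v nspace =
  vecs :: "'v set"
  vadd :: "'v \<Rightarrow> 'v \<Rightarrow> 'v"
  vscale :: "real \<Rightarrow> 'v \<Rightarrow> 'v"
  vnorm :: "'v \<Rightarrow> real"

text \<open>
  We construct the completion of \<open>E \<otimes> F \<otimes> \<dots> \<otimes> F\<close> (\<open>k\<close> factors \<open>F\<close>) for the projective norm.
  Formal linear combinations of tuples \<open>(x\<^sub>0, [x\<^sub>1, \<dots>, x\<^sub>k])\<close> are finitely supported functions; the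
  algebraic tensor product is their quotient by the span of \<open>multilin_rel\<close>.
\<close>

definition tuples :: "nat \<Rightarrow> 'b nspace \<Rightarrow> 'c nspace \<Rightarrow> ('b \<times> 'c list) set" where
  "tuples k E F = {(x, ys). x \<in> vecs E \<and> length ys = k \<and> set ys \<subseteq> vecs F}"

definition cross :: "'b nspace \<Rightarrow> 'c nspace \<Rightarrow> 'b \<times> 'c list \<Rightarrow> real" where
  "cross E F t = vnorm E (fst t) * prod_list (map (vnorm F) (snd t))"

abbreviation pure :: "'t \<Rightarrow> 't \<Rightarrow>\<^sub>0 real" where
  "pure t \<equiv> Poly_Mapping.single t 1"

definition multilin_rel :: "nat \<Rightarrow> 'b nspace \<Rightarrow> 'c nspace \<Rightarrow> ('b \<times> 'c list \<Rightarrow>\<^sub>0 real) set" where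
  "multilin_rel k E F =
     {pure (vadd E x x', ys) - (pure (x, ys) + pure (x', ys)) | x x' ys.
        (x, ys) \<in> tuples k E F \<and> x' \<in> vecs E}
   \<union> {pure (vscale E c x, ys) - c *\<^sub>R pure (x, ys) | c x ys. (x, ys) \<in> tuples k E F}
   \<union> {pure (x, ys[i := vadd F y y']) - (pure (x, ys[i := y]) + pure (x, ys[i := y'])) | x ys i y y'.
        (x, ys) \<in> tuples k E F \<and> i < k \<and> y \<in> vecs F \<and> y' \<in> vecs F}
   \<union> {pure (x, ys[i := vscale F c y]) - c *\<^sub>R pure (x, ys[i := y]) | x ys i c y.
        (x, ys) \<in> tuples k E F \<and> i < k \<and> y \<in> vecs F}"

definition proj_norm :: "nat \<Rightarrow> 'b nspace \<Rightarrow> 'c nspace \<Rightarrow> ('b \<times> 'c list \<Rightarrow>\<^sub>0 real) \<Rightarrow> real" where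
  "proj_norm k E F u =
     Inf {(\<Sum>t\<leftarrow>ts. cross E F t) | ts.
            set ts \<subseteq> tuples k E F \<and> u - (\<Sum>t\<leftarrow>ts. pure t) \<in> span (multilin_rel k E F)}"

text \<open>
  An element of the completion is an equivalence class of Cauchy sequences. Passing to classes also
  divides out the span of \<open>multilin_rel\<close>, on which \<open>proj_norm\<close> vanishes.
\<close>

definition ct_cauchy :: "nat \<Rightarrow> 'b nspace \<Rightarrow> 'c nspace \<Rightarrow> (nat \<Rightarrow> 'b \<times> 'c list \<Rightarrow>\<^sub>0 real) set" where
  "ct_cauchy k E F =
     {u. (\<forall>n. Poly_Mapping.keys (u n) \<subseteq> tuples k E F) \<and>
         (\<forall>e>0. \<exists>N. \<forall>m\<ge>N. \<forall>n\<ge>N. proj_norm k E F (u m - u n) < e)}"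

definition ct_class ::
    "nat \<Rightarrow> 'b nspace \<Rightarrow> 'c nspace \<Rightarrow> (nat \<Rightarrow> 'b \<times> 'c list \<Rightarrow>\<^sub>0 real) \<Rightarrow>
     (nat \<Rightarrow> 'b \<times> 'c list \<Rightarrow>\<^sub>0 real) set" where
  "ct_class k E F u = {v \<in> ct_cauchy k E F. (\<lambda>n. proj_norm k E F (u n - v n)) \<longlonglongrightarrow> 0}"

definition ctensor ::
    "nat \<Rightarrow> 'b nspace \<Rightarrow> 'c nspace \<Rightarrow> (nat \<Rightarrow> 'b \<times> 'c list \<Rightarrow>\<^sub>0 real) set set" where
  "ctensor k E F = ct_class k E F ` ct_cauchy k E F"

definition ct_zero where
  "ct_zero k E F = ct_class k E F (\<lambda>_. 0)"

definition ct_pure where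
  "ct_pure k E F t = ct_class k E F (\<lambda>_. pure t)"

definition ct_add where
  "ct_add k E F A B = (\<Union>u\<in>A. \<Union>v\<in>B. ct_class k E F (\<lambda>n. u n + v n))"

definition ct_diff where
  "ct_diff k E F A B = (\<Union>u\<in>A. \<Union>v\<in>B. ct_class k E F (\<lambda>n. u n - v n))"

definition ct_scale where
  "ct_scale k E F c A = (\<Union>u\<in>A. ct_class k E F (\<lambda>n. c *\<^sub>R u n))"

text \<open>
  \<open>ct_map k E' F' f g\<close> is \<open>f \<otimes> g \<otimes> \<dots> \<otimes> g\<close> with values in the tensor product built from \<open>E'\<close>, \<open>F'\<close>,
  for bounded linear \<open>f : E \<rightarrow> E'\<close> and \<open>g : F \<rightarrow> F'\<close>.
\<close>

definition push :: "('s \<Rightarrow> 't) \<Rightarrow> ('s \<Rightarrow>\<^sub>0 real) \<Rightarrow> ('t \<Rightarrow>\<^sub>0 real)" where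
  "push \<phi> u = (\<Sum>t\<in>Poly_Mapping.keys u. Poly_Mapping.single (\<phi> t) (Poly_Mapping.lookup u t))"

definition ct_map where
  "ct_map k E' F' f g A = (\<Union>u\<in>A. ct_class k E' F' (\<lambda>n. push (\<lambda>(x, ys). (f x, map g ys)) (u n)))"

text \<open>
  \<open>ct_series k E F A\<close>: the sequences of tuples with absolutely convergent series
  \<open>A = \<Sum>\<^sub>j s\<^sub>j\<^sub>0 \<otimes> \<dots> \<otimes> s\<^sub>j\<^sub>k\<close>. Partial sums converge in the completion to the class of the sequence of
  partial sums, so the series has sum \<open>A\<close> iff that sequence is a member of \<open>A\<close>.
\<close>

definition ct_series ::
    "nat \<Rightarrow> 'b nspace \<Rightarrow> 'c nspace \<Rightarrow> (nat \<Rightarrow> 'b \<times> 'c list \<Rightarrow>\<^sub>0 real) set \<Rightarrow>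
     (nat \<Rightarrow> 'b \<times> 'c list) set" where
  "ct_series k E F A =
     {s. (\<forall>j. s j \<in> tuples k E F) \<and> summable (\<lambda>j. cross E F (s j)) \<and>
         (\<lambda>n. \<Sum>j<n. pure (s j)) \<in> A}"


section \<open>Lipschitz spaces\<close>

definition Lip :: "'a::metric_space set \<Rightarrow> ('a \<Rightarrow> real) \<Rightarrow> real" where
  "Lip E f = Inf {C. C-lipschitz_on E f}"

text \<open>Inserting \<open>0\<close> gives the empty set supremum norm \<open>0\<close>.\<close>

definition supnorm :: "'a set \<Rightarrow> ('a \<Rightarrow> real) \<Rightarrow> real" where
  "supnorm E f = Sup (insert 0 ((\<lambda>x. \<bar>f x\<bar>) ` E))"

definition Lnorm :: "'a::metric_space set \<Rightarrow> ('a \<Rightarrow> real) \<Rightarrow> real" where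
  "Lnorm U f = max (Lip U f) (supnorm U f)"

text \<open>Functions on \<open>U\<close> are represented by their extensional representatives.\<close>

definition LIP_inf :: "'a::metric_space set \<Rightarrow> ('a \<Rightarrow> real) nspace" where
  "LIP_inf U =
     \<lparr>vecs = {f \<in> extensional U. (\<exists>C. C-lipschitz_on U f) \<and> bounded (f ` U)},
      vadd = (\<lambda>f g. \<lambda>x\<in>U. f x + g x),
      vscale = (\<lambda>c f. \<lambda>x\<in>U. c * f x),
      vnorm = Lnorm U\<rparr>"

definition qmap :: "'a set \<Rightarrow> ('a \<Rightarrow> real) \<Rightarrow> ('a \<Rightarrow> real) set" where
  "qmap U f = {\<lambda>x\<in>U. f x - c | c. True}"

definition LIP_bar :: "'a::metric_space set \<Rightarrow> ('a \<Rightarrow> real) set nspace" where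
  "LIP_bar U =
     \<lparr>vecs = qmap U ` vecs (LIP_inf U),
      vadd = (\<lambda>A B. \<Union>f\<in>A. \<Union>g\<in>B. qmap U (vadd (LIP_inf U) f g)),
      vscale = (\<lambda>c A. \<Union>f\<in>A. qmap U (vscale (LIP_inf U) c f)),
      vnorm = (\<lambda>A. Inf (Lnorm U ` A))\<rparr>"


section \<open>Metric currents\<close>

definition spt :: "('a::topological_space \<Rightarrow> real) \<Rightarrow> 'a set" where
  "spt f = closure {x. f x \<noteq> 0}"

definition LIP_c :: "('a::metric_space \<Rightarrow> real) set" where
  "LIP_c = {f. (\<exists>C. C-lipschitz_on UNIV f) \<and> compact (spt f)}"

definition Dform :: "nat \<Rightarrow> (('a::metric_space \<Rightarrow> real) \<times> ('a \<Rightarrow> real) list) set" where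
  "Dform k = {(f, gs). f \<in> LIP_c \<and> length gs = k \<and> set gs \<subseteq> vecs (LIP_inf UNIV)}"

definition tendsto_LIP_c ::
    "(nat \<Rightarrow> 'a::metric_space \<Rightarrow> real) \<Rightarrow> ('a \<Rightarrow> real) \<Rightarrow> bool" where
  "tendsto_LIP_c fn f \<longleftrightarrow>
     bdd_above (range (\<lambda>n. Lip UNIV (fn n))) \<and> compact (closure (\<Union>n. spt (fn n))) \<and>
     uniform_limit UNIV fn f sequentially"

definition tendsto_LIP_inf ::
    "(nat \<Rightarrow> 'a::metric_space \<Rightarrow> real) \<Rightarrow> ('a \<Rightarrow> real) \<Rightarrow> bool" where
  "tendsto_LIP_inf fn f \<longleftrightarrow>
     bdd_above (range (\<lambda>n. Lip UNIV (fn n))) \<and>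
     (\<forall>K. compact K \<longrightarrow> uniform_limit K fn f sequentially)"

definition multilinear_form ::
    "nat \<Rightarrow> (('a::metric_space \<Rightarrow> real) \<times> ('a \<Rightarrow> real) list \<Rightarrow> real) \<Rightarrow> bool" where
  "multilinear_form k T \<longleftrightarrow>
     (\<forall>f f' gs a b. (f, gs) \<in> Dform k \<and> (f', gs) \<in> Dform k \<longrightarrow>
        T (\<lambda>x. a * f x + b * f' x, gs) = a * T (f, gs) + b * T (f', gs)) \<and>
     (\<forall>f gs i g g' a b. (f, gs) \<in> Dform k \<and> i < k \<and>
        g \<in> vecs (LIP_inf UNIV) \<and> g' \<in> vecs (LIP_inf UNIV) \<longrightarrow>
        T (f, gs[i := (\<lambda>x. a * g x + b * g' x)]) = a * T (f, gs[i := g]) + b * T (f, gs[i := g']))"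

definition seq_continuous_form ::
    "nat \<Rightarrow> (('a::metric_space \<Rightarrow> real) \<times> ('a \<Rightarrow> real) list \<Rightarrow> real) \<Rightarrow> bool" where
  "seq_continuous_form k T \<longleftrightarrow>
     (\<forall>fn gn f g. (\<forall>n. (fn n, gn n) \<in> Dform k) \<and> (f, g) \<in> Dform k \<and>
        tendsto_LIP_c fn f \<and> (\<forall>i<k. tendsto_LIP_inf (\<lambda>n. gn n ! i) (g ! i)) \<longrightarrow>
        (\<lambda>n. T (fn n, gn n)) \<longlonglongrightarrow> T (f, g))"

definition local_form ::
    "nat \<Rightarrow> (('a::metric_space \<Rightarrow> real) \<times> ('a \<Rightarrow> real) list \<Rightarrow> real) \<Rightarrow> bool" where
  "local_form k T \<longleftrightarrow>
     (\<forall>f gs. (f, gs) \<in> Dform k \<and>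
        (\<exists>i<k. \<exists>W c. open W \<and> spt f \<subseteq> W \<and> (\<forall>x\<in>W. (gs ! i) x = c)) \<longrightarrow> T (f, gs) = 0)"

definition metric_current ::
    "nat \<Rightarrow> (('a::metric_space \<Rightarrow> real) \<times> ('a \<Rightarrow> real) list \<Rightarrow> real) \<Rightarrow> bool" where
  "metric_current k T \<longleftrightarrow> multilinear_form k T \<and> seq_continuous_form k T \<and> local_form k T"

definition radon_measure :: "'a::topological_space measure \<Rightarrow> bool" where
  "radon_measure \<mu> \<longleftrightarrow>
     sets \<mu> = sets borel \<and>
     (\<forall>K. compact K \<longrightarrow> emeasure \<mu> K < \<infinity>) \<and>
     (\<forall>A\<in>sets borel. emeasure \<mu> A = (INF V\<in>{V. open V \<and> A \<subseteq> V}. emeasure \<mu> V)) \<and>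
     (\<forall>V. open V \<longrightarrow> emeasure \<mu> V = (SUP K\<in>{K. compact K \<and> K \<subseteq> V}. emeasure \<mu> K))"

definition mass_bound ::
    "nat \<Rightarrow> (('a::metric_space \<Rightarrow> real) \<times> ('a \<Rightarrow> real) list \<Rightarrow> real) \<Rightarrow> 'a measure \<Rightarrow> bool" where
  "mass_bound k T \<mu> \<longleftrightarrow>
     (\<forall>f gs. (f, gs) \<in> Dform k \<longrightarrow>
        ennreal \<bar>T (f, gs)\<bar> \<le>
          ennreal (prod_list (map (Lip UNIV) gs)) * (\<integral>\<^sup>+x. ennreal \<bar>f x\<bar> \<partial>\<mu>))"

definition M_loc ::
    "nat \<Rightarrow> (('a::metric_space \<Rightarrow> real) \<times> ('a \<Rightarrow> real) list \<Rightarrow> real) set" where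
  "M_loc k = {T. metric_current k T \<and> (\<exists>\<mu>. radon_measure \<mu> \<and> mass_bound k T \<mu>)}"

definition is_mass_measure ::
    "nat \<Rightarrow> (('a::metric_space \<Rightarrow> real) \<times> ('a \<Rightarrow> real) list \<Rightarrow> real) \<Rightarrow> 'a measure \<Rightarrow> bool" where
  "is_mass_measure k T \<mu> \<longleftrightarrow>
     radon_measure \<mu> \<and> mass_bound k T \<mu> \<and>
     (\<forall>\<nu>. radon_measure \<nu> \<and> mass_bound k T \<nu> \<longrightarrow>
        (\<forall>A\<in>sets borel. emeasure \<mu> A \<le> emeasure \<nu> A))"


section \<open>Polylipschitz functions\<close>

type_synonym 'a ptuple = "('a \<Rightarrow> real) \<times> ('a \<Rightarrow> real) list"
type_synonym 'a poly_elt = "(nat \<Rightarrow> 'a ptuple \<Rightarrow>\<^sub>0 real) set"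
type_synonym 'a bpoly_elt = "(nat \<Rightarrow> ('a \<Rightarrow> real) \<times> ('a \<Rightarrow> real) set list \<Rightarrow>\<^sub>0 real) set"

definition Poly :: "nat \<Rightarrow> 'a::metric_space set \<Rightarrow> 'a poly_elt set" where
  "Poly k U = ctensor k (LIP_inf U) (LIP_inf U)"

definition bPoly :: "nat \<Rightarrow> 'a::metric_space set \<Rightarrow> 'a bpoly_elt set" where
  "bPoly k U = ctensor k (LIP_inf U) (LIP_bar U)"

definition bPoly_zero :: "nat \<Rightarrow> 'a::metric_space set \<Rightarrow> 'a bpoly_elt" where
  "bPoly_zero k U = ct_zero k (LIP_inf U) (LIP_bar U)"

definition Qmap :: "nat \<Rightarrow> 'a::metric_space set \<Rightarrow> 'a poly_elt \<Rightarrow> 'a bpoly_elt" where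
  "Qmap k U = ct_map k (LIP_inf U) (LIP_bar U) id (qmap U)"

definition Rep :: "nat \<Rightarrow> 'a::metric_space set \<Rightarrow> 'a poly_elt \<Rightarrow> (nat \<Rightarrow> 'a ptuple) set" where
  "Rep k U = ct_series k (LIP_inf U) (LIP_inf U)"

text \<open>\<open>bres k U\<close> is restriction to \<open>U\<close>, from any \<open>V\<close> containing \<open>U\<close>.\<close>

definition bres :: "nat \<Rightarrow> 'a::metric_space set \<Rightarrow> 'a bpoly_elt \<Rightarrow> 'a bpoly_elt" where
  "bres k U = ct_map k (LIP_inf U) (LIP_bar U) (\<lambda>f. restrict f U) (\<lambda>A. (\<lambda>f. restrict f U) ` A)"

definition tendsto_Poly ::
    "nat \<Rightarrow> 'a::metric_space set \<Rightarrow> (nat \<Rightarrow> 'a poly_elt) \<Rightarrow> 'a poly_elt \<Rightarrow> bool" where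
  "tendsto_Poly k U pn p \<longleftrightarrow>
     (\<forall>V0 Vs. compact V0 \<and> V0 \<subseteq> U \<and> length Vs = k \<and> (\<forall>V\<in>set Vs. compact V \<and> V \<subseteq> U) \<longrightarrow>
       (\<exists>r. (\<forall>n. r n \<in> Rep k U (ct_diff k (LIP_inf U) (LIP_inf U) (pn n) p)) \<and>
            suminf (\<lambda>j. SUP n. ennreal (cross (LIP_inf U) (LIP_inf U) (r n j))) < \<infinity> \<and>
            (\<lambda>n. suminf (\<lambda>j. ennreal (supnorm V0 (fst (r n j)) *
               prod_list (map2 supnorm Vs (snd (r n j)))))) \<longlonglongrightarrow> 0))"

definition tendsto_bPoly ::
    "nat \<Rightarrow> 'a::metric_space set \<Rightarrow> (nat \<Rightarrow> 'a bpoly_elt) \<Rightarrow> 'a bpoly_elt \<Rightarrow> bool" where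
  "tendsto_bPoly k U bn b \<longleftrightarrow>
     (\<exists>pn p. (\<forall>n. pn n \<in> Poly k U \<and> Qmap k U (pn n) = bn n) \<and>
             p \<in> Poly k U \<and> Qmap k U p = b \<and> tendsto_Poly k U pn p)"


section \<open>Polylipschitz forms\<close>

text \<open>
  A germ is an equivalence class of pairs \<open>(U, b)\<close> with \<open>b \<in> bPoly k U\<close>. Germs at distinct points are
  distinct sets, since \<open>U\<close> ranges over all small neighbourhoods of the point; hence the stalks are
  disjoint and the set of all germs is the underlying set of the etale space.
\<close>

type_synonym 'a germ = "('a set \<times> 'a bpoly_elt) set"

definition germ :: "nat \<Rightarrow> 'a::metric_space \<Rightarrow> 'a set \<Rightarrow> 'a bpoly_elt \<Rightarrow> 'a germ" where
  "germ k x U b =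
     {(V, b'). open V \<and> x \<in> V \<and> b' \<in> bPoly k V \<and>
        (\<exists>W. open W \<and> x \<in> W \<and> W \<subseteq> U \<inter> V \<and> bres k W b = bres k W b')}"

definition stalk :: "nat \<Rightarrow> 'a::metric_space \<Rightarrow> 'a germ set" where
  "stalk k x = {germ k x U b | U b. open U \<and> x \<in> U \<and> b \<in> bPoly k U}"

definition etale_topology :: "nat \<Rightarrow> 'a::metric_space germ topology" where
  "etale_topology k =
     topology_generated_by {(\<lambda>x. germ k x U b) ` U | U b. open U \<and> b \<in> bPoly k U}"

definition germ_zero :: "nat \<Rightarrow> 'a::metric_space \<Rightarrow> 'a germ" where
  "germ_zero k x = germ k x UNIV (bPoly_zero k UNIV)"

definition bGamma :: "nat \<Rightarrow> ('a::metric_space \<Rightarrow> 'a germ) set" where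
  "bGamma k = {\<omega>. (\<forall>x. \<omega> x \<in> stalk k x) \<and> continuous_map euclidean (etale_topology k) \<omega>}"

definition spt_section :: "nat \<Rightarrow> ('a::metric_space \<Rightarrow> 'a germ) \<Rightarrow> 'a set" where
  "spt_section k \<omega> = closure {x. \<omega> x \<noteq> germ_zero k x}"

definition bGamma_c :: "nat \<Rightarrow> ('a::metric_space \<Rightarrow> 'a germ) set" where
  "bGamma_c k = {\<omega> \<in> bGamma k. compact (spt_section k \<omega>)}"

definition sec_add ::
    "nat \<Rightarrow> ('a::metric_space \<Rightarrow> 'a germ) \<Rightarrow> ('a \<Rightarrow> 'a germ) \<Rightarrow> 'a \<Rightarrow> 'a germ" where
  "sec_add k \<omega> \<eta> x =
     (\<Union>(U, b)\<in>\<omega> x. \<Union>(V, b')\<in>\<eta> x. germ k x (U \<inter> V)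
        (ct_add k (LIP_inf (U \<inter> V)) (LIP_bar (U \<inter> V)) (bres k (U \<inter> V) b) (bres k (U \<inter> V) b')))"

definition sec_scale ::
    "nat \<Rightarrow> real \<Rightarrow> ('a::metric_space \<Rightarrow> 'a germ) \<Rightarrow> 'a \<Rightarrow> 'a germ" where
  "sec_scale k c \<omega> x =
     (\<Union>(U, b)\<in>\<omega> x. germ k x U (ct_scale k (LIP_inf U) (LIP_bar U) c b))"

definition sec_diff ::
    "nat \<Rightarrow> ('a::metric_space \<Rightarrow> 'a germ) \<Rightarrow> ('a \<Rightarrow> 'a germ) \<Rightarrow> 'a \<Rightarrow> 'a germ" where
  "sec_diff k \<omega> \<eta> = sec_add k \<omega> (sec_scale k (- 1) \<eta>)"

definition locally_finite_open_cover :: "'a::topological_space set set \<Rightarrow> bool" where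
  "locally_finite_open_cover \<U> \<longleftrightarrow>
     (\<forall>U\<in>\<U>. open U) \<and> \<Union>\<U> = UNIV \<and> locally_finite_in euclidean \<U>"

definition overlap_compatible ::
    "nat \<Rightarrow> 'a::metric_space set set \<Rightarrow> ('a set \<Rightarrow> 'a bpoly_elt) \<Rightarrow> ('a \<Rightarrow> 'a germ) \<Rightarrow> bool" where
  "overlap_compatible k \<U> b \<omega> \<longleftrightarrow>
     locally_finite_open_cover \<U> \<and>
     (\<forall>U\<in>\<U>. b U \<in> bPoly k U) \<and>
     (\<forall>x. \<exists>U\<in>\<U>. x \<in> U \<and> \<omega> x = germ k x U (b U)) \<and>
     (\<forall>U\<in>\<U>. \<forall>V\<in>\<U>. U \<inter> V \<noteq> {} \<longrightarrow> bres k (U \<inter> V) (b U) = bres k (U \<inter> V) (b V))"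

definition tendsto_bGamma_c ::
    "nat \<Rightarrow> (nat \<Rightarrow> 'a::metric_space \<Rightarrow> 'a germ) \<Rightarrow> ('a \<Rightarrow> 'a germ) \<Rightarrow> bool" where
  "tendsto_bGamma_c k \<omega>n \<omega> \<longleftrightarrow>
     (\<exists>K \<U> b. compact K \<and> locally_finite_open_cover \<U> \<and> (\<forall>U\<in>\<U>. compact (closure U)) \<and>
        (\<forall>n. overlap_compatible k \<U> (b n) (sec_diff k (\<omega>n n) \<omega>)) \<and>
        (\<forall>n. spt_section k (sec_diff k (\<omega>n n) \<omega>) \<subseteq> K) \<and>
        (\<forall>U\<in>\<U>. tendsto_bPoly k U (\<lambda>n. b n U) (bPoly_zero k U)))"

definition iota :: "nat \<Rightarrow> 'a::metric_space ptuple \<Rightarrow> 'a \<Rightarrow> 'a germ" where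
  "iota k t x =
     germ k x UNIV (ct_pure k (LIP_inf UNIV) (LIP_bar UNIV) (fst t, map (qmap UNIV) (snd t)))"

definition linear_on_sections ::
    "nat \<Rightarrow> (('a::metric_space \<Rightarrow> 'a germ) \<Rightarrow> real) \<Rightarrow> bool" where
  "linear_on_sections k S \<longleftrightarrow>
     (\<forall>\<omega>\<in>bGamma_c k. \<forall>\<eta>\<in>bGamma_c k. S (sec_add k \<omega> \<eta>) = S \<omega> + S \<eta>) \<and>
     (\<forall>c. \<forall>\<omega>\<in>bGamma_c k. S (sec_scale k c \<omega>) = c * S \<omega>)"

definition seq_continuous_on_sections ::
    "nat \<Rightarrow> (('a::metric_space \<Rightarrow> 'a germ) \<Rightarrow> real) \<Rightarrow> bool" where
  "seq_continuous_on_sections k S \<longleftrightarrow>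
     (\<forall>\<omega>n \<omega>. (\<forall>n. \<omega>n n \<in> bGamma_c k) \<and> \<omega> \<in> bGamma_c k \<and> tendsto_bGamma_c k \<omega>n \<omega> \<longrightarrow>
        (\<lambda>n. S (\<omega>n n)) \<longlonglongrightarrow> S \<omega>)"

definition is_extension ::
    "nat \<Rightarrow> ('a::metric_space ptuple \<Rightarrow> real) \<Rightarrow> (('a \<Rightarrow> 'a germ) \<Rightarrow> real) \<Rightarrow> bool" where
  "is_extension k T S \<longleftrightarrow>
     linear_on_sections k S \<and> seq_continuous_on_sections k S \<and> (\<forall>t\<in>Dform k. S (iota k t) = T t)"


section \<open>Pointwise norm\<close>

text \<open>
  The choices below are immaterial: \<open>Lip_k\<close> does not depend on the preimage under \<open>Q\<close>, and the
  limit defining \<open>pointwise_norm\<close> does not depend on the representative of the germ.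
\<close>

definition Lip_k :: "nat \<Rightarrow> 'a::metric_space set \<Rightarrow> 'a bpoly_elt \<Rightarrow> 'a set \<Rightarrow> ennreal" where
  "Lip_k k U b E =
     (INF s\<in>Rep k U (SOME p. p \<in> Poly k U \<and> Qmap k U p = b).
        SUP x\<in>E. suminf (\<lambda>j. ennreal (\<bar>fst (s j) x\<bar> * prod_list (map (Lip E) (snd (s j))))))"

definition pointwise_norm ::
    "nat \<Rightarrow> ('a::metric_space \<Rightarrow> 'a germ) \<Rightarrow> 'a \<Rightarrow> ennreal" where
  "pointwise_norm k \<omega> x =
     (let (U, b) = (SOME (U, b). open U \<and> x \<in> U \<and> b \<in> bPoly k U \<and> germ k x U b = \<omega> x)
      in Lim (at_right 0) (\<lambda>r. Lip_k k U b (ball x r)))"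

end

theory Submission
  imports Defs
begin

text \<open>
  Near every point a form \<open>\<omega>\<close> is the class of an absolutely convergent series
  \<open>\<Sum>\<^sub>j s\<^sub>j\<^sub>0 \<otimes> s\<^sub>j\<^sub>1 \<otimes> \<dots> \<otimes> s\<^sub>j\<^sub>k\<close> of Lipschitz functions on an open set. Let \<open>B\<close> be a small ball, let
  \<open>\<phi>\<close> be a Lipschitz cutoff supported in \<open>B\<close>, and let \<open>c\<close> bound \<open>\<Sum>\<^sub>j \<bar>s\<^sub>j\<^sub>0\<bar> Lip(s\<^sub>j\<^sub>1|B) \<cdots> Lip(s\<^sub>j\<^sub>k|B)\<close>
  on \<open>B\<close>. Extending the last \<open>k\<close> factors from \<open>B\<close> to the whole space with the same Lipschitz
  constants (\<open>mcshane_extension\<close>) turns \<open>\<phi> \<omega>\<close> into the class of a global series whose terms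
  come from elements of \<open>Dform k\<close>. Sequential continuity evaluates the extension of \<open>T\<close> on
  such a series term by term (\<open>extension_series\<close>). Adding the mass bounds of the terms under
  the integral sign gives at most \<open>c \<integral> \<phi> d\<mu>\<close> (\<open>extension_cutoff_bound\<close>). A Lipschitz partition
  of unity near the compact support of \<open>\<omega>\<close> then yields the bound
  \<open>\<Sum>\<^sub>i c\<^sub>i \<integral> \<phi>\<^sub>i d\<mu>\<close> for \<open>\<omega>\<close> itself (\<open>partition_of_unity_section\<close>, \<open>extension_partition_bound\<close>).

  The partition has to be chosen so that \<open>\<Sum>\<^sub>i c\<^sub>i \<phi>\<^sub>i\<close> is close to the pointwise norm. For this the
  pointwise norm is replaced by \<open>relaxed_norm\<close>, the infimum of the admissible constants \<open>c\<close> over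
  all radii and all representing series. It is at most the pointwise norm
  (\<open>relaxed_norm_le_pointwise_norm\<close>). An admissible constant for a ball is admissible at every point
  of a smaller ball, so \<open>relaxed_norm\<close> is upper semicontinuous, and hence it has a continuous
  majorant with almost the same integral (\<open>usc_lipschitz_majorant\<close>). On sufficiently small balls
  the constants \<open>c\<^sub>i\<close> lie below this majorant up to a small error
  (\<open>extension_bound_majorant\<close>), and the theorem follows by letting the errors tend to \<open>0\<close>.

  Two existence results enter. Every element of the completed tensor product is the sum of an
  absolutely convergent series, even after lifting from functions modulo constants to functions
  (\<open>ctensor_series_lift\<close>). Convergence of forms refers to a locally finite cover by
  precompact open sets, which exists by Stone's theorem on paracompactness of metric spaces
  (\<open>stone_locally_finite_refinement\<close>).
\<close>

section \<open>Projective seminorms and Cauchy classes\<close>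

text \<open>
  The properties of the factors from which \<open>proj_norm\<close> inherits those of a seminorm.
\<close>

definition seminormed_space :: "'v nspace \<Rightarrow> bool" where
  "seminormed_space E \<longleftrightarrow> vecs E \<noteq> {} \<and>
     (\<forall>x\<in>vecs E. \<forall>y\<in>vecs E. vadd E x y \<in> vecs E) \<and>
     (\<forall>c. \<forall>x\<in>vecs E. vscale E c x \<in> vecs E \<and> vnorm E (vscale E c x) \<le> \<bar>c\<bar> * vnorm E x) \<and>
     (\<forall>x\<in>vecs E. 0 \<le> vnorm E x)"

lemma prod_list_nonneg:
  "(\<And>x. x \<in> set xs \<Longrightarrow> 0 \<le> x) \<Longrightarrow> 0 \<le> prod_list (xs :: real list)"
  by (induction xs) auto

lemma prod_list_map_mono:
  "(\<And>x. x \<in> set xs \<Longrightarrow> 0 \<le> f x \<and> f x \<le> (g x :: real)) \<Longrightarrow>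
     prod_list (map f xs) \<le> prod_list (map g xs)"
proof (induction xs)
  case (Cons a xs)
  then show ?case
    by (auto intro!: mult_mono prod_list_nonneg dest: order_trans)
qed auto

lemma lookup_scaleR_real: "Poly_Mapping.lookup (c *\<^sub>R (u :: 't \<Rightarrow>\<^sub>0 real)) t = c * Poly_Mapping.lookup u t"
proof -
  have "finite {i. c *\<^sub>R Poly_Mapping.lookup u i \<noteq> 0}"
    by (rule finite_subset[OF _ finite_keys[of u]]) (auto simp: in_keys_iff)
  then show ?thesis by (simp add: scaleR_poly_mapping_def Abs_poly_mapping_inverse)
qed

lemma poly_mapping_sum_single:
  "(u :: 't \<Rightarrow>\<^sub>0 real) = (\<Sum>t\<in>Poly_Mapping.keys u. Poly_Mapping.lookup u t *\<^sub>R pure t)"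
proof (rule poly_mapping_eqI)
  fix s
  have "(\<Sum>t\<in>Poly_Mapping.keys u. Poly_Mapping.lookup u t * (1 when t = s))
      = (\<Sum>t\<in>Poly_Mapping.keys u. if t = s then Poly_Mapping.lookup u s else 0)"
    by (rule sum.cong) auto
  also have "\<dots> = Poly_Mapping.lookup u s"
    by (auto simp: in_keys_iff)
  finally show "Poly_Mapping.lookup u s = Poly_Mapping.lookup
      (\<Sum>t\<in>Poly_Mapping.keys u. Poly_Mapping.lookup u t *\<^sub>R pure t) s"
    by (simp add: lookup_sum lookup_scaleR_real lookup_single)
qed

lemma single_eq_scaleR_pure: "Poly_Mapping.single t c = c *\<^sub>R pure t"
  by (rule poly_mapping_eqI) (simp add: lookup_scaleR_real lookup_single when_def)

lemma push_superset:
  assumes "finite A" "Poly_Mapping.keys u \<subseteq> A"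
  shows "push \<phi> u = (\<Sum>t\<in>A. Poly_Mapping.lookup u t *\<^sub>R pure (\<phi> t))"
proof -
  have "push \<phi> u = (\<Sum>t\<in>Poly_Mapping.keys u. Poly_Mapping.lookup u t *\<^sub>R pure (\<phi> t))"
    unfolding push_def by (intro sum.cong refl single_eq_scaleR_pure)
  also have "\<dots> = (\<Sum>t\<in>A. Poly_Mapping.lookup u t *\<^sub>R pure (\<phi> t))"
    by (rule sum.mono_neutral_left) (use assms in \<open>auto simp: in_keys_iff\<close>)
  finally show ?thesis .
qed

lemma linear_push: "linear (push \<phi>)"
proof
  fix u v :: "'a \<Rightarrow>\<^sub>0 real" and c :: real
  let ?A = "Poly_Mapping.keys u \<union> Poly_Mapping.keys v"
  have uv: "push \<phi> (u + v) = (\<Sum>t\<in>?A. Poly_Mapping.lookup (u + v) t *\<^sub>R pure (\<phi> t))"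
    by (rule push_superset) (use keys_add[of u v] in auto)
  show "push \<phi> (u + v) = push \<phi> u + push \<phi> v"
    unfolding uv by (subst (1 2) push_superset[of ?A])
      (simp_all add: lookup_add scaleR_add_left sum.distrib)
  have "Poly_Mapping.keys (c *\<^sub>R u) \<subseteq> Poly_Mapping.keys u"
    by (auto simp: in_keys_iff lookup_scaleR_real)
  then show "push \<phi> (c *\<^sub>R u) = c *\<^sub>R push \<phi> u"
    by (subst (1 2) push_superset[of "Poly_Mapping.keys u"])
      (simp_all add: lookup_scaleR_real scaleR_sum_right)
qed

lemma push_pure [simp]: "push \<phi> (pure t) = pure (\<phi> t)"
  by (simp add: push_def)

lemma push_sum: "push \<phi> (\<Sum>i\<in>A. u i) = (\<Sum>i\<in>A. push \<phi> (u i))"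
  by (rule linear_sum[OF linear_push])

lemma push_add: "push \<phi> (u + v) = push \<phi> u + push \<phi> v"
  by (rule linear_add[OF linear_push])

lemma push_diff: "push \<phi> (u - v) = push \<phi> u - push \<phi> v"
  by (rule linear_diff[OF linear_push])

lemma push_scaleR: "push \<phi> (c *\<^sub>R u) = c *\<^sub>R push \<phi> u"
  by (rule linear_scale[OF linear_push])

lemma push_sum_list: "push \<phi> (\<Sum>t\<leftarrow>ts. pure t) = (\<Sum>t\<leftarrow>map \<phi> ts. pure t)"
  by (induction ts) (simp_all add: push_add linear_0[OF linear_push])

lemma linear_eq_on_pure:
  assumes "linear h" "linear h'" "Poly_Mapping.keys u \<subseteq> A"
    and "\<And>t. t \<in> A \<Longrightarrow> h (pure t) = h' (pure t)"
  shows "h (u :: 't \<Rightarrow>\<^sub>0 real) = h' u"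
  by (subst (1 2) poly_mapping_sum_single)
    (use assms in \<open>auto simp: linear_sum linear_scale intro!: sum.cong\<close>)

lemma linear_on_pure_in_span:
  assumes "linear h" "Poly_Mapping.keys u \<subseteq> A" and "\<And>t. t \<in> A \<Longrightarrow> h (pure t) \<in> span S"
  shows "h (u :: 't \<Rightarrow>\<^sub>0 real) \<in> span S"
  by (subst poly_mapping_sum_single)
    (use assms in \<open>auto simp: linear_sum linear_scale intro!: span_sum span_scale\<close>)

lemma push_compose: "push \<phi> (push \<psi> u) = push (\<lambda>t. \<phi> (\<psi> t)) u"
  using linear_eq_on_pure[of "push \<phi> \<circ> push \<psi>" "push (\<lambda>t. \<phi> (\<psi> t))" u UNIV]
  by (simp add: linear_compose linear_push)

locale tensor =
  fixes k :: nat and E :: "'b nspace" and F :: "'c nspace"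
  assumes seminormed_E: "seminormed_space E" and seminormed_F: "seminormed_space F"
begin

abbreviation R where "R \<equiv> span (multilin_rel k E F)"
abbreviation pnorm where "pnorm \<equiv> proj_norm k E F"
abbreviation cls where "cls \<equiv> ct_class k E F"
abbreviation cauchy where "cauchy \<equiv> ct_cauchy k E F"

text \<open>
  The formal combinations of genuine tuples. Outside this space \<open>proj_norm\<close> is the infimum of an
  empty set and carries no information.
\<close>

definition formal :: "('b \<times> 'c list \<Rightarrow>\<^sub>0 real) set" where
  "formal = {u. Poly_Mapping.keys u \<subseteq> tuples k E F}"

lemma formal_0 [simp]: "0 \<in> formal"
  and formal_pure: "t \<in> tuples k E F \<Longrightarrow> pure t \<in> formal"
  by (auto simp: formal_def)

lemma formal_add: "u \<in> formal \<Longrightarrow> v \<in> formal \<Longrightarrow> u + v \<in> formal"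
  using keys_add[of u v] by (auto simp: formal_def)

lemma formal_diff: "u \<in> formal \<Longrightarrow> v \<in> formal \<Longrightarrow> u - v \<in> formal"
  using keys_diff[of u v] by (auto simp: formal_def)

lemma formal_scaleR: "u \<in> formal \<Longrightarrow> c *\<^sub>R u \<in> formal"
  by (auto simp: formal_def in_keys_iff lookup_scaleR_real)

lemma formal_sum: "(\<And>i. i \<in> A \<Longrightarrow> u i \<in> formal) \<Longrightarrow> (\<Sum>i\<in>A. u i) \<in> formal"
  by (induction A rule: infinite_finite_induct) (auto intro: formal_add)

lemma vscale_E: "x \<in> vecs E \<Longrightarrow> vscale E c x \<in> vecs E \<and> vnorm E (vscale E c x) \<le> \<bar>c\<bar> * vnorm E x"
  using seminormed_E by (auto simp: seminormed_space_def)

lemma vnorm_F_nonneg: "y \<in> vecs F \<Longrightarrow> 0 \<le> vnorm F y"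
  using seminormed_F by (auto simp: seminormed_space_def)

lemma cross_nonneg: "t \<in> tuples k E F \<Longrightarrow> 0 \<le> cross E F t"
  using seminormed_E
  by (auto simp: cross_def tuples_def seminormed_space_def
      intro!: mult_nonneg_nonneg prod_list_nonneg vnorm_F_nonneg)

text \<open>
  Scalars are absorbed by the first factor.
\<close>

definition scale_tuple :: "real \<Rightarrow> 'b \<times> 'c list \<Rightarrow> 'b \<times> 'c list" where
  "scale_tuple c t = (vscale E c (fst t), snd t)"

lemma scale_tuple:
  assumes "t \<in> tuples k E F"
  shows "scale_tuple c t \<in> tuples k E F" "cross E F (scale_tuple c t) \<le> \<bar>c\<bar> * cross E F t"
    "c *\<^sub>R pure t - pure (scale_tuple c t) \<in> R"
proof -
  obtain x ys where t: "t = (x, ys)" by (cases t)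
  have x: "x \<in> vecs E" "set ys \<subseteq> vecs F" using assms by (auto simp: t tuples_def)
  show "scale_tuple c t \<in> tuples k E F"
    using assms vscale_E by (auto simp: scale_tuple_def tuples_def)
  have "0 \<le> prod_list (map (vnorm F) ys)"
    using x vnorm_F_nonneg by (intro prod_list_nonneg) auto
  then show "cross E F (scale_tuple c t) \<le> \<bar>c\<bar> * cross E F t"
    using vscale_E[OF x(1), of c]
    by (auto simp: scale_tuple_def cross_def t mult.assoc[symmetric] intro!: mult_right_mono)
  have "pure (vscale E c x, ys) - c *\<^sub>R pure (x, ys) \<in> R"
    by (rule span_base) (use assms in \<open>auto simp: multilin_rel_def t\<close>)
  from span_neg[OF this] show "c *\<^sub>R pure t - pure (scale_tuple c t) \<in> R"
    by (simp add: scale_tuple_def t)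
qed

lemma pure_add_first:
  assumes "(x, ys) \<in> tuples k E F" "x' \<in> vecs E"
  shows "pure (vadd E x x', ys) - (pure (x, ys) + pure (x', ys)) \<in> R"
  by (rule span_base) (use assms in \<open>unfold multilin_rel_def, blast\<close>)

text \<open>
  Since the first factor absorbs scalars, every formal combination is congruent to a plain sum of
  tuples. Hence the infimum that defines \<open>proj_norm\<close> runs over a nonempty set.
\<close>

lemma ex_representation:
  assumes "u \<in> formal"
  shows "\<exists>ts. set ts \<subseteq> tuples k E F \<and> u - (\<Sum>t\<leftarrow>ts. pure t) \<in> R"
proof -
  have "\<exists>ts. set ts \<subseteq> tuples k E F \<and> (\<Sum>t\<in>A. c t *\<^sub>R pure t) - (\<Sum>t\<leftarrow>ts. pure t) \<in> R"
    if "finite A" "A \<subseteq> tuples k E F" for A and c :: "'b \<times> 'c list \<Rightarrow> real"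
    using that
  proof (induction A rule: finite_induct)
    case empty
    show ?case by (rule exI[of _ "[]"]) (simp add: span_zero)
  next
    case (insert t A)
    then obtain ts where ts: "set ts \<subseteq> tuples k E F"
      "(\<Sum>t\<in>A. c t *\<^sub>R pure t) - (\<Sum>t\<leftarrow>ts. pure t) \<in> R" by auto
    have "(\<Sum>t\<in>insert t A. c t *\<^sub>R pure t) - (\<Sum>t\<leftarrow>scale_tuple (c t) t # ts. pure t)
        = (c t *\<^sub>R pure t - pure (scale_tuple (c t) t)) +
          ((\<Sum>t\<in>A. c t *\<^sub>R pure t) - (\<Sum>t\<leftarrow>ts. pure t))"
      using insert by simp
    also have "\<dots> \<in> R"
      using insert ts by (intro span_add scale_tuple) auto
    finally show ?case using insert ts scale_tuple(1)
      by (intro exI[of _ "scale_tuple (c t) t # ts"]) auto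
  qed
  from this[of "Poly_Mapping.keys u" "Poly_Mapping.lookup u"] show ?thesis
    using assms by (simp add: formal_def poly_mapping_sum_single[symmetric])
qed

lemma sum_cross_nonneg: "set ts \<subseteq> tuples k E F \<Longrightarrow> 0 \<le> (\<Sum>t\<leftarrow>ts. cross E F t)"
  by (intro sum_list_nonneg) (auto intro: cross_nonneg)

lemma pnorm_le:
  assumes "set ts \<subseteq> tuples k E F" "u - (\<Sum>t\<leftarrow>ts. pure t) \<in> R"
  shows "pnorm u \<le> (\<Sum>t\<leftarrow>ts. cross E F t)"
  unfolding proj_norm_def
  by (rule cInf_lower) (use assms sum_cross_nonneg in \<open>auto intro!: bdd_belowI[of _ 0]\<close>)

lemma pnorm_nonneg: "u \<in> formal \<Longrightarrow> 0 \<le> pnorm u"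
  unfolding proj_norm_def
  by (rule cInf_greatest) (use ex_representation[of u] sum_cross_nonneg in auto)

lemma pnorm_lessD:
  assumes "u \<in> formal" "pnorm u < e"
  shows "\<exists>ts. set ts \<subseteq> tuples k E F \<and> u - (\<Sum>t\<leftarrow>ts. pure t) \<in> R \<and> (\<Sum>t\<leftarrow>ts. cross E F t) < e"
proof -
  have "\<exists>y\<in>{(\<Sum>t\<leftarrow>ts. cross E F t) | ts.
      set ts \<subseteq> tuples k E F \<and> u - (\<Sum>t\<leftarrow>ts. pure t) \<in> R}. y < e"
    using assms(2) ex_representation[OF assms(1)] unfolding proj_norm_def
    by (intro cInf_lessD) auto
  then show ?thesis by auto
qed

lemma pnorm_cong:
  assumes "u - v \<in> R"
  shows "pnorm u = pnorm v"
proof -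
  have "u - w \<in> R \<longleftrightarrow> v - w \<in> R" for w
    using span_add[OF assms, of "v - w"] span_diff[of "u - w" _ "u - v"] assms by auto
  then show ?thesis unfolding proj_norm_def by simp
qed

lemma pnorm_0 [simp]: "pnorm 0 = 0"
  using pnorm_le[of "[]" 0] pnorm_nonneg[of 0] by (simp add: span_zero)

lemma pnorm_in_R: "u \<in> R \<Longrightarrow> pnorm u = 0"
  using pnorm_cong[of u 0] by simp

text \<open>
  Representations of the two summands can be concatenated.
\<close>

lemma pnorm_add:
  assumes "u \<in> formal" "v \<in> formal"
  shows "pnorm (u + v) \<le> pnorm u + pnorm v"
proof (rule field_le_epsilon)
  fix e :: real assume "0 < e"
  then obtain ts ts' where ts: "set ts \<subseteq> tuples k E F" "u - (\<Sum>t\<leftarrow>ts. pure t) \<in> R"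
      "(\<Sum>t\<leftarrow>ts. cross E F t) < pnorm u + e / 2"
    and ts': "set ts' \<subseteq> tuples k E F" "v - (\<Sum>t\<leftarrow>ts'. pure t) \<in> R"
      "(\<Sum>t\<leftarrow>ts'. cross E F t) < pnorm v + e / 2"
    using pnorm_lessD[OF assms(1), of "pnorm u + e / 2"]
      pnorm_lessD[OF assms(2), of "pnorm v + e / 2"] by auto
  have "pnorm (u + v) \<le> (\<Sum>t\<leftarrow>ts @ ts'. cross E F t)"
    using ts ts' span_add[OF ts(2) ts'(2)] by (intro pnorm_le) (auto simp: algebra_simps)
  then show "pnorm (u + v) \<le> pnorm u + pnorm v + e"
    using ts ts' by simp
qed

lemma pnorm_scaleR_le:
  assumes "u \<in> formal"
  shows "pnorm (c *\<^sub>R u) \<le> \<bar>c\<bar> * pnorm u"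
proof (rule field_le_epsilon)
  fix e :: real assume "0 < e"
  define d where "d = e / (\<bar>c\<bar> + 1)"
  have d: "0 < d" "\<bar>c\<bar> * d \<le> e" using \<open>0 < e\<close> by (auto simp: d_def field_simps)
  obtain ts where ts: "set ts \<subseteq> tuples k E F" "u - (\<Sum>t\<leftarrow>ts. pure t) \<in> R"
      "(\<Sum>t\<leftarrow>ts. cross E F t) < pnorm u + d"
    using pnorm_lessD[OF assms, of "pnorm u + d"] d by auto
  have *: "c *\<^sub>R (\<Sum>t\<leftarrow>ts. pure t) - (\<Sum>t\<leftarrow>map (scale_tuple c) ts. pure t) \<in> R"
    using ts(1)
  proof (induction ts)
    case (Cons t ts)
    then show ?case
      using span_add[OF scale_tuple(3)[of t c], of "c *\<^sub>R (\<Sum>t\<leftarrow>ts. pure t) - (\<Sum>t\<leftarrow>map (scale_tuple c) ts. pure t)"]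
      by (simp add: algebra_simps)
  qed (simp add: span_zero)
  have "c *\<^sub>R (u - (\<Sum>t\<leftarrow>ts. pure t)) + (c *\<^sub>R (\<Sum>t\<leftarrow>ts. pure t) - (\<Sum>t\<leftarrow>map (scale_tuple c) ts. pure t)) \<in> R"
    by (intro span_add span_scale ts *)
  then have "pnorm (c *\<^sub>R u) \<le> (\<Sum>t\<leftarrow>map (scale_tuple c) ts. cross E F t)"
    using ts scale_tuple(1) by (intro pnorm_le) (auto simp: algebra_simps)
  also have "\<dots> \<le> (\<Sum>t\<leftarrow>ts. \<bar>c\<bar> * cross E F t)"
    unfolding map_map o_def using ts(1) by (intro sum_list_mono scale_tuple) auto
  also have "\<dots> = \<bar>c\<bar> * (\<Sum>t\<leftarrow>ts. cross E F t)" by (simp add: sum_list_const_mult)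
  also have "\<dots> \<le> \<bar>c\<bar> * (pnorm u + d)" using ts(3) by (intro mult_left_mono) auto
  finally show "pnorm (c *\<^sub>R u) \<le> \<bar>c\<bar> * pnorm u + e" using d by (simp add: algebra_simps)
qed

lemma pnorm_minus: "u \<in> formal \<Longrightarrow> pnorm (- u) \<le> pnorm u"
  using pnorm_scaleR_le[of u "-1"] by simp

lemma pnorm_diff_commute: "u \<in> formal \<Longrightarrow> v \<in> formal \<Longrightarrow> pnorm (u - v) = pnorm (v - u)"
  using pnorm_minus[of "u - v"] pnorm_minus[of "v - u"] by (simp add: formal_diff order_antisym)

lemma pnorm_triangle:
  "u \<in> formal \<Longrightarrow> v \<in> formal \<Longrightarrow> w \<in> formal \<Longrightarrow> pnorm (u - w) \<le> pnorm (u - v) + pnorm (v - w)"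
  using pnorm_add[of "u - v" "v - w"] by (simp add: formal_diff)

lemma pnorm_sum_le:
  "(\<And>i. i \<in> A \<Longrightarrow> u i \<in> formal) \<Longrightarrow> pnorm (\<Sum>i\<in>A. u i) \<le> (\<Sum>i\<in>A. pnorm (u i))"
proof (induction A rule: infinite_finite_induct)
  case (insert a A)
  then show ?case using pnorm_add[of "u a" "\<Sum>i\<in>A. u i"] by (force intro: formal_sum)
qed auto

lemma pnorm_pure_le: "t \<in> tuples k E F \<Longrightarrow> pnorm (pure t) \<le> cross E F t"
  using pnorm_le[of "[t]" "pure t"] by (simp add: span_zero)

lemma cauchyD: "u \<in> cauchy \<Longrightarrow> u n \<in> formal"
  by (auto simp: ct_cauchy_def formal_def)

lemma cauchy_const: "v \<in> formal \<Longrightarrow> (\<lambda>_. v) \<in> cauchy"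
  by (auto simp: ct_cauchy_def formal_def)

lemma cauchyI:
  assumes "\<And>n. u n \<in> formal" "\<And>e. 0 < e \<Longrightarrow> \<exists>N. \<forall>m\<ge>N. \<forall>n\<ge>N. pnorm (u m - u n) < e"
  shows "u \<in> cauchy"
  using assms by (auto simp: ct_cauchy_def formal_def)

lemma cauchy_less:
  "u \<in> cauchy \<Longrightarrow> 0 < e \<Longrightarrow> \<exists>N. \<forall>m\<ge>N. \<forall>n\<ge>N. pnorm (u m - u n) < e"
  by (simp add: ct_cauchy_def)

lemma cauchy_add:
  assumes "u \<in> cauchy" "v \<in> cauchy"
  shows "(\<lambda>n. u n + v n) \<in> cauchy"
proof (rule cauchyI)
  fix e :: real assume "0 < e"
  then obtain N M where NM: "\<forall>m\<ge>N. \<forall>n\<ge>N. pnorm (u m - u n) < e / 2"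
    "\<forall>m\<ge>M. \<forall>n\<ge>M. pnorm (v m - v n) < e / 2"
    using cauchy_less[OF assms(1), of "e/2"] cauchy_less[OF assms(2), of "e/2"] by auto
  have "pnorm (u m + v m - (u n + v n)) < e" if "m \<ge> max N M" "n \<ge> max N M" for m n
  proof -
    have "pnorm (u m + v m - (u n + v n)) \<le> pnorm (u m - u n) + pnorm (v m - v n)"
      using pnorm_add[of "u m - u n" "v m - v n"] cauchyD[OF assms(1)] cauchyD[OF assms(2)]
      by (simp add: formal_diff algebra_simps)
    also have "\<dots> < e / 2 + e / 2" using NM that by (intro add_strict_mono) auto
    finally show ?thesis by simp
  qed
  then show "\<exists>N. \<forall>m\<ge>N. \<forall>n\<ge>N. pnorm (u m + v m - (u n + v n)) < e" by blast
qed (intro formal_add cauchyD assms)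

text \<open>
  A single Lipschitz estimate serves scalar multiples and all bounded maps between tensor products.
\<close>

lemma cauchy_bounded_image:
  assumes u: "u \<in> ct_cauchy k' E' F'"
    and "\<And>n. v n \<in> formal" "\<And>m n. pnorm (v m - v n) \<le> C * proj_norm k' E' F' (u m - u n)" "0 \<le> C"
  shows "v \<in> cauchy"
proof (rule cauchyI)
  fix e :: real assume "0 < e"
  then have "0 < e / (C + 1)" using \<open>0 \<le> C\<close> by simp
  then obtain N where N: "\<forall>m\<ge>N. \<forall>n\<ge>N. proj_norm k' E' F' (u m - u n) < e / (C + 1)"
    using u unfolding ct_cauchy_def by blast
  have "pnorm (v m - v n) < e" if "m \<ge> N" "n \<ge> N" for m n
  proof -
    have "pnorm (v m - v n) \<le> C * (e / (C + 1))"
      by (rule order_trans[OF assms(3) mult_left_mono[OF less_imp_le \<open>0 \<le> C\<close>]])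
        (use N that in auto)
    also have "\<dots> < e" using \<open>0 < e\<close> \<open>0 \<le> C\<close> by (simp add: field_simps)
    finally show ?thesis .
  qed
  then show "\<exists>N. \<forall>m\<ge>N. \<forall>n\<ge>N. pnorm (v m - v n) < e" by blast
qed (use assms in auto)

lemma cauchy_scaleR: "u \<in> cauchy \<Longrightarrow> (\<lambda>n. c *\<^sub>R u n) \<in> cauchy"
  by (rule cauchy_bounded_image[of u k E F _ "\<bar>c\<bar>"])
    (simp_all add: scaleR_diff_right[symmetric] formal_scaleR cauchyD pnorm_scaleR_le formal_diff)

text \<open>
  Two Cauchy sequences define the same element of the completion iff they are equivalent.
\<close>

definition equivalent (infix "\<sim>" 50) where
  "u \<sim> v \<longleftrightarrow> (\<lambda>n. pnorm (u n - v n)) \<longlonglongrightarrow> 0"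

lemma equivalentI_le:
  assumes "\<And>n. u n \<in> formal" "\<And>n. v n \<in> formal" "\<And>n. pnorm (u n - v n) \<le> b n" "b \<longlonglongrightarrow> 0"
  shows "u \<sim> v"
  unfolding equivalent_def
  by (rule tendsto_sandwich[OF _ _ tendsto_const assms(4)])
    (use assms in \<open>auto intro!: always_eventually pnorm_nonneg formal_diff\<close>)

lemma equivalentI_R: "(\<And>n. u n - v n \<in> R) \<Longrightarrow> u \<sim> v"
  by (simp add: equivalent_def pnorm_in_R)

lemma equivalent_refl: "u \<sim> u"
  by (simp add: equivalent_def)

lemma equivalent_sym:
  assumes "\<And>n. u n \<in> formal" "\<And>n. v n \<in> formal" "u \<sim> v"
  shows "v \<sim> u"
  using assms by (simp add: equivalent_def pnorm_diff_commute)

lemma equivalent_trans: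
  assumes "\<And>n. u n \<in> formal" "\<And>n. v n \<in> formal" "\<And>n. w n \<in> formal" "u \<sim> v" "v \<sim> w"
  shows "u \<sim> w"
  by (rule equivalentI_le[where b="\<lambda>n. pnorm (u n - v n) + pnorm (v n - w n)"])
    (use assms tendsto_add[of "\<lambda>n. pnorm (u n - v n)" 0] in
      \<open>auto simp: equivalent_def intro: pnorm_triangle\<close>)

lemma equivalent_add:
  assumes "\<And>n. u n \<in> formal" "\<And>n. v n \<in> formal" "\<And>n. u' n \<in> formal" "\<And>n. v' n \<in> formal"
    and "u \<sim> u'" "v \<sim> v'"
  shows "(\<lambda>n. u n + v n) \<sim> (\<lambda>n. u' n + v' n)"
proof (rule equivalentI_le[where b="\<lambda>n. pnorm (u n - u' n) + pnorm (v n - v' n)"])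
  show "pnorm (u n + v n - (u' n + v' n)) \<le> pnorm (u n - u' n) + pnorm (v n - v' n)" for n
    using pnorm_add[of "u n - u' n" "v n - v' n"] assms by (simp add: formal_diff algebra_simps)
qed (use assms tendsto_add[of "\<lambda>n. pnorm (u n - u' n)" 0] in
      \<open>auto simp: equivalent_def intro: formal_add\<close>)

lemma equivalent_sum:
  assumes "\<And>i n. i \<in> A \<Longrightarrow> u i n \<in> formal" "\<And>i n. i \<in> A \<Longrightarrow> v i n \<in> formal"
    and "\<And>i. i \<in> A \<Longrightarrow> u i \<sim> v i"
  shows "(\<lambda>n. \<Sum>i\<in>A. u i n) \<sim> (\<lambda>n. \<Sum>i\<in>A. v i n)"
  using assms
  by (induction A rule: infinite_finite_induct)
    (auto intro!: equivalent_add formal_sum simp: equivalent_refl)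

lemma equivalent_scaleR:
  assumes "\<And>n. u n \<in> formal" "\<And>n. v n \<in> formal" "u \<sim> v"
  shows "(\<lambda>n. c *\<^sub>R u n) \<sim> (\<lambda>n. c *\<^sub>R v n)"
proof (rule equivalentI_le[where b="\<lambda>n. \<bar>c\<bar> * pnorm (u n - v n)"])
  show "pnorm (c *\<^sub>R u n - c *\<^sub>R v n) \<le> \<bar>c\<bar> * pnorm (u n - v n)" for n
    using pnorm_scaleR_le[of "u n - v n" c] assms by (simp add: formal_diff scaleR_diff_right)
qed (use assms in \<open>auto simp: equivalent_def intro: formal_scaleR tendsto_mult_right_zero\<close>)

lemma mem_cls_iff: "v \<in> cls u \<longleftrightarrow> v \<in> cauchy \<and> u \<sim> v"
  by (simp add: ct_class_def equivalent_def)

lemma cls_eqI: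
  assumes "u \<in> cauchy" "v \<in> cauchy" "u \<sim> v"
  shows "cls u = cls v"
proof -
  have f: "u n \<in> formal" "v n \<in> formal" for n using assms cauchyD by auto
  have "u \<sim> w \<longleftrightarrow> v \<sim> w" if "w \<in> cauchy" for w
    using equivalent_trans[OF f(1) f(2) cauchyD[OF that] assms(3)]
      equivalent_trans[OF f(2) f(1) cauchyD[OF that] equivalent_sym[OF f assms(3)]] by auto
  then show ?thesis by (auto simp: mem_cls_iff)
qed

lemma equivalent_sym_cauchy: "u \<in> cauchy \<Longrightarrow> v \<in> cauchy \<Longrightarrow> u \<sim> v \<Longrightarrow> v \<sim> u"
  using equivalent_sym cauchyD by blast

lemma self_mem_cls: "u \<in> cauchy \<Longrightarrow> u \<in> cls u"
  by (simp add: mem_cls_iff equivalent_refl)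

lemma cls_eq_iff: "u \<in> cauchy \<Longrightarrow> v \<in> cauchy \<Longrightarrow> cls u = cls v \<longleftrightarrow> u \<sim> v"
  using cls_eqI self_mem_cls mem_cls_iff by blast

lemma cls_in_ctensor: "u \<in> cauchy \<Longrightarrow> cls u \<in> ctensor k E F"
  by (simp add: ctensor_def)

lemma ctensorE:
  assumes "A \<in> ctensor k E F" obtains u where "u \<in> cauchy" "A = cls u"
  using assms by (auto simp: ctensor_def)

text \<open>
  The operations on classes are unions over all choices of representatives. They are well defined
  because all choices give the same class.
\<close>

lemma ct_add_cls:
  assumes "u \<in> cauchy" "v \<in> cauchy"
  shows "ct_add k E F (cls u) (cls v) = cls (\<lambda>n. u n + v n)"
proof -
  have "cls (\<lambda>n. u' n + v' n) = cls (\<lambda>n. u n + v n)" if "u' \<in> cls u" "v' \<in> cls v" for u' v'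
    using that assms
    by (intro cls_eqI cauchy_add equivalent_add)
      (simp_all add: mem_cls_iff cauchyD equivalent_sym_cauchy)
  then show ?thesis using assms self_mem_cls unfolding ct_add_def by blast
qed

lemma ct_scale_cls:
  assumes "u \<in> cauchy"
  shows "ct_scale k E F c (cls u) = cls (\<lambda>n. c *\<^sub>R u n)"
proof -
  have "cls (\<lambda>n. c *\<^sub>R u' n) = cls (\<lambda>n. c *\<^sub>R u n)" if "u' \<in> cls u" for u'
    using that assms
    by (intro cls_eqI cauchy_scaleR equivalent_scaleR)
      (simp_all add: mem_cls_iff cauchyD equivalent_sym_cauchy)
  then show ?thesis using assms self_mem_cls unfolding ct_scale_def by blast
qed

lemma ct_diff_cls:
  assumes "u \<in> cauchy" "v \<in> cauchy"
  shows "ct_diff k E F (cls u) (cls v) = cls (\<lambda>n. u n - v n)"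
proof -
  have "cls (\<lambda>n. u' n - v' n) = cls (\<lambda>n. u n - v n)" if "u' \<in> cls u" "v' \<in> cls v" for u' v'
  proof -
    have "(\<lambda>n. u' n + (-1) *\<^sub>R v' n) \<sim> (\<lambda>n. u n + (-1) *\<^sub>R v n)"
      using that assms
      by (intro equivalent_add equivalent_scaleR formal_scaleR)
        (simp_all add: mem_cls_iff cauchyD equivalent_sym_cauchy)
    moreover have "(\<lambda>n. u' n + (-1) *\<^sub>R v' n) \<in> cauchy" "(\<lambda>n. u n + (-1) *\<^sub>R v n) \<in> cauchy"
      using that assms by (simp_all only: mem_cls_iff cauchy_add cauchy_scaleR)
    ultimately show ?thesis using cls_eqI by simp
  qed
  then show ?thesis using assms self_mem_cls unfolding ct_diff_def by blast
qed

lemma partial_sums_formal: "(\<And>j. s j \<in> tuples k E F) \<Longrightarrow> (\<Sum>j\<in>A. pure (s j)) \<in> formal"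
  by (intro formal_sum formal_pure)

lemma cauchy_partial_sums:
  assumes s: "\<And>j. s j \<in> tuples k E F" and sm: "summable (\<lambda>j. cross E F (s j))"
  shows "(\<lambda>n. \<Sum>j<n. pure (s j)) \<in> cauchy"
proof (rule cauchyI)
  fix e :: real assume "0 < e"
  then obtain N where N: "\<And>m n. m \<ge> N \<Longrightarrow> norm (\<Sum>j=m..<n. cross E F (s j)) < e"
    using sm unfolding summable_Cauchy by blast
  have *: "pnorm ((\<Sum>j<n. pure (s j)) - (\<Sum>j<m. pure (s j))) < e" if "m \<le> n" "N \<le> m" for m n
  proof -
    have "(\<Sum>j<n. pure (s j)) - (\<Sum>j<m. pure (s j)) = (\<Sum>j=m..<n. pure (s j))"
      using that sum_diff_nat_ivl[of 0 m n "\<lambda>j. pure (s j)"] by (simp add: atLeast0LessThan)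
    also have "pnorm \<dots> \<le> (\<Sum>j=m..<n. pnorm (pure (s j)))"
      using s by (intro pnorm_sum_le formal_pure)
    also have "\<dots> \<le> (\<Sum>j=m..<n. cross E F (s j))" using s by (intro sum_mono pnorm_pure_le)
    also have "\<dots> < e" using N[OF that(2), of n] by simp
    finally show ?thesis .
  qed
  have "pnorm ((\<Sum>j<m. pure (s j)) - (\<Sum>j<n. pure (s j))) < e" if "N \<le> m" "N \<le> n" for m n
    using *[of m n] *[of n m] that
      pnorm_diff_commute[of "\<Sum>j<m. pure (s j)" "\<Sum>j<n. pure (s j)"] partial_sums_formal[of s] s
    by (cases "m \<le> n") auto
  then show "\<exists>N. \<forall>m\<ge>N. \<forall>n\<ge>N. pnorm ((\<Sum>j<m. pure (s j)) - (\<Sum>j<n. pure (s j))) < e" by blast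
qed (use s partial_sums_formal in auto)

end

section \<open>Tensor products of maps\<close>

text \<open>
  The map \<open>f \<otimes> g \<otimes> \<dots> \<otimes> g\<close> has norm at most \<open>C\<close>. Taking \<open>g\<close> to be a contraction keeps powers of its
  norm out of the estimates; restriction, multiplication by a function and passage to the quotient
  are all of this form.
\<close>

locale tensor_map = src: tensor k E F + tgt: tensor k E' F'
  for k :: nat and E :: "'b nspace" and F :: "'c nspace" and E' :: "'d nspace" and F' :: "'e nspace" +
  fixes f :: "'b \<Rightarrow> 'd" and g :: "'c \<Rightarrow> 'e" and C :: real
  assumes f_vecs: "x \<in> vecs E \<Longrightarrow> f x \<in> vecs E'"
    and f_add: "x \<in> vecs E \<Longrightarrow> x' \<in> vecs E \<Longrightarrow> f (vadd E x x') = vadd E' (f x) (f x')"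
    and f_scale: "x \<in> vecs E \<Longrightarrow> f (vscale E c x) = vscale E' c (f x)"
    and f_norm: "x \<in> vecs E \<Longrightarrow> vnorm E' (f x) \<le> C * vnorm E x"
    and C_nonneg: "0 \<le> C"
    and g_vecs: "y \<in> vecs F \<Longrightarrow> g y \<in> vecs F'"
    and g_add: "y \<in> vecs F \<Longrightarrow> z \<in> vecs F \<Longrightarrow> g (vadd F y z) = vadd F' (g y) (g z)"
    and g_scale: "y \<in> vecs F \<Longrightarrow> g (vscale F c y) = vscale F' c (g y)"
    and g_norm: "y \<in> vecs F \<Longrightarrow> vnorm F' (g y) \<le> vnorm F y"
begin

abbreviation tmap :: "'b \<times> 'c list \<Rightarrow> 'd \<times> 'e list" where
  "tmap \<equiv> (\<lambda>(x, ys). (f x, map g ys))"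

lemma tmap_tuples: "t \<in> tuples k E F \<Longrightarrow> tmap t \<in> tuples k E' F'"
  using f_vecs g_vecs by (force simp: tuples_def)

lemma cross_tmap:
  assumes "t \<in> tuples k E F"
  shows "cross E' F' (tmap t) \<le> C * cross E F t"
proof -
  obtain x ys where t: "t = (x, ys)" "x \<in> vecs E" "set ys \<subseteq> vecs F"
    using assms by (auto simp: tuples_def)
  have "prod_list (map (vnorm F' \<circ> g) ys) \<le> prod_list (map (vnorm F) ys)"
    using t g_norm g_vecs tgt.vnorm_F_nonneg by (intro prod_list_map_mono) auto
  moreover have "0 \<le> prod_list (map (vnorm F' \<circ> g) ys)"
    using t g_vecs tgt.vnorm_F_nonneg by (intro prod_list_nonneg) auto
  moreover have "0 \<le> C * vnorm E x"
    using C_nonneg src.seminormed_E t by (auto simp: seminormed_space_def)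
  ultimately show ?thesis
    using f_norm[of x] t by (auto simp: cross_def mult.assoc[symmetric] intro: mult_mono)
qed

lemma push_formal: "u \<in> src.formal \<Longrightarrow> push tmap u \<in> tgt.formal"
  by (subst push_superset[of "Poly_Mapping.keys u"])
    (use tmap_tuples in \<open>force simp: src.formal_def
      intro!: tgt.formal_sum tgt.formal_scaleR tgt.formal_pure\<close>)+

text \<open>
  Each of the four kinds of generators is mapped to a generator of the same kind.
\<close>

lemma push_R:
  assumes "u \<in> src.R"
  shows "push tmap u \<in> tgt.R"
proof -
  have "push tmap v \<in> tgt.R" if "v \<in> multilin_rel k E F" for v
  proof (rule span_base)
    from that[unfolded multilin_rel_def Un_iff mem_Collect_eq]
    show "push tmap v \<in> multilin_rel k E' F'"
    proof (elim disjE exE conjE)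
      fix x x' ys
      assume "v = pure (vadd E x x', ys) - (pure (x, ys) + pure (x', ys))"
        and *: "(x, ys) \<in> tuples k E F" "x' \<in> vecs E"
      moreover have "x \<in> vecs E" using * by (auto simp: tuples_def)
      ultimately have "push tmap v = pure (vadd E' (f x) (f x'), map g ys) -
            (pure (f x, map g ys) + pure (f x', map g ys)) \<and>
          (f x, map g ys) \<in> tuples k E' F' \<and> f x' \<in> vecs E'"
        using tmap_tuples[OF *(1)] f_vecs f_add by (simp add: push_diff push_add)
      then show ?thesis unfolding multilin_rel_def by blast
    next
      fix c x ys
      assume "v = pure (vscale E c x, ys) - c *\<^sub>R pure (x, ys)"
        and *: "(x, ys) \<in> tuples k E F"
      moreover have "x \<in> vecs E" using * by (auto simp: tuples_def)
      ultimately have "push tmap v = pure (vscale E' c (f x), map g ys) - c *\<^sub>R pure (f x, map g ys) \<and>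
          (f x, map g ys) \<in> tuples k E' F'"
        using tmap_tuples[OF *(1)] f_vecs f_scale by (simp add: push_diff push_scaleR)
      then show ?thesis unfolding multilin_rel_def by blast
    next
      fix x ys i y y'
      assume "v = pure (x, ys[i := vadd F y y']) - (pure (x, ys[i := y]) + pure (x, ys[i := y']))"
        and *: "(x, ys) \<in> tuples k E F" "i < k" "y \<in> vecs F" "y' \<in> vecs F"
      then have "push tmap v = pure (f x, (map g ys)[i := vadd F' (g y) (g y')]) -
            (pure (f x, (map g ys)[i := g y]) + pure (f x, (map g ys)[i := g y'])) \<and>
          (f x, map g ys) \<in> tuples k E' F' \<and> i < k \<and> g y \<in> vecs F' \<and> g y' \<in> vecs F'"
        using tmap_tuples[OF *(1)] g_vecs g_add by (simp add: push_diff push_add map_update)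
      then show ?thesis unfolding multilin_rel_def by blast
    next
      fix x ys i c y
      assume "v = pure (x, ys[i := vscale F c y]) - c *\<^sub>R pure (x, ys[i := y])"
        and *: "(x, ys) \<in> tuples k E F" "i < k" "y \<in> vecs F"
      then have "push tmap v = pure (f x, (map g ys)[i := vscale F' c (g y)]) -
            c *\<^sub>R pure (f x, (map g ys)[i := g y]) \<and>
          (f x, map g ys) \<in> tuples k E' F' \<and> i < k \<and> g y \<in> vecs F'"
        using tmap_tuples[OF *(1)] g_vecs g_scale by (simp add: push_diff push_scaleR map_update)
      then show ?thesis unfolding multilin_rel_def by blast
    qed
  qed
  then have "push tmap ` multilin_rel k E F \<subseteq> tgt.R" by auto
  then have "span (push tmap ` multilin_rel k E F) \<subseteq> tgt.R"
    by (rule span_minimal) (rule subspace_span)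
  with assms show ?thesis by (auto simp: linear_span_image[OF linear_push])
qed

lemma pnorm_push:
  assumes "u \<in> src.formal"
  shows "tgt.pnorm (push tmap u) \<le> C * src.pnorm u"
proof (rule field_le_epsilon)
  fix e :: real assume "0 < e"
  define d where "d = e / (C + 1)"
  have d: "0 < d" "C * d \<le> e" using \<open>0 < e\<close> C_nonneg by (auto simp: d_def field_simps)
  obtain ts where ts: "set ts \<subseteq> tuples k E F" "u - (\<Sum>t\<leftarrow>ts. pure t) \<in> src.R"
      "(\<Sum>t\<leftarrow>ts. cross E F t) < src.pnorm u + d"
    using src.pnorm_lessD[OF assms, of "src.pnorm u + d"] d by auto
  have "tgt.pnorm (push tmap u) \<le> (\<Sum>t\<leftarrow>map tmap ts. cross E' F' t)"
  proof (rule tgt.pnorm_le)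
    show "set (map tmap ts) \<subseteq> tuples k E' F'" using ts(1) tmap_tuples by auto
    show "push tmap u - (\<Sum>t\<leftarrow>map tmap ts. pure t) \<in> tgt.R"
      using push_R[OF ts(2)] by (simp only: push_diff push_sum_list)
  qed
  also have "\<dots> \<le> (\<Sum>t\<leftarrow>ts. C * cross E F t)"
    unfolding map_map o_def using ts(1) by (intro sum_list_mono cross_tmap) auto
  also have "\<dots> = C * (\<Sum>t\<leftarrow>ts. cross E F t)" by (simp add: sum_list_const_mult)
  also have "\<dots> \<le> C * (src.pnorm u + d)" using ts(3) C_nonneg by (intro mult_left_mono) auto
  finally show "tgt.pnorm (push tmap u) \<le> C * src.pnorm u + e" using d by (simp add: algebra_simps)
qed

lemma pnorm_push_diff:
  "u \<in> src.formal \<Longrightarrow> v \<in> src.formal \<Longrightarrow>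
     tgt.pnorm (push tmap u - push tmap v) \<le> C * src.pnorm (u - v)"
  using pnorm_push[of "u - v"] by (simp add: push_diff src.formal_diff)

lemma cauchy_push: "u \<in> src.cauchy \<Longrightarrow> (\<lambda>n. push tmap (u n)) \<in> tgt.cauchy"
  by (rule tgt.cauchy_bounded_image[of u k E F _ C])
    (simp_all add: push_formal src.cauchyD pnorm_push_diff C_nonneg)

lemma equivalent_push:
  assumes "\<And>n. u n \<in> src.formal" "\<And>n. v n \<in> src.formal" "src.equivalent u v"
  shows "tgt.equivalent (\<lambda>n. push tmap (u n)) (\<lambda>n. push tmap (v n))"
  by (rule tgt.equivalentI_le[of _ _ "\<lambda>n. C * src.pnorm (u n - v n)"])
    (use assms in \<open>simp_all add: push_formal pnorm_push_diff src.equivalent_def tendsto_mult_right_zero\<close>)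

lemma ct_map_cls:
  assumes "u \<in> src.cauchy"
  shows "ct_map k E' F' f g (src.cls u) = tgt.cls (\<lambda>n. push tmap (u n))"
proof -
  have "tgt.cls (\<lambda>n. push tmap (u' n)) = tgt.cls (\<lambda>n. push tmap (u n))" if "u' \<in> src.cls u" for u'
    using that assms
    by (intro tgt.cls_eqI cauchy_push equivalent_push)
      (simp_all add: src.mem_cls_iff src.cauchyD src.equivalent_sym_cauchy)
  then show ?thesis using assms src.self_mem_cls unfolding ct_map_def by blast
qed

end

text \<open>
  Head and tail are lifted with a common error \<open>d \<le> 1\<close>. If \<open>p\<close> is the product of the norms of the
  tail, then the product of the lifted norms exceeds \<open>N y * p\<close> by at most \<open>d * (N y + p + 1)\<close>.
\<close>

lemma near_optimal_prod_list_lift: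
  assumes "\<And>y e. y \<in> S \<Longrightarrow> 0 < e \<Longrightarrow> \<exists>y'\<in>S'. q y' = y \<and> N' y' \<le> N y + e"
    and "\<And>y. y \<in> S \<Longrightarrow> 0 \<le> N y" "\<And>y. y \<in> S' \<Longrightarrow> 0 \<le> N' y"
    and "set ys \<subseteq> S" "0 < (e::real)"
  shows "\<exists>ys'. set ys' \<subseteq> S' \<and> map q ys' = ys \<and> prod_list (map N' ys') \<le> prod_list (map N ys) + e"
  using assms(4,5)
proof (induction ys arbitrary: e)
  case Nil
  then show ?case by (intro exI[of _ "[]"]) auto
next
  case (Cons y ys)
  define p where "p = prod_list (map N ys)"
  have p: "0 \<le> p" unfolding p_def using Cons assms(2) by (intro prod_list_nonneg) auto
  have y: "y \<in> S" "0 \<le> N y" using Cons assms(2) by auto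
  define d where "d = min 1 (e / (N y + p + 1))"
  have d: "0 < d" "d \<le> 1"
    using Cons(3) p y by (auto simp: d_def)
  have "d * (N y + p + 1) \<le> e / (N y + p + 1) * (N y + p + 1)"
    using p y by (intro mult_right_mono) (auto simp: d_def)
  with p y have d3: "d * (N y + p + 1) \<le> e" by simp
  obtain y' where y': "y' \<in> S'" "q y' = y" "N' y' \<le> N y + d"
    using assms(1)[OF y(1) d(1)] by auto
  obtain ys' where ys': "set ys' \<subseteq> S'" "map q ys' = ys" "prod_list (map N' ys') \<le> p + d"
    using Cons.IH[OF _ d(1)] Cons.prems by (auto simp: p_def)
  have "0 \<le> prod_list (map N' ys')" using ys'(1) assms(3) by (intro prod_list_nonneg) auto
  then have "N' y' * prod_list (map N' ys') \<le> (N y + d) * (p + d)"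
    using y' ys' y d p assms(3) by (intro mult_mono) auto
  also have "\<dots> = N y * p + d * (N y + p + d)" by (simp add: algebra_simps)
  also have "\<dots> \<le> N y * p + d * (N y + p + 1)" using d by (intro add_left_mono mult_left_mono) auto
  also have "\<dots> \<le> N y * p + e" using d3 by simp
  finally show ?case using y' ys' by (intro exI[of _ "y' # ys'"]) (auto simp: p_def)
qed

text \<open>
  Here \<open>q\<close> is a metric surjection: the norm of an element is the infimum of the norms of its preimages.
\<close>

locale tensor_quotient = tensor_map k E F' E F id q 1
  for k :: nat and E :: "'b nspace" and F' :: "'d nspace" and F :: "'c nspace" and q :: "'d \<Rightarrow> 'c" +
  assumes lift_near_optimal:
    "y \<in> vecs F \<Longrightarrow> 0 < e \<Longrightarrow> \<exists>y'\<in>vecs F'. q y' = y \<and> vnorm F' y' \<le> vnorm F y + e"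
begin

lemma lift_tuple:
  assumes "t \<in> tuples k E F" "0 < e"
  shows "\<exists>t'\<in>tuples k E F'. tmap t' = t \<and> cross E F' t' \<le> cross E F t + e"
proof -
  obtain x ys where t: "t = (x, ys)" "x \<in> vecs E" "set ys \<subseteq> vecs F" "length ys = k"
    using assms by (auto simp: tuples_def)
  have x: "0 \<le> vnorm E x" using t tgt.seminormed_E by (auto simp: seminormed_space_def)
  then have "0 < e / (vnorm E x + 1)" using assms(2) by simp
  then obtain ys' where ys': "set ys' \<subseteq> vecs F'" "map q ys' = ys"
    "prod_list (map (vnorm F') ys') \<le> prod_list (map (vnorm F) ys) + e / (vnorm E x + 1)"
    using near_optimal_prod_list_lift[of "vecs F" "vecs F'" q "vnorm F'" "vnorm F" ys, OF lift_near_optimal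
        tgt.vnorm_F_nonneg src.vnorm_F_nonneg t(3)] by blast
  have "vnorm E x * prod_list (map (vnorm F') ys') \<le>
      vnorm E x * (prod_list (map (vnorm F) ys) + e / (vnorm E x + 1))"
    using x ys' by (intro mult_left_mono) auto
  also have "\<dots> \<le> vnorm E x * prod_list (map (vnorm F) ys) + e"
    using x assms(2) by (simp add: field_simps)
  finally have "cross E F' (x, ys') \<le> cross E F t + e" by (simp add: cross_def t)
  moreover have "(x, ys') \<in> tuples k E F'" "tmap (x, ys') = t"
    using t ys' by (auto simp: tuples_def)
  ultimately show ?thesis by blast
qed

lemma lift_tuple_list:
  assumes "set ts \<subseteq> tuples k E F" "0 < e"
  shows "\<exists>ts'. set ts' \<subseteq> tuples k E F' \<and> map tmap ts' = ts \<and>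
      (\<Sum>t\<leftarrow>ts'. cross E F' t) \<le> (\<Sum>t\<leftarrow>ts. cross E F t) + e"
  using assms
proof (induction ts arbitrary: e)
  case (Cons t ts)
  obtain t' where "t' \<in> tuples k E F'" "tmap t' = t" "cross E F' t' \<le> cross E F t + e / 2"
    using lift_tuple[of t "e / 2"] Cons.prems by auto
  moreover obtain ts' where "set ts' \<subseteq> tuples k E F'" "map tmap ts' = ts"
      "(\<Sum>t\<leftarrow>ts'. cross E F' t) \<le> (\<Sum>t\<leftarrow>ts. cross E F t) + e / 2"
    using Cons.IH[of "e / 2"] Cons.prems by auto
  ultimately show ?case by (intro exI[of _ "t' # ts'"]) auto
qed auto

text \<open>
  A Cauchy sequence has a subsequence whose \<open>i\<close>-th increment has norm below \<open>2\<^sup>-\<^sup>i\<close>. Each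
  increment is congruent to a finite block of tuples of almost optimal total norm, and each tuple has an
  almost optimal lift. Concatenating the blocks gives an absolutely convergent series, and its partial sums
  at the block ends are congruent to the subsequence. Since both sequences are Cauchy, agreement
  along these subsequences makes them equivalent.
\<close>

theorem ctensor_series_lift:
  assumes "A \<in> ctensor k E F"
  shows "\<exists>s. (\<forall>j. s j \<in> tuples k E F') \<and> summable (\<lambda>j. cross E F' (s j)) \<and>
      A = tgt.cls (\<lambda>n. \<Sum>j<n. pure (tmap (s j)))"
proof -
  obtain u where u: "u \<in> tgt.cauchy" "A = tgt.cls u" using assms by (rule tgt.ctensorE)
  have "\<forall>i. \<exists>N. \<forall>m\<ge>N. \<forall>n\<ge>N. tgt.pnorm (u m - u n) < (1/2) ^ i"
    using tgt.cauchy_less[OF u(1)] by simp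
  then obtain N where N: "\<And>i m n. m \<ge> N i \<Longrightarrow> n \<ge> N i \<Longrightarrow> tgt.pnorm (u m - u n) < (1/2) ^ i"
    by metis
  \<comment> \<open>Partial sums make the chosen indices increasing.\<close>
  define M where "M i = (\<Sum>l\<le>i. N l)" for i
  have M: "tgt.pnorm (u m - u n) < (1/2) ^ i" if "m \<ge> M i" "n \<ge> M i" for i m n
    using N[of i m n] that member_le_sum[of i "{..i}" N] by (simp add: M_def)
  define w where "w i = (case i of 0 \<Rightarrow> u (M 0) | Suc i' \<Rightarrow> u (M (Suc i')) - u (M i'))" for i
  have w_sum: "(\<Sum>i<Suc m. w i) = u (M m)" for m
    by (induction m) (simp_all add: w_def)
  have w_formal: "w i \<in> tgt.formal" for i
    using tgt.cauchyD[OF u(1)] by (auto simp: w_def tgt.formal_diff split: nat.split)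
  define b where "b i = (case i of 0 \<Rightarrow> tgt.pnorm (w 0) + 1 | Suc i' \<Rightarrow> (1/2) ^ i')" for i
  have "tgt.pnorm (w i) < b i" for i
    by (cases i) (use M in \<open>auto simp: w_def b_def M_def\<close>)
  then have "\<forall>i. \<exists>ts. set ts \<subseteq> tuples k E F \<and> w i - (\<Sum>t\<leftarrow>ts. pure t) \<in> tgt.R \<and>
      (\<Sum>t\<leftarrow>ts. cross E F t) < b i"
    using tgt.pnorm_lessD[OF w_formal] by blast
  then obtain ts where ts: "\<And>i. set (ts i) \<subseteq> tuples k E F"
    "\<And>i. w i - (\<Sum>t\<leftarrow>ts i. pure t) \<in> tgt.R" "\<And>i. (\<Sum>t\<leftarrow>ts i. cross E F t) < b i"
    by metis
  have "\<forall>i. \<exists>ts'. set ts' \<subseteq> tuples k E F' \<and> map tmap ts' = ts i \<and>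
      (\<Sum>t\<leftarrow>ts'. cross E F' t) \<le> (\<Sum>t\<leftarrow>ts i. cross E F t) + (1/2) ^ i"
    using lift_tuple_list[OF ts(1)] by simp
  then obtain ts' where ts': "\<And>i. set (ts' i) \<subseteq> tuples k E F'" "\<And>i. map tmap (ts' i) = ts i"
    "\<And>i. (\<Sum>t\<leftarrow>ts' i. cross E F' t) \<le> (\<Sum>t\<leftarrow>ts i. cross E F t) + (1/2) ^ i"
    by metis
  obtain x y where xy: "x \<in> vecs E" "y \<in> vecs F'"
    using src.seminormed_E src.seminormed_F by (auto simp: seminormed_space_def)
  \<comment> \<open>Each block of tuples starts with a null tuple, so that no block is empty.\<close>
  define z where "z = src.scale_tuple 0 (x, replicate k y)"
  have xy_t: "(x, replicate k y) \<in> tuples k E F'" using xy by (auto simp: tuples_def)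
  have z: "z \<in> tuples k E F'" "cross E F' z = 0" "pure (tmap z) \<in> tgt.R"
    using src.scale_tuple[OF xy_t, of 0] src.cross_nonneg[of z]
      push_R[of "pure z"] span_neg[of "- pure z"] by (auto simp: z_def)
  define L where "L m = concat (map (\<lambda>i. z # ts' i) [0..<m])" for m
  have L_Suc: "L (Suc m) = L m @ z # ts' m" for m by (simp add: L_def)
  have L_len: "m \<le> length (L m)" for m
    by (induction m) (auto simp: L_Suc)
  have L_prefix: "L m' ! j = L m ! j \<and> length (L m) \<le> length (L m')"
    if "m \<le> m'" "j < length (L m)" for m m' j
    using that by (induction m' rule: dec_induct) (auto simp: L_Suc nth_append)
  have L_tuples: "set (L m) \<subseteq> tuples k E F'" for m using ts' z by (auto simp: L_def)
  define s where "s j = L (Suc j) ! j" for j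
  have s_nth: "s j = L m ! j" if "j < length (L m)" for j m
    using L_prefix[of "Suc j" m j] L_prefix[of m "Suc j" j] L_len[of "Suc j"] that
    by (cases "m \<le> Suc j") (auto simp: s_def)
  have s_map: "map s [0..<length (L m)] = L m" for m
    by (rule nth_equalityI) (auto simp: s_nth)
  have s_tuples: "s j \<in> tuples k E F'" for j
    using L_tuples[of "Suc j"] L_len[of "Suc j"] nth_mem[of j "L (Suc j)"] by (auto simp: s_def)
  have s_sum: "(\<Sum>j<length (L m). h (s j)) = (\<Sum>t\<leftarrow>L m. h t)" for h :: "_ \<Rightarrow> 'z :: comm_monoid_add" and m
    by (subst s_map[symmetric])
      (simp add: o_def interv_sum_list_conv_sum_set_nat lessThan_atLeast0)
  have b_nonneg: "0 \<le> b i" for i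
    using tgt.sum_cross_nonneg[OF ts(1), of i] ts(3)[of i] by simp
  have sm_b: "summable b"
    by (subst summable_Suc_iff[symmetric]) (simp add: b_def summable_geometric)
  have L_cross: "(\<Sum>t\<leftarrow>L m. cross E F' t) \<le> (\<Sum>i<m. b i + (1/2) ^ i)" for m
  proof (induction m)
    case (Suc m)
    have "(\<Sum>t\<leftarrow>ts' m. cross E F' t) \<le> b m + (1/2) ^ m"
      using ts'(3)[of m] ts(3)[of m] by simp
    with Suc show ?case by (simp add: L_Suc z)
  qed (simp add: L_def)
  have sm: "summable (\<lambda>j. cross E F' (s j))"
  proof (rule summableI_nonneg_bounded)
    fix n
    have "(\<Sum>j<n. cross E F' (s j)) \<le> (\<Sum>j<length (L n). cross E F' (s j))"
      using L_len by (intro sum_mono2) (auto intro: src.cross_nonneg s_tuples)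
    also have "\<dots> \<le> (\<Sum>i<n. b i + (1/2) ^ i)" unfolding s_sum by (rule L_cross)
    also have "\<dots> \<le> suminf (\<lambda>i. b i + (1/2) ^ i)"
      using b_nonneg sm_b by (intro sum_le_suminf summable_add) (auto simp: summable_geometric)
    finally show "(\<Sum>j<n. cross E F' (s j)) \<le> suminf (\<lambda>i. b i + (1/2) ^ i)" .
  qed (rule src.cross_nonneg[OF s_tuples])
  define v where "v n = (\<Sum>j<n. pure (tmap (s j)))" for n
  have "v = (\<lambda>n. push tmap (\<Sum>j<n. pure (s j)))" by (simp add: v_def push_sum fun_eq_iff)
  with cauchy_push[OF src.cauchy_partial_sums[OF s_tuples sm]] have v: "v \<in> tgt.cauchy" by simp
  have v_L_eq: "v (length (L m)) = (\<Sum>t\<leftarrow>L m. pure (tmap t))" for m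
    unfolding v_def by (rule s_sum)
  \<comment> \<open>At the end of block \<open>m\<close> the new series has caught up with \<open>u (M m)\<close>.\<close>
  have v_L: "u (M m) - v (length (L (Suc m))) \<in> tgt.R" for m
  proof -
    have "(\<Sum>i<m. w i) - (\<Sum>t\<leftarrow>L m. pure (tmap t)) \<in> tgt.R" for m
    proof (induction m)
      case (Suc m)
      have "(\<Sum>t\<leftarrow>ts' m. pure (tmap t)) = (\<Sum>t\<leftarrow>ts m. pure t)"
        unfolding ts'(2)[symmetric] by (simp add: o_def)
      then have "(\<Sum>i<Suc m. w i) - (\<Sum>t\<leftarrow>L (Suc m). pure (tmap t)) =
         ((\<Sum>i<m. w i) - (\<Sum>t\<leftarrow>L m. pure (tmap t))) + (w m - (\<Sum>t\<leftarrow>ts m. pure t)) - pure (tmap z)"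
        by (simp add: L_Suc)
      also have "\<dots> \<in> tgt.R" by (intro span_diff span_add Suc ts z)
      finally show ?case .
    qed (simp add: L_def span_zero)
    from this[of "Suc m"] show ?thesis unfolding v_L_eq w_sum .
  qed
  have "tgt.equivalent u v"
    unfolding tgt.equivalent_def
  proof (rule LIMSEQ_I)
    fix e :: real assume "0 < e"
    then obtain J where J: "\<And>m n. m \<ge> J \<Longrightarrow> n \<ge> J \<Longrightarrow> tgt.pnorm (v m - v n) < e / 2"
      using tgt.cauchy_less[OF v, of "e / 2"] by auto
    obtain i0 where i0: "(1/2) ^ i0 < e / 2"
      using real_arch_pow_inv[of "e/2" "1/2"] \<open>0 < e\<close> by auto
    define i where "i = max i0 J"
    have "(1/2::real) ^ i \<le> (1/2) ^ i0" by (rule power_decreasing) (auto simp: i_def)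
    also note i0
    finally have i: "(1/2) ^ i < e / 2" .
    have "tgt.pnorm (u n - v n) < e" if n: "n \<ge> max (M i) J" for n
    proof -
      let ?l = "length (L (Suc i))"
      have "tgt.pnorm (u n - v n) \<le> tgt.pnorm (u n - u (M i)) + tgt.pnorm (u (M i) - v n)"
        using u v by (intro tgt.pnorm_triangle tgt.cauchyD)
      also have "tgt.pnorm (u (M i) - v n) \<le> tgt.pnorm (u (M i) - v ?l) + tgt.pnorm (v ?l - v n)"
        using u v by (intro tgt.pnorm_triangle tgt.cauchyD)
      also have "tgt.pnorm (u (M i) - v ?l) = 0" by (rule tgt.pnorm_in_R[OF v_L])
      finally have "tgt.pnorm (u n - v n) \<le> tgt.pnorm (u n - u (M i)) + tgt.pnorm (v ?l - v n)" by simp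
      moreover have "tgt.pnorm (u n - u (M i)) < e / 2" using M[of i n "M i"] n i by simp
      moreover have "tgt.pnorm (v ?l - v n) < e / 2"
        using L_len[of "Suc i"] n by (intro J) (auto simp: i_def)
      ultimately show ?thesis by simp
    qed
    then show "\<exists>no. \<forall>n\<ge>no. norm (tgt.pnorm (u n - v n) - 0) < e"
      using tgt.pnorm_nonneg[OF tgt.formal_diff[OF tgt.cauchyD[OF u(1)] tgt.cauchyD[OF v]]]
      by (intro exI[of _ "max (M i) J"]) auto
  qed
  then have "A = tgt.cls v" using u v tgt.cls_eqI by simp
  then show ?thesis using s_tuples sm unfolding v_def by blast
qed

end

section \<open>Lipschitz spaces modulo constants\<close>

lemma Lip_le: "C-lipschitz_on E f \<Longrightarrow> Lip E f \<le> C"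
  unfolding Lip_def by (rule cInf_lower) (auto intro!: bdd_belowI[of _ 0] lipschitz_on_nonneg)

text \<open>
  The infimum that defines \<open>Lip\<close> is attained, because the conditions on \<open>C\<close> are closed.
\<close>

lemma lipschitz_on_Lip:
  assumes "C-lipschitz_on E f"
  shows "(Lip E f)-lipschitz_on E f"
proof (rule lipschitz_onI)
  show "0 \<le> Lip E f"
    unfolding Lip_def by (rule cInf_greatest) (use assms in \<open>auto intro: lipschitz_on_nonneg\<close>)
  fix x y assume xy: "x \<in> E" "y \<in> E"
  show "dist (f x) (f y) \<le> Lip E f * dist x y"
  proof (cases "x = y")
    case False
    have "dist (f x) (f y) / dist x y \<le> Lip E f"
      unfolding Lip_def
      by (rule cInf_greatest) (use assms xy False in \<open>auto simp: divide_le_eq lipschitz_onD\<close>)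
    with False show ?thesis by (simp add: divide_le_eq)
  qed simp
qed

lemma Lip_nonneg: "C-lipschitz_on E f \<Longrightarrow> 0 \<le> Lip E f"
  using lipschitz_on_Lip lipschitz_on_nonneg by blast

lemma Lip_mono: "C-lipschitz_on V f \<Longrightarrow> U \<subseteq> V \<Longrightarrow> Lip U f \<le> Lip V f"
  by (rule Lip_le) (rule lipschitz_on_subset[OF lipschitz_on_Lip])

lemma supnorm_ge:
  assumes "\<And>x. x \<in> E \<Longrightarrow> \<bar>f x\<bar> \<le> B"
  shows "0 \<le> supnorm E f" "x \<in> E \<Longrightarrow> \<bar>f x\<bar> \<le> supnorm E f"
proof -
  have "bdd_above (insert 0 ((\<lambda>x. \<bar>f x\<bar>) ` E))"
    using assms by (auto intro!: bdd_aboveI[of _ "max 0 B"] simp: le_max_iff_disj)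
  then show "0 \<le> supnorm E f" "x \<in> E \<Longrightarrow> \<bar>f x\<bar> \<le> supnorm E f"
    unfolding supnorm_def by (auto intro: cSup_upper)
qed

lemma supnorm_le: "0 \<le> B \<Longrightarrow> (\<And>x. x \<in> E \<Longrightarrow> \<bar>f x\<bar> \<le> B) \<Longrightarrow> supnorm E f \<le> B"
  unfolding supnorm_def by (rule cSup_least) auto

lemma Lnorm_le:
  "C-lipschitz_on U f \<Longrightarrow> C \<le> B \<Longrightarrow> (\<And>x. x \<in> U \<Longrightarrow> \<bar>f x\<bar> \<le> B) \<Longrightarrow> Lnorm U f \<le> B"
  unfolding Lnorm_def using Lip_le[of C U f] lipschitz_on_nonneg[of C U f] supnorm_le[of B U f] by auto

lemma mem_LIP_inf:
  "f \<in> vecs (LIP_inf U) \<longleftrightarrow>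
     f \<in> extensional U \<and> (\<exists>C. C-lipschitz_on U f) \<and> (\<exists>B. \<forall>x\<in>U. \<bar>f x\<bar> \<le> B)"
  by (auto simp: LIP_inf_def bounded_iff)

lemma LIP_infD:
  assumes "f \<in> vecs (LIP_inf U)"
  shows "f \<in> extensional U" "(Lip U f)-lipschitz_on U f" "0 \<le> Lip U f" "Lip U f \<le> Lnorm U f"
    "0 \<le> Lnorm U f" "x \<in> U \<Longrightarrow> \<bar>f x\<bar> \<le> supnorm U f" "x \<in> U \<Longrightarrow> \<bar>f x\<bar> \<le> Lnorm U f"
    "0 \<le> supnorm U f" "(Lnorm U f)-lipschitz_on U f"
proof -
  obtain C B where CB: "f \<in> extensional U" "C-lipschitz_on U f" "\<And>x. x \<in> U \<Longrightarrow> \<bar>f x\<bar> \<le> B"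
    using assms by (auto simp: mem_LIP_inf)
  show *: "f \<in> extensional U" "(Lip U f)-lipschitz_on U f" "0 \<le> Lip U f" "Lip U f \<le> Lnorm U f"
    "0 \<le> Lnorm U f" "x \<in> U \<Longrightarrow> \<bar>f x\<bar> \<le> supnorm U f" "x \<in> U \<Longrightarrow> \<bar>f x\<bar> \<le> Lnorm U f"
    "0 \<le> supnorm U f"
    using CB lipschitz_on_Lip[OF CB(2)] Lip_nonneg[OF CB(2)] supnorm_ge[of U f B, OF CB(3)]
    by (auto simp: Lnorm_def le_max_iff_disj)
  show "(Lnorm U f)-lipschitz_on U f"
    using lipschitz_on_le[OF *(2,4)] .
qed

lemma LIP_infI:
  assumes "f \<in> extensional U" "C-lipschitz_on U f" "\<And>x. x \<in> U \<Longrightarrow> \<bar>f x\<bar> \<le> B"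
  shows "f \<in> vecs (LIP_inf U)"
  using assms by (auto simp: mem_LIP_inf)

lemma LIP_inf_simps [simp]:
  "vadd (LIP_inf U) f g = (\<lambda>x\<in>U. f x + g x)"
  "vscale (LIP_inf U) c f = (\<lambda>x\<in>U. c * f x)"
  "vnorm (LIP_inf U) = Lnorm U"
  by (simp_all add: LIP_inf_def)

lemma lipschitz_on_restrict [simp]: "C-lipschitz_on U (restrict f U) \<longleftrightarrow> C-lipschitz_on U f"
  by (auto simp: lipschitz_on_def)

lemma lipschitz_on_times:
  fixes f g :: "'a::metric_space \<Rightarrow> real"
  assumes f: "L-lipschitz_on U f" "\<And>x. x \<in> U \<Longrightarrow> \<bar>f x\<bar> \<le> A" "0 \<le> A"
    and g: "M-lipschitz_on U g" "\<And>x. x \<in> U \<Longrightarrow> \<bar>g x\<bar> \<le> B" "0 \<le> B"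
  shows "(L * B + A * M)-lipschitz_on U (\<lambda>x. f x * g x)"
proof (rule lipschitz_onI)
  show "0 \<le> L * B + A * M"
    using lipschitz_on_nonneg[OF f(1)] lipschitz_on_nonneg[OF g(1)] f(3) g(3) by simp
  fix x y assume xy: "x \<in> U" "y \<in> U"
  have "\<bar>f x * g x - f y * g y\<bar> = \<bar>(f x - f y) * g x + f y * (g x - g y)\<bar>"
    by (simp add: algebra_simps)
  also have "\<dots> \<le> \<bar>f x - f y\<bar> * \<bar>g x\<bar> + \<bar>f y\<bar> * \<bar>g x - g y\<bar>"
    by (metis abs_mult abs_triangle_ineq)
  also have "\<dots> \<le> (L * dist x y) * B + A * (M * dist x y)"
    using lipschitz_onD[OF f(1) xy] lipschitz_onD[OF g(1) xy] xy f g
      lipschitz_on_nonneg[OF f(1)]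
    by (intro add_mono mult_mono) (auto simp: dist_real_def)
  finally show "dist (f x * g x) (f y * g y) \<le> (L * B + A * M) * dist x y"
    by (simp add: dist_real_def algebra_simps)
qed

lemma restrict_LIP_inf:
  assumes "C-lipschitz_on U f" "C \<le> B" "\<And>x. x \<in> U \<Longrightarrow> \<bar>f x\<bar> \<le> B"
  shows "restrict f U \<in> vecs (LIP_inf U)" "Lnorm U (restrict f U) \<le> B"
proof -
  have C: "C-lipschitz_on U (restrict f U)" using assms by simp
  show "restrict f U \<in> vecs (LIP_inf U)"
    by (rule LIP_infI[of _ _ C B]) (use C assms in auto)
  show "Lnorm U (restrict f U) \<le> B"
    by (rule Lnorm_le[of C]) (use C assms in auto)
qed

lemma LIP_inf_vadd:
  assumes "f \<in> vecs (LIP_inf U)" "g \<in> vecs (LIP_inf U)"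
  shows "(\<lambda>x\<in>U. f x + g x) \<in> vecs (LIP_inf U)"
proof (rule restrict_LIP_inf(1))
  show "(Lnorm U f + Lnorm U g)-lipschitz_on U (\<lambda>x. f x + g x)"
    by (intro lipschitz_on_add LIP_infD assms)
  show "\<bar>f x + g x\<bar> \<le> Lnorm U f + Lnorm U g" if "x \<in> U" for x
    using LIP_infD(7)[OF assms(1) that] LIP_infD(7)[OF assms(2) that] by simp
qed simp

lemma LIP_inf_times:
  assumes f: "f \<in> vecs (LIP_inf U)"
    and \<phi>: "L-lipschitz_on U \<phi>" "\<And>x. x \<in> U \<Longrightarrow> \<bar>\<phi> x\<bar> \<le> B" "0 \<le> B"
  shows "(\<lambda>x\<in>U. \<phi> x * f x) \<in> vecs (LIP_inf U)" "Lnorm U (\<lambda>x\<in>U. \<phi> x * f x) \<le> (L + B) * Lnorm U f"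
proof -
  have *: "(L * Lnorm U f + B * Lnorm U f)-lipschitz_on U (\<lambda>x. \<phi> x * f x)"
    by (intro lipschitz_on_times LIP_infD f \<phi>)
  have **: "\<bar>\<phi> x * f x\<bar> \<le> (L + B) * Lnorm U f" if "x \<in> U" for x
  proof -
    have "\<bar>\<phi> x * f x\<bar> \<le> B * Lnorm U f"
      using that \<phi> LIP_infD(7)[OF f that] by (auto simp: abs_mult intro!: mult_mono)
    also have "\<dots> \<le> (L + B) * Lnorm U f"
      using lipschitz_on_nonneg[OF \<phi>(1)] LIP_infD(5)[OF f] by (intro mult_right_mono) auto
    finally show ?thesis .
  qed
  show "(\<lambda>x\<in>U. \<phi> x * f x) \<in> vecs (LIP_inf U)" "Lnorm U (\<lambda>x\<in>U. \<phi> x * f x) \<le> (L + B) * Lnorm U f"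
    by (rule restrict_LIP_inf[OF * _ **]; simp add: algebra_simps)+
qed

lemma LIP_inf_scale:
  assumes "f \<in> vecs (LIP_inf U)"
  shows "(\<lambda>x\<in>U. c * f x) \<in> vecs (LIP_inf U)" "Lnorm U (\<lambda>x\<in>U. c * f x) \<le> \<bar>c\<bar> * Lnorm U f"
  using LIP_inf_times[OF assms, of 0 "\<lambda>_. c" "\<bar>c\<bar>"] by (auto simp: lipschitz_on_def)

lemma LIP_inf_const: "(\<lambda>x\<in>U. c) \<in> vecs (LIP_inf U)"
  by (rule restrict_LIP_inf(1)[of 0 _ _ "\<bar>c\<bar>"]) (auto simp: lipschitz_on_def)

lemma LIP_inf_restrict:
  assumes "f \<in> vecs (LIP_inf V)" "W \<subseteq> V"
  shows "restrict f W \<in> vecs (LIP_inf W)" "Lnorm W (restrict f W) \<le> Lnorm V f"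
proof -
  have *: "(Lnorm V f)-lipschitz_on W f"
    using LIP_infD(9)[OF assms(1)] assms(2) by (auto intro: lipschitz_on_subset)
  have **: "\<bar>f x\<bar> \<le> Lnorm V f" if "x \<in> W" for x
    using LIP_infD(7)[OF assms(1)] assms(2) that by auto
  show "restrict f W \<in> vecs (LIP_inf W)" "Lnorm W (restrict f W) \<le> Lnorm V f"
    by (rule restrict_LIP_inf[OF * order_refl **]; assumption)+
qed

lemma seminormed_LIP_inf: "seminormed_space (LIP_inf U)"
proof -
  have "vecs (LIP_inf U) \<noteq> {}" using LIP_inf_const by blast
  then show ?thesis
    unfolding seminormed_space_def by (simp add: LIP_inf_vadd LIP_inf_scale LIP_infD(5))
qed

lemma mem_qmap: "g \<in> qmap U f \<longleftrightarrow> (\<exists>c. g = (\<lambda>x\<in>U. f x - c))"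
  by (auto simp: qmap_def)

lemma self_mem_qmap: "f \<in> extensional U \<Longrightarrow> f \<in> qmap U f"
  unfolding mem_qmap by (rule exI[of _ 0]) (auto simp: extensional_restrict)

lemma qmap_eqI:
  assumes "\<And>x. x \<in> U \<Longrightarrow> g x = f x - c"
  shows "qmap U g = qmap U f"
proof -
  have "(\<lambda>x\<in>U. g x - d) = (\<lambda>x\<in>U. f x - (c + d))" "(\<lambda>x\<in>U. f x - d) = (\<lambda>x\<in>U. g x - (d - c))" for d
    using assms by (auto simp: fun_eq_iff)
  then show ?thesis unfolding qmap_def by blast
qed

lemma qmap_eq: "g \<in> qmap U f \<Longrightarrow> qmap U g = qmap U f"
  unfolding mem_qmap by (elim exE, hypsubst, rule qmap_eqI) simp

lemma qmap_vecs:
  assumes "f \<in> vecs (LIP_inf U)" "g \<in> qmap U f"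
  shows "g \<in> vecs (LIP_inf U)"
proof -
  obtain c where "g = (\<lambda>x\<in>U. f x - c)" using assms mem_qmap by blast
  then have "g = (\<lambda>x\<in>U. f x + (\<lambda>x\<in>U. - c) x)" by auto
  then show ?thesis using LIP_inf_vadd[OF assms(1) LIP_inf_const] by simp
qed

lemma vecs_LIP_bar: "vecs (LIP_bar U) = qmap U ` vecs (LIP_inf U)"
  by (simp add: LIP_bar_def)

lemma LIP_bar_vadd: "vadd (LIP_bar U) (qmap U f) (qmap U g) = qmap U (\<lambda>x\<in>U. f x + g x)"
proof -
  have "qmap U (\<lambda>x\<in>U. f' x + g' x) = qmap U (\<lambda>x\<in>U. f x + g x)"
    if fg: "f' \<in> qmap U f" "g' \<in> qmap U g" for f' g'
  proof -
    obtain c d where "f' = (\<lambda>x\<in>U. f x - c)" "g' = (\<lambda>x\<in>U. g x - d)" using fg mem_qmap by metis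
    then show ?thesis by (intro qmap_eqI[of _ _ _ "c + d"]) auto
  qed
  moreover have "qmap U f \<noteq> {}" "qmap U g \<noteq> {}" by (auto simp: qmap_def)
  ultimately show ?thesis by (auto simp: LIP_bar_def)
qed

lemma LIP_bar_vscale: "vscale (LIP_bar U) c (qmap U f) = qmap U (\<lambda>x\<in>U. c * f x)"
proof -
  have "qmap U (\<lambda>x\<in>U. c * f' x) = qmap U (\<lambda>x\<in>U. c * f x)" if fg: "f' \<in> qmap U f" for f'
  proof -
    obtain d where "f' = (\<lambda>x\<in>U. f x - d)" using fg mem_qmap by metis
    then show ?thesis by (intro qmap_eqI[of _ _ _ "c * d"]) (auto simp: algebra_simps)
  qed
  moreover have "qmap U f \<noteq> {}" by (auto simp: qmap_def)
  ultimately show ?thesis by (auto simp: LIP_bar_def)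
qed

lemma LIP_bar_vnorm:
  assumes "f \<in> vecs (LIP_inf U)"
  shows "0 \<le> vnorm (LIP_bar U) (qmap U f)"
    "g \<in> qmap U f \<Longrightarrow> vnorm (LIP_bar U) (qmap U f) \<le> Lnorm U g"
    "0 < e \<Longrightarrow> \<exists>g\<in>qmap U f. Lnorm U g < vnorm (LIP_bar U) (qmap U f) + e"
proof -
  have L: "0 \<le> Lnorm U g" if "g \<in> qmap U f" for g
    using LIP_infD(5)[OF qmap_vecs[OF assms that]] .
  have ne: "Lnorm U ` qmap U f \<noteq> {}" by (auto simp: qmap_def)
  show "0 \<le> vnorm (LIP_bar U) (qmap U f)"
    unfolding LIP_bar_def using cInf_greatest[OF ne, of 0] L by auto
  show "g \<in> qmap U f \<Longrightarrow> vnorm (LIP_bar U) (qmap U f) \<le> Lnorm U g"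
    unfolding LIP_bar_def by (auto intro!: cInf_lower bdd_belowI[of _ 0] L)
  show "\<exists>g\<in>qmap U f. Lnorm U g < vnorm (LIP_bar U) (qmap U f) + e" if "0 < e"
    using cInf_lessD[OF ne, of "vnorm (LIP_bar U) (qmap U f) + e"] that
    by (auto simp: LIP_bar_def)
qed

lemma seminormed_LIP_bar: "seminormed_space (LIP_bar U)"
  unfolding seminormed_space_def
proof (intro conjI ballI allI)
  show "vecs (LIP_bar U) \<noteq> {}" using LIP_inf_const by (auto simp: vecs_LIP_bar)
  fix A assume "A \<in> vecs (LIP_bar U)"
  then obtain f where f: "A = qmap U f" "f \<in> vecs (LIP_inf U)" by (auto simp: vecs_LIP_bar)
  show "0 \<le> vnorm (LIP_bar U) A" using f LIP_bar_vnorm by auto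
  fix c :: real
  show "vscale (LIP_bar U) c A \<in> vecs (LIP_bar U)"
    using f LIP_inf_scale by (auto simp: vecs_LIP_bar LIP_bar_vscale)
  show "vnorm (LIP_bar U) (vscale (LIP_bar U) c A) \<le> \<bar>c\<bar> * vnorm (LIP_bar U) A"
  proof (rule field_le_epsilon)
    fix e :: real assume "0 < e"
    define d where "d = e / (\<bar>c\<bar> + 1)"
    have d: "0 < d" "\<bar>c\<bar> * d \<le> e" using \<open>0 < e\<close> by (auto simp: d_def field_simps)
    obtain g where g: "g \<in> qmap U f" "Lnorm U g < vnorm (LIP_bar U) A + d"
      using LIP_bar_vnorm(3)[OF f(2) d(1)] f(1) by auto
    have gv: "g \<in> vecs (LIP_inf U)" by (rule qmap_vecs[OF f(2) g(1)])
    have "vscale (LIP_bar U) c A = qmap U (\<lambda>x\<in>U. c * g x)"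
      unfolding f(1) qmap_eq[OF g(1), symmetric] LIP_bar_vscale ..
    then have "vnorm (LIP_bar U) (vscale (LIP_bar U) c A) \<le> Lnorm U (\<lambda>x\<in>U. c * g x)"
      using LIP_bar_vnorm(2)[OF LIP_inf_scale(1)[OF gv] self_mem_qmap] by simp
    also have "\<dots> \<le> \<bar>c\<bar> * Lnorm U g" by (rule LIP_inf_scale[OF gv])
    also have "\<dots> \<le> \<bar>c\<bar> * (vnorm (LIP_bar U) A + d)" using g by (intro mult_left_mono) auto
    finally show "vnorm (LIP_bar U) (vscale (LIP_bar U) c A) \<le> \<bar>c\<bar> * vnorm (LIP_bar U) A + e"
      using d by (simp add: algebra_simps)
  qed
next
  fix A B assume "A \<in> vecs (LIP_bar U)" "B \<in> vecs (LIP_bar U)"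
  then show "vadd (LIP_bar U) A B \<in> vecs (LIP_bar U)"
    by (auto simp: vecs_LIP_bar LIP_bar_vadd LIP_inf_vadd)
qed

lemma qmap_restrict:
  assumes "W \<subseteq> V"
  shows "(\<lambda>f. restrict f W) ` qmap V f = qmap W (restrict f W)"
proof -
  have eq: "restrict (\<lambda>x\<in>V. f x - c) W = (\<lambda>x\<in>W. restrict f W x - c)" for c
    using assms by (auto simp: fun_eq_iff)
  have "(\<lambda>f. restrict f W) ` qmap V f = range (\<lambda>c. restrict (\<lambda>x\<in>V. f x - c) W)"
    unfolding qmap_def by blast
  also have "\<dots> = qmap W (restrict f W)" unfolding eq qmap_def by blast
  finally show ?thesis .
qed

interpretation poly: tensor k "LIP_inf U" "LIP_inf U" for k U
  by unfold_locales (rule seminormed_LIP_inf)+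

interpretation bpoly: tensor k "LIP_inf U" "LIP_bar U" for k U
  by unfold_locales (rule seminormed_LIP_inf seminormed_LIP_bar)+

interpretation Q: tensor_quotient k "LIP_inf U" "LIP_inf U" "LIP_bar U" "qmap U" for k U
proof
  fix f assume f: "f \<in> vecs (LIP_inf U)"
  show "qmap U f \<in> vecs (LIP_bar U)" using f by (simp add: vecs_LIP_bar)
  show "vnorm (LIP_bar U) (qmap U f) \<le> vnorm (LIP_inf U) f"
    using LIP_bar_vnorm(2)[OF f self_mem_qmap] LIP_infD(1)[OF f] by simp
next
  fix A and e :: real assume A: "A \<in> vecs (LIP_bar U)" and e: "0 < e"
  then obtain f where f: "A = qmap U f" "f \<in> vecs (LIP_inf U)" by (auto simp: vecs_LIP_bar)
  obtain g where g: "g \<in> qmap U f" "Lnorm U g < vnorm (LIP_bar U) A + e"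
    using LIP_bar_vnorm(3)[OF f(2) e] f(1) by auto
  then show "\<exists>g\<in>vecs (LIP_inf U). qmap U g = A \<and> vnorm (LIP_inf U) g \<le> vnorm (LIP_bar U) A + e"
    using qmap_vecs[OF f(2) g(1)] qmap_eq[OF g(1)] f(1) by (intro bexI[of _ g]) simp_all
qed (simp_all add: LIP_bar_vadd LIP_bar_vscale)

lemma tensor_map_restrict:
  assumes "W \<subseteq> V"
  shows "tensor_map (LIP_inf V) (LIP_bar V) (LIP_inf W) (LIP_bar W)
    (\<lambda>f. restrict f W) (\<lambda>A. (\<lambda>f. restrict f W) ` A) 1"
proof
  fix f f' and c :: real assume f: "f \<in> vecs (LIP_inf V)"
  show "restrict f W \<in> vecs (LIP_inf W)" using LIP_inf_restrict[OF f assms] by simp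
  show "vnorm (LIP_inf W) (restrict f W) \<le> 1 * vnorm (LIP_inf V) f"
    using LIP_inf_restrict[OF f assms] by simp
  show "restrict (vscale (LIP_inf V) c f) W = vscale (LIP_inf W) c (restrict f W)"
    "restrict (vadd (LIP_inf V) f f') W = vadd (LIP_inf W) (restrict f W) (restrict f' W)"
    using assms by (auto simp: fun_eq_iff)
next
  fix A A' and c :: real assume "A \<in> vecs (LIP_bar V)"
  then obtain f where f: "A = qmap V f" "f \<in> vecs (LIP_inf V)" by (auto simp: vecs_LIP_bar)
  show "(\<lambda>f. restrict f W) ` A \<in> vecs (LIP_bar W)"
    using LIP_inf_restrict(1)[OF f(2) assms] by (simp add: f(1) qmap_restrict[OF assms] vecs_LIP_bar)
  have eq: "(\<lambda>x\<in>W. c * restrict f W x) = restrict (\<lambda>x\<in>V. c * f x) W"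
    using assms by (auto simp: fun_eq_iff)
  show "(\<lambda>f. restrict f W) ` vscale (LIP_bar V) c A = vscale (LIP_bar W) c ((\<lambda>f. restrict f W) ` A)"
    unfolding f(1) LIP_bar_vscale qmap_restrict[OF assms] eq ..
  show "vnorm (LIP_bar W) ((\<lambda>f. restrict f W) ` A) \<le> vnorm (LIP_bar V) A"
  proof (rule field_le_epsilon)
    fix e :: real assume "0 < e"
    then obtain g where g: "g \<in> qmap V f" "Lnorm V g < vnorm (LIP_bar V) A + e"
      using LIP_bar_vnorm(3)[OF f(2)] f(1) by auto
    then have "restrict g W \<in> qmap W (restrict f W)"
      unfolding qmap_restrict[OF assms, symmetric] by (intro imageI)
    then have "vnorm (LIP_bar W) ((\<lambda>f. restrict f W) ` A) \<le> Lnorm W (restrict g W)"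
      unfolding f(1) qmap_restrict[OF assms]
      by (rule LIP_bar_vnorm(2)[OF LIP_inf_restrict(1)[OF f(2) assms]])
    also have "\<dots> \<le> Lnorm V g" by (rule LIP_inf_restrict[OF qmap_vecs[OF f(2) g(1)] assms])
    finally show "vnorm (LIP_bar W) ((\<lambda>f. restrict f W) ` A) \<le> vnorm (LIP_bar V) A + e"
      using g by simp
  qed
  assume "A' \<in> vecs (LIP_bar V)"
  then obtain f' where f': "A' = qmap V f'" "f' \<in> vecs (LIP_inf V)" by (auto simp: vecs_LIP_bar)
  have eq: "(\<lambda>x\<in>W. restrict f W x + restrict f' W x) = restrict (\<lambda>x\<in>V. f x + f' x) W"
    using assms by (auto simp: fun_eq_iff)
  show "(\<lambda>f. restrict f W) ` vadd (LIP_bar V) A A' =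
      vadd (LIP_bar W) ((\<lambda>f. restrict f W) ` A) ((\<lambda>f. restrict f W) ` A')"
    unfolding f(1) f'(1) LIP_bar_vadd qmap_restrict[OF assms] eq ..
qed simp

text \<open>
  Multiplication of the first factor by a bounded Lipschitz function makes the tensor product a
  module over such functions. Cutoff functions act on forms in this way.
\<close>

lemma tensor_map_times:
  assumes \<phi>: "L-lipschitz_on W \<phi>" "\<And>x. x \<in> W \<Longrightarrow> \<bar>\<phi> x\<bar> \<le> B" "0 \<le> B"
  shows "tensor_map (LIP_inf W) (LIP_bar W) (LIP_inf W) (LIP_bar W)
    (\<lambda>f. \<lambda>x\<in>W. \<phi> x * f x) id (L + B)"
proof
  fix f f' and c :: real assume f: "f \<in> vecs (LIP_inf W)"
  show "(\<lambda>x\<in>W. \<phi> x * f x) \<in> vecs (LIP_inf W)"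
    "vnorm (LIP_inf W) (\<lambda>x\<in>W. \<phi> x * f x) \<le> (L + B) * vnorm (LIP_inf W) f"
    unfolding LIP_inf_simps by (rule LIP_inf_times[OF f \<phi>]; assumption)+
  show "(\<lambda>x\<in>W. \<phi> x * vscale (LIP_inf W) c f x) = vscale (LIP_inf W) c (\<lambda>x\<in>W. \<phi> x * f x)"
    "(\<lambda>x\<in>W. \<phi> x * vadd (LIP_inf W) f f' x) =
      vadd (LIP_inf W) (\<lambda>x\<in>W. \<phi> x * f x) (\<lambda>x\<in>W. \<phi> x * f' x)"
    by (simp_all add: fun_eq_iff distrib_left mult.left_commute)
qed (use lipschitz_on_nonneg[OF \<phi>(1)] \<phi>(3) in simp_all)

text \<open>
  The function \<open>x \<mapsto> inf\<^sub>y f y + L dist x y\<close> extends \<open>f\<close>; truncation preserves both its Lipschitz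
  constant and its values on \<open>E\<close>.
\<close>

lemma mcshane_extension:
  fixes f :: "'a::metric_space \<Rightarrow> real"
  assumes f: "L-lipschitz_on E f" "\<And>x. x \<in> E \<Longrightarrow> \<bar>f x\<bar> \<le> B" and "E \<noteq> {}"
  obtains g where "L-lipschitz_on UNIV g" "\<And>x. x \<in> E \<Longrightarrow> g x = f x" "\<And>x. \<bar>g x\<bar> \<le> B"
proof -
  have L: "0 \<le> L" using f lipschitz_on_nonneg by blast
  \<comment> \<open>The largest \<open>L\<close>-Lipschitz function that is at most \<open>f\<close> on \<open>E\<close>.\<close>
  define h where "h x = (INF y\<in>E. f y + L * dist x y)" for x
  have bdd: "bdd_below ((\<lambda>y. f y + L * dist x y) ` E)" for x
  proof (rule bdd_belowI2)
    fix y assume "y \<in> E"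
    then have "- B \<le> f y" using f(2)[of y] by linarith
    then show "- B \<le> f y + L * dist x y" using L by (simp add: add_increasing2)
  qed
  have h_le: "h x \<le> h y + L * dist x y" for x y
  proof -
    have "h x - L * dist x y \<le> h y"
      unfolding h_def[of y]
    proof (rule cINF_greatest)
      fix z assume "z \<in> E"
      then have "h x \<le> f z + L * dist x z" unfolding h_def by (rule cINF_lower[OF bdd])
      also have "L * dist x z \<le> L * (dist x y + dist y z)"
        by (intro mult_left_mono dist_triangle L)
      finally show "h x - L * dist x y \<le> f z + L * dist y z" by (simp add: algebra_simps)
    qed (rule assms)
    then show ?thesis by simp
  qed
  have h_eq: "h x = f x" if "x \<in> E" for x
  proof (rule antisym)
    show "h x \<le> f x" using cINF_lower[OF bdd that, of x] by (simp add: h_def)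
    show "f x \<le> h x" unfolding h_def
    proof (rule cINF_greatest)
      fix y assume "y \<in> E"
      then show "f x \<le> f y + L * dist x y"
        using lipschitz_onD[OF f(1) that, of y] by (simp add: dist_real_def)
    qed (rule assms)
  qed
  define g where "g x = max (- B) (min B (h x))" for x
  have "\<bar>g x - g y\<bar> \<le> L * dist x y" for x y
  proof -
    have "\<bar>g x - g y\<bar> \<le> \<bar>h x - h y\<bar>" by (auto simp: g_def)
    also have "\<dots> \<le> L * dist x y" using h_le[of x y] h_le[of y x] by (auto simp: dist_commute)
    finally show ?thesis .
  qed
  then have "L-lipschitz_on UNIV g" by (intro lipschitz_onI L) (auto simp: dist_real_def)
  moreover have "g x = f x" if "x \<in> E" for x
    using f(2)[OF that] by (simp add: g_def h_eq[OF that] abs_le_iff)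
  moreover have "\<bar>g x\<bar> \<le> B" for x
  proof -
    obtain y where "y \<in> E" using \<open>E \<noteq> {}\<close> by blast
    then have "0 \<le> B" using f(2)[of y] by linarith
    then show ?thesis by (auto simp: g_def)
  qed
  ultimately show ?thesis by (rule that)
qed

text \<open>
  Only pairs with \<open>x \<in> S\<close> and \<open>y \<notin> S\<close> need an argument beyond the product rule. There \<open>\<phi> y = 0\<close>, so
  \<open>\<bar>\<phi> x\<bar> \<le> L * dist x y\<close>.
\<close>

lemma lipschitz_on_cutoff:
  fixes \<phi> f :: "'a::metric_space \<Rightarrow> real"
  assumes \<phi>: "L-lipschitz_on UNIV \<phi>" "\<And>x. \<bar>\<phi> x\<bar> \<le> A" "\<And>x. x \<notin> S \<Longrightarrow> \<phi> x = 0"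
    and f: "M-lipschitz_on S f" "\<And>x. x \<in> S \<Longrightarrow> \<bar>f x\<bar> \<le> B" "0 \<le> B"
  shows "(L * B + A * M)-lipschitz_on UNIV (\<lambda>x. if x \<in> S then \<phi> x * f x else 0)"
proof -
  let ?h = "\<lambda>x. if x \<in> S then \<phi> x * f x else 0"
  have A: "0 \<le> A" using order_trans[OF abs_ge_zero \<phi>(2)] .
  have LM: "0 \<le> L" "0 \<le> M" using \<phi> f lipschitz_on_nonneg by auto
  have in_S: "(L * B + A * M)-lipschitz_on S (\<lambda>x. \<phi> x * f x)"
    using lipschitz_on_subset[OF \<phi>(1)] \<phi> f A by (intro lipschitz_on_times) auto
  have out: "\<bar>?h x\<bar> \<le> (L * B + A * M) * dist x y" if "x \<in> S" "y \<notin> S" for x y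
  proof -
    have "\<bar>\<phi> x\<bar> \<le> L * dist x y"
      using lipschitz_onD[OF \<phi>(1), of x y] \<phi>(3)[OF that(2)] by (simp add: dist_real_def)
    then have "\<bar>?h x\<bar> \<le> (L * dist x y) * B"
      using f(2)[OF that(1)] that LM by (auto simp: abs_mult intro!: mult_mono)
    also have "\<dots> \<le> (L * B + A * M) * dist x y"
      using A LM by (simp add: algebra_simps)
    finally show ?thesis .
  qed
  show ?thesis
  proof (rule lipschitz_onI)
    show "0 \<le> L * B + A * M" using in_S lipschitz_on_nonneg by blast
    fix x y
    show "dist (?h x) (?h y) \<le> (L * B + A * M) * dist x y"
      using lipschitz_onD[OF in_S, of x y] out[of x y] out[of y x] A LM f(3)
      by (cases "x \<in> S"; cases "y \<in> S") (auto simp: dist_commute dist_real_def)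
  qed
qed

section \<open>Germs and global sections\<close>

abbreviation bcls where "bcls k U \<equiv> ct_class k (LIP_inf U) (LIP_bar U)"
abbreviation bcauchy where "bcauchy k U \<equiv> ct_cauchy k (LIP_inf U) (LIP_bar U)"
abbreviation bequiv where "bequiv k U \<equiv> tensor.equivalent k (LIP_inf U) (LIP_bar U)"
abbreviation btuples where "btuples k U \<equiv> tuples k (LIP_inf U) (LIP_bar U)"
abbreviation bformal where "bformal k U \<equiv> tensor.formal k (LIP_inf U) (LIP_bar U)"

abbreviation brel where "brel k U \<equiv> span (multilin_rel k (LIP_inf U) (LIP_bar U))"
abbreviation badd where "badd k U \<equiv> ct_add k (LIP_inf U) (LIP_bar U)"
abbreviation bscale where "bscale k U \<equiv> ct_scale k (LIP_inf U) (LIP_bar U)"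

abbreviation res :: "'a set \<Rightarrow> ('a \<Rightarrow> real) \<times> ('a \<Rightarrow> real) set list \<Rightarrow> ('a \<Rightarrow> real) \<times> ('a \<Rightarrow> real) set list"
  where "res W \<equiv> (\<lambda>(f, As). (restrict f W, map (\<lambda>A. (\<lambda>f. restrict f W) ` A) As))"

lemma bres_bcls:
  assumes "W \<subseteq> V" "u \<in> bcauchy k V"
  shows "bres k W (bcls k V u) = bcls k W (\<lambda>n. push (res W) (u n))"
    "(\<lambda>n. push (res W) (u n)) \<in> bcauchy k W"
proof -
  interpret r: tensor_map k "LIP_inf V" "LIP_bar V" "LIP_inf W" "LIP_bar W"
      "\<lambda>f. restrict f W" "\<lambda>A. (\<lambda>f. restrict f W) ` A" 1
    by (rule tensor_map_restrict[OF assms(1)])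
  show "bres k W (bcls k V u) = bcls k W (\<lambda>n. push (res W) (u n))"
    unfolding bres_def by (rule r.ct_map_cls[OF assms(2)])
  show "(\<lambda>n. push (res W) (u n)) \<in> bcauchy k W"
    by (rule r.cauchy_push[OF assms(2)])
qed

lemma bPolyE:
  assumes "b \<in> bPoly k U"
  obtains u where "u \<in> bcauchy k U" "b = bcls k U u"
  using bpoly.ctensorE assms unfolding bPoly_def by blast

lemma bcls_bPoly: "u \<in> bcauchy k U \<Longrightarrow> bcls k U u \<in> bPoly k U"
  unfolding bPoly_def by (rule bpoly.cls_in_ctensor)

lemma bres_bPoly: "W \<subseteq> V \<Longrightarrow> b \<in> bPoly k V \<Longrightarrow> bres k W b \<in> bPoly k W"
  by (elim bPolyE) (simp add: bres_bcls bcls_bPoly)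

lemma bres_bres:
  assumes "W' \<subseteq> W" "W \<subseteq> V" "b \<in> bPoly k V"
  shows "bres k W' (bres k W b) = bres k W' b"
proof -
  obtain u where u: "u \<in> bcauchy k V" "b = bcls k V u" using bPolyE[OF assms(3)] .
  have "W \<inter> W' = W'" using assms by auto
  then have "res W' (res W t) = res W' t" for t :: "('a \<Rightarrow> real) \<times> ('a \<Rightarrow> real) set list"
    by (cases t) (simp add: image_image)
  then have "push (res W') (push (res W) v) = push (res W') v" for v
    unfolding push_compose by presburger
  then show ?thesis
    using u assms bres_bcls[of W V u k] bres_bcls[of W' W _ k] bres_bcls[of W' V u k] by simp
qed

lemma mem_germ_self: "open U \<Longrightarrow> x \<in> U \<Longrightarrow> b \<in> bPoly k U \<Longrightarrow> (U, b) \<in> germ k x U b"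
  unfolding germ_def by blast

lemma bres_eq_subset:
  assumes "bres k W b = bres k W c" "W' \<subseteq> W" "W \<subseteq> U" "W \<subseteq> V" "b \<in> bPoly k U" "c \<in> bPoly k V"
  shows "bres k W' b = bres k W' c"
  using bres_bres[OF assms(2,3,5)] bres_bres[OF assms(2,4,6)] assms(1) by simp

lemma germ_subsetI:
  assumes U: "b \<in> bPoly k U" and V: "c \<in> bPoly k V"
    and W: "open W" "x \<in> W" "W \<subseteq> U" "W \<subseteq> V" "bres k W b = bres k W c"
  shows "germ k x U b \<subseteq> germ k x V c"
proof
  fix p assume "p \<in> germ k x U b"
  then obtain V' d W' where p: "p = (V', d)" "open V'" "x \<in> V'" "d \<in> bPoly k V'"
    and W': "open W'" "x \<in> W'" "W' \<subseteq> U" "W' \<subseteq> V'" "bres k W' b = bres k W' d"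
    unfolding germ_def by blast
  let ?W = "W \<inter> W'"
  have "bres k ?W b = bres k ?W c" by (rule bres_eq_subset[OF W(5) _ W(3,4) U V]) simp
  moreover have "bres k ?W b = bres k ?W d" by (rule bres_eq_subset[OF W'(5) _ W'(3,4) U p(4)]) simp
  ultimately have eq: "bres k ?W c = bres k ?W d" by (rule trans[OF sym])
  have "open ?W" "x \<in> ?W" "?W \<subseteq> V \<inter> V'" using W(1,2,4) W'(1,2,4) by auto
  then show "p \<in> germ k x V c"
    unfolding germ_def p(1) mem_Collect_eq prod.case using p(2-4) eq
    by (intro conjI exI[of _ ?W])
qed

lemma germ_eqI:
  assumes U: "b \<in> bPoly k U" and V: "c \<in> bPoly k V"
    and W: "open W" "x \<in> W" "W \<subseteq> U" "W \<subseteq> V" "bres k W b = bres k W c"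
  shows "germ k x U b = germ k x V c"
  by (rule subset_antisym) 
    (rule germ_subsetI[OF U V W] germ_subsetI[OF V U W(1,2,4,3) W(5)[symmetric]])+

lemma germ_eqD:
  assumes "germ k x U b = germ k x V c" "open V" "x \<in> V" "c \<in> bPoly k V"
  obtains W where "open W" "x \<in> W" "W \<subseteq> U" "W \<subseteq> V" "bres k W b = bres k W c"
proof -
  have "(V, c) \<in> germ k x U b"
    unfolding assms(1) by (rule mem_germ_self[OF assms(2-4)])
  then obtain W where W: "open W" "x \<in> W" "W \<subseteq> U \<inter> V" "bres k W b = bres k W c"
    unfolding germ_def by blast
  then have "W \<subseteq> U" "W \<subseteq> V" by auto
  then show ?thesis using that[OF W(1,2)] W(4) by (simp only:)
qed

lemma germ_bres:
  assumes "b \<in> bPoly k U" "open W" "x \<in> W" "W \<subseteq> U"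
  shows "germ k x W (bres k W b) = germ k x U b"
  using assms by (intro germ_eqI[of _ _ _ _ _ W]) (auto simp: bres_bPoly bres_bres)

text \<open>
  The open sets that occur in a germ at \<open>x\<close> can be shrunk so as to avoid any other point.
\<close>

lemma germ_eq_imp_same_point:
  assumes "germ k x U b = germ k y V c" "open U" "x \<in> U" "b \<in> bPoly k U"
  shows "x = y"
proof (rule ccontr)
  assume "x \<noteq> y"
  let ?W = "U - {y}"
  have W: "open ?W" "x \<in> ?W" using assms \<open>x \<noteq> y\<close> by auto
  have "(?W, bres k ?W b) \<in> germ k x ?W (bres k ?W b)"
    using W assms by (intro mem_germ_self bres_bPoly) auto
  also have "\<dots> = germ k y V c" using W assms germ_bres[of b k U ?W x] by auto
  finally show False unfolding germ_def by auto
qed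

text \<open>
  This is the meaning of continuity for the topology of the etale space: a section agrees near \<open>x\<close>
  with the germs of any element that represents it at \<open>x\<close>.
\<close>

lemma section_locally:
  assumes "\<omega> \<in> bGamma k" "\<omega> x = germ k x U b" "open U" "x \<in> U" "b \<in> bPoly k U"
  obtains W where "open W" "x \<in> W" "W \<subseteq> U" "\<And>y. y \<in> W \<Longrightarrow> \<omega> y = germ k y U b"
proof
  let ?O = "(\<lambda>x. germ k x U b) ` U"
  have "openin (etale_topology k) ?O"
    unfolding etale_topology_def using assms by (intro topology_generated_by_Basis) blast
  then have "openin euclidean {y \<in> topspace euclidean. \<omega> y \<in> ?O}"
    using assms(1) unfolding bGamma_def by (blast intro: openin_continuous_map_preimage)
  then show "open {y. \<omega> y \<in> ?O}" by simp
  have eq: "y \<in> U \<and> \<omega> y = germ k y U b" if y: "\<omega> y \<in> ?O" for y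
  proof -
    obtain z where z: "z \<in> U" "\<omega> y = germ k z U b" using y by blast
    obtain V c where "open V" "y \<in> V" "c \<in> bPoly k V" "\<omega> y = germ k y V c"
      using assms(1) unfolding bGamma_def stalk_def by blast
    then have "y = z" using germ_eq_imp_same_point[of k y V c z U b] z(2) by simp
    with z show ?thesis by (simp only: simp_thms)
  qed
  then show "{y. \<omega> y \<in> ?O} \<subseteq> U" "\<And>y. y \<in> {y. \<omega> y \<in> ?O} \<Longrightarrow> \<omega> y = germ k y U b" by blast+
  show "x \<in> {y. \<omega> y \<in> ?O}" using assms(2,4) by blast
qed

text \<open>
  The section given by a single element over the whole space. All forms that occur in the proof are brought
  into this shape, where sums and multiples of sections can be computed on representatives.
\<close>

definition global_section :: "nat \<Rightarrow> 'a::metric_space bpoly_elt \<Rightarrow> 'a \<Rightarrow> 'a germ" where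
  "global_section k b x = germ k x UNIV b"

lemma global_section_bGamma:
  assumes "b \<in> bPoly k UNIV"
  shows "global_section k b \<in> bGamma k"
  unfolding bGamma_def mem_Collect_eq
proof
  show "\<forall>x. global_section k b x \<in> stalk k x"
    unfolding stalk_def global_section_def using assms by (auto intro!: exI[of _ UNIV] exI[of _ b])
  show "continuous_map euclidean (etale_topology k) (global_section k b)"
    unfolding etale_topology_def
  proof (rule continuous_on_generated_topo)
    fix O' :: "'a germ set" assume "O' \<in> {(\<lambda>x. germ k x U b) ` U |U b. open U \<and> b \<in> bPoly k U}"
    then obtain U c where U: "O' = (\<lambda>x. germ k x U c) ` U" "open U" "c \<in> bPoly k U" by auto
    have "\<exists>W. open W \<and> x \<in> W \<and> W \<subseteq> global_section k b -` O'" if x: "x \<in> global_section k b -` O'" for x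
    proof -
      obtain y where y: "y \<in> U" "germ k x UNIV b = germ k y U c"
        using x by (auto simp: U global_section_def)
      have "x = y" using germ_eq_imp_same_point[OF y(2)] assms by auto
      with y have "germ k x UNIV b = germ k x U c" "x \<in> U" by auto
      from germ_eqD[OF this(1) U(2) this(2) U(3)] obtain W
        where W: "open W" "x \<in> W" "W \<subseteq> U" "bres k W b = bres k W c" by metis
      have "W \<subseteq> global_section k b -` O'"
      proof
        fix z assume z: "z \<in> W"
        have "germ k z UNIV b = germ k z U c"
          by (rule germ_eqI[OF assms U(3) W(1) z _ W(3,4)]) simp
        with z W(3) show "z \<in> global_section k b -` O'" unfolding U(1) global_section_def by blast
      qed
      with W show ?thesis by blast
    qed
    then have "open (global_section k b -` O')"
      by (intro open_subopen[THEN iffD2] ballI)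
    then show "openin euclidean (global_section k b -` O' \<inter> topspace euclidean)" by simp
  next
    show "global_section k b ` topspace euclidean \<subseteq> \<Union> {(\<lambda>x. germ k x U b) ` U |U b. open U \<and> b \<in> bPoly k U}"
    proof (rule image_subsetI, rule UnionI)
      show "range (\<lambda>x. germ k x UNIV b) \<in> {(\<lambda>x. germ k x U b) ` U |U b. open U \<and> b \<in> bPoly k U}"
        using assms by blast
      show "global_section k b x \<in> range (\<lambda>x. germ k x UNIV b)" for x
        by (simp add: global_section_def)
    qed
  qed
qed

lemma bPoly_add:
  assumes "b \<in> bPoly k V" "c \<in> bPoly k V"
  shows "badd k V b c \<in> bPoly k V"
    "W \<subseteq> V \<Longrightarrow> bres k W (badd k V b c) =
       badd k W (bres k W b) (bres k W c)"
proof -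
  obtain u v where uv: "u \<in> bcauchy k V" "b = bcls k V u" "v \<in> bcauchy k V" "c = bcls k V v"
    using assms bPolyE by metis
  show "badd k V b c \<in> bPoly k V"
    using uv by (simp add: bpoly.ct_add_cls bcls_bPoly bpoly.cauchy_add)
  show "bres k W (badd k V b c) =
       badd k W (bres k W b) (bres k W c)" if "W \<subseteq> V"
    using uv that
    by (simp add: bpoly.ct_add_cls bpoly.cauchy_add bres_bcls push_add)
qed

lemma bPoly_scale:
  assumes "b \<in> bPoly k V"
  shows "bscale k V c b \<in> bPoly k V"
    "W \<subseteq> V \<Longrightarrow> bres k W (bscale k V c b) =
       bscale k W c (bres k W b)"
proof -
  obtain u where u: "u \<in> bcauchy k V" "b = bcls k V u"
    using assms bPolyE by metis
  show "bscale k V c b \<in> bPoly k V"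
    using u by (simp add: bpoly.ct_scale_cls bcls_bPoly bpoly.cauchy_scaleR)
  show "bres k W (bscale k V c b) =
       bscale k W c (bres k W b)" if "W \<subseteq> V"
    using u that
    by (simp add: bpoly.ct_scale_cls bpoly.cauchy_scaleR bres_bcls push_scaleR)
qed

lemma UN_prod_const: "p \<in> A \<Longrightarrow> (\<And>a b. (a, b) \<in> A \<Longrightarrow> f a b = c) \<Longrightarrow> (\<Union>(a, b)\<in>A. f a b) = c"
  by (rule SUP_eq_const) auto

lemma sec_add_global_section:
  assumes b: "b \<in> bPoly k UNIV" and c: "c \<in> bPoly k UNIV"
  shows "sec_add k (global_section k b) (global_section k c) =
    global_section k (badd k UNIV b c)"
proof
  fix x
  have eq: "germ k x (U \<inter> V) (badd k (U \<inter> V)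
        (bres k (U \<inter> V) b') (bres k (U \<inter> V) c')) =
      germ k x UNIV (badd k UNIV b c)"
    if bc': "(U, b') \<in> germ k x UNIV b" "(V, c') \<in> germ k x UNIV c" for U b' V c'
  proof -
    obtain W1 where W1: "open U" "x \<in> U" "b' \<in> bPoly k U" "open W1" "x \<in> W1" "W1 \<subseteq> U" "bres k W1 b = bres k W1 b'"
      using bc'(1) by (auto simp: germ_def)
    obtain W2 where W2: "open V" "x \<in> V" "c' \<in> bPoly k V" "open W2" "x \<in> W2" "W2 \<subseteq> V" "bres k W2 c = bres k W2 c'"
      using bc'(2) by (auto simp: germ_def)
    let ?W = "W1 \<inter> W2"
    have b: "bres k ?W b = bres k ?W b'"
      by (rule bres_eq_subset[OF W1(7) _ _ W1(6) assms(1) W1(3)]) auto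
    have c: "bres k ?W c = bres k ?W c'"
      by (rule bres_eq_subset[OF W2(7) _ _ W2(6) assms(2) W2(3)]) auto
    have W: "?W \<subseteq> U \<inter> V" "open ?W" "x \<in> ?W" using W1 W2 by auto
    have b': "bres k ?W (bres k (U \<inter> V) b') = bres k ?W b'" 
      by (rule bres_bres[OF W(1) _ W1(3)]) simp
    have c': "bres k ?W (bres k (U \<inter> V) c') = bres k ?W c'"
      by (rule bres_bres[OF W(1) _ W2(3)]) simp
    have m: "bres k (U \<inter> V) b' \<in> bPoly k (U \<inter> V)" "bres k (U \<inter> V) c' \<in> bPoly k (U \<inter> V)"
      by (rule bres_bPoly[OF _ W1(3)] bres_bPoly[OF _ W2(3)]; simp)+
    show ?thesis
    proof (rule germ_eqI[OF bPoly_add(1)[OF m] bPoly_add(1)[OF assms] W(2,3,1)])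
      show "bres k ?W (badd k (U \<inter> V) (bres k (U \<inter> V) b') (bres k (U \<inter> V) c')) =
          bres k ?W (badd k UNIV b c)"
        unfolding bPoly_add(2)[OF m W(1)] bPoly_add(2)[OF assms subset_UNIV] b' c' b c ..
    qed simp
  qed
  show "sec_add k (global_section k b) (global_section k c) x =
    global_section k (badd k UNIV b c) x"
    unfolding sec_add_def global_section_def
    by (rule UN_prod_const[OF mem_germ_self[OF open_UNIV UNIV_I b]],
        rule UN_prod_const[OF mem_germ_self[OF open_UNIV UNIV_I c]], rule eq)
qed

lemma sec_scale_global_section:
  assumes b: "b \<in> bPoly k UNIV"
  shows "sec_scale k c (global_section k b) =
    global_section k (bscale k UNIV c b)"
proof
  fix x
  have eq: "germ k x U (bscale k U c b') =
      germ k x UNIV (bscale k UNIV c b)"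
    if bc': "(U, b') \<in> germ k x UNIV b" for U b'
  proof -
    obtain W where W: "open U" "x \<in> U" "b' \<in> bPoly k U" "open W" "x \<in> W" "W \<subseteq> U" "bres k W b = bres k W b'"
      using bc'(1) by (auto simp: germ_def)
    show ?thesis
    proof (rule germ_eqI[OF bPoly_scale(1)[OF W(3)] bPoly_scale(1)[OF assms] W(4,5,6)])
      show "bres k W (bscale k U c b') =
          bres k W (bscale k UNIV c b)"
        unfolding bPoly_scale(2)[OF W(3,6)] bPoly_scale(2)[OF assms subset_UNIV] W(7) ..
    qed simp
  qed
  show "sec_scale k c (global_section k b) x =
    global_section k (bscale k UNIV c b) x"
    unfolding sec_scale_def global_section_def
    by (rule UN_prod_const[OF mem_germ_self[OF open_UNIV UNIV_I b]], rule eq)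
qed

section \<open>Locally finite covers by precompact open sets\<close>

text \<open>
  This is Rudin's proof of Stone's theorem. Well-order the cover and let \<open>c x\<close> be its first member
  containing \<open>x\<close>. At stage \<open>n\<close> take the balls of radius \<open>2\<^sup>-\<^sup>n\<close> around the points \<open>x\<close> that were not covered
  at earlier stages and satisfy \<open>ball x (3 * 2\<^sup>-\<^sup>n) \<subseteq> c x\<close>, and unite those with a common \<open>c x\<close>. A small ball
  meets no set from late stages, since their centres avoid what is already covered, and at most
  one set from each early stage, since centres with different \<open>c\<close> are at distance at least
  \<open>3 * 2\<^sup>-\<^sup>n\<close>.
\<close>

lemma stone_locally_finite_refinement:
  fixes \<C> :: "'a::metric_space set set"
  assumes op: "\<And>C. C \<in> \<C> \<Longrightarrow> open C" and cov: "\<Union>\<C> = UNIV"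
  shows "\<exists>\<U>. locally_finite_open_cover \<U> \<and> (\<forall>U\<in>\<U>. \<exists>C\<in>\<C>. U \<subseteq> C)"
proof -
  obtain r :: "'a set rel" where r: "well_order_on UNIV r"
    using well_order_on by blast
  have wf: "wf (r - Id)" using r by (simp add: well_order_on_def)
  have "total_on UNIV r" using r by (simp add: well_order_on_def linear_order_on_def)
  then have tot: "(A, B) \<in> r - Id \<or> (B, A) \<in> r - Id" if "A \<noteq> B" for A B
    using that unfolding total_on_def by blast
  have "\<exists>C. C \<in> \<C> \<and> x \<in> C \<and> (\<forall>C'\<in>\<C>. x \<in> C' \<longrightarrow> (C', C) \<notin> r - Id)" for x
  proof -
    have "x \<in> \<Union>\<C>" using cov by simp
    then obtain C0 where "C0 \<in> {C \<in> \<C>. x \<in> C}" by (elim UnionE) simp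
    from wf[unfolded wf_eq_minimal, rule_format, OF this]
    obtain C where "C \<in> {C \<in> \<C>. x \<in> C}" "\<forall>y. (y, C) \<in> r - Id \<longrightarrow> y \<notin> {C \<in> \<C>. x \<in> C}"
      by (elim bexE)
    then show ?thesis by (intro exI[of _ C]) blast
  qed
  then obtain c where c: "\<And>x. c x \<in> \<C>" "\<And>x. x \<in> c x"
    and c_min: "\<And>x C'. C' \<in> \<C> \<Longrightarrow> x \<in> C' \<Longrightarrow> (C', c x) \<notin> r - Id"
    by metis
  define R :: "nat \<Rightarrow> real" where "R n = (1/2) ^ n" for n
  have R: "0 < R n" "R n = 2 * R (Suc n)" for n by (auto simp: R_def)
  have R_mono: "R n \<le> R m" if "m \<le> n" for m n
    unfolding R_def by (rule power_decreasing) (use that in auto)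
  define prev where "prev = rec_nat {} (\<lambda>n P. P \<union> (\<Union>x\<in>{x. x \<notin> P \<and> ball x (3 * R n) \<subseteq> c x}. ball x (R n)))"
  define A where "A n = {x. x \<notin> prev n \<and> ball x (3 * R n) \<subseteq> c x}" for n
  have prev_Suc: "prev (Suc n) = prev n \<union> (\<Union>x\<in>A n. ball x (R n))" for n
    by (simp add: prev_def A_def)
  have prev_0: "prev 0 = {}" by (simp add: prev_def)
  define D where "D n C = (\<Union>x\<in>{x \<in> A n. c x = C}. ball x (R n))" for n C
  have prev_D: "x \<in> prev n \<Longrightarrow> \<exists>j C. x \<in> D j C" for x n
  proof (induction n)
    case (Suc n)
    show ?case
    proof (cases "x \<in> prev n")
      case False
      then obtain y where "y \<in> A n" "x \<in> ball y (R n)" using Suc.prems prev_Suc by blast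
      then have "x \<in> D n (c y)" unfolding D_def by blast
      then show ?thesis by blast
    qed (use Suc in blast)
  qed (simp add: prev_0)
  have D_prev: "D n C \<subseteq> prev i" if "n < i" for n i C
    using that
  proof (induction i)
    case (Suc i)
    show ?case
    proof (cases "n = i")
      case True
      have "D n C \<subseteq> (\<Union>x\<in>A n. ball x (R n))" unfolding D_def by blast
      then show ?thesis unfolding True prev_Suc by blast
    next
      case False
      then have "D n C \<subseteq> prev i" using Suc by simp
      then show ?thesis unfolding prev_Suc by blast
    qed
  qed simp
  have D_cover: "\<exists>j C. x \<in> D j C" for x
  proof -
    obtain e where e: "0 < e" "ball x e \<subseteq> c x" using op c openE by blast
    obtain n where "(1/2) ^ n < e / 3" using real_arch_pow_inv[of "e/3" "1/2"] e by auto
    then have n: "3 * R n < e" by (simp add: R_def)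
    have "ball x (3 * R n) \<subseteq> c x"
      using n by (intro subset_trans[OF _ e(2)] subset_ball) simp
    then have "x \<in> prev n \<or> x \<in> A n" by (auto simp: A_def)
    then show ?thesis
    proof
      assume "x \<in> A n"
      then have "x \<in> D n (c x)" unfolding D_def using R(1)[of n] by force
      then show ?thesis by blast
    qed (rule prev_D)
  qed
  have open_D: "open (D n C)" for n C unfolding D_def by (intro open_UN ballI open_ball)
  have far: "3 * R i \<le> dist y z" if "y \<in> A i" "z \<in> A i" "(c y, c z) \<in> r - Id" for i y z
  proof -
    have "z \<notin> c y" using c_min[of "c y" z] c(1)[of y] that(3) by blast
    then have "z \<notin> ball y (3 * R i)" using that(1) by (auto simp: A_def)
    then show ?thesis by simp
  qed
  have loc: "\<exists>V. open V \<and> x \<in> V \<and> finite {U \<in> {D n C |n C. C \<in> \<C>}. U \<inter> V \<noteq> {}}" for x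
  proof -
    obtain n C where nC: "x \<in> D n C" using D_cover by blast
    obtain e where e: "0 < e" "ball x e \<subseteq> D n C" using openE[OF open_D nC] by blast
    obtain j where "(1/2) ^ j < e" using real_arch_pow_inv[of e "1/2"] e by auto
    then have j: "R j < e" by (simp add: R_def)
    define N where "N = n + j + 1"
    define V where "V = ball x (R N)"
    \<comment> \<open>Late stages: their centres avoid \<open>D n C\<close>, which contains \<open>ball x e\<close>.\<close>
    have high: "D i C' \<inter> V = {}" if i: "N \<le> i" for i C'
    proof (rule ccontr)
      assume "D i C' \<inter> V \<noteq> {}"
      then obtain p y where p: "y \<in> A i" "dist y p < R i" "dist x p < R N"
        unfolding D_def V_def by auto
      have "y \<notin> prev i" using p(1) by (simp add: A_def)
      moreover have "D n C \<subseteq> prev i" using i by (intro D_prev) (simp add: N_def)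
      ultimately have "y \<notin> ball x e" using e(2) by blast
      then have "R j < dist x y" using j by simp
      also have "\<dots> \<le> dist x p + dist y p" by (metis dist_triangle2)
      also have "\<dots> < R N + R i" using p by simp
      also have "\<dots> \<le> R (Suc j) + R (Suc j)" using i by (intro add_mono R_mono) (auto simp: N_def)
      also have "\<dots> = R j" using R(2)[of j] by simp
      finally show False by simp
    qed
    have close: "dist y z < 3 * R i"
      if "i < N" "dist y p < R i" "dist z q < R i" "p \<in> V" "q \<in> V" for i y z p q
    proof -
      have "dist y z \<le> dist y p + (dist x p + dist x q) + dist z q"
        using dist_triangle[of y z p] dist_triangle[of p z q] dist_triangle[of p q x]
        by (simp add: dist_commute)
      also have "\<dots> < R i + (R N + R N) + R i"
        using that by (intro add_strict_mono) (auto simp: V_def)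
      also have "R N + R N \<le> R i"
        using R(2)[of "n + j"] R_mono[of i "n + j"] that(1) by (simp add: N_def)
      finally show ?thesis by simp
    qed
    \<comment> \<open>Early stages: \<open>V\<close> is too small to meet two sets of the same stage.\<close>
    have uniq: "C1 = C2" if i: "i < N" and ne: "D i C1 \<inter> V \<noteq> {}" "D i C2 \<inter> V \<noteq> {}" for i C1 C2
    proof (rule ccontr)
      assume neq: "C1 \<noteq> C2"
      obtain p where "p \<in> D i C1" and pV: "p \<in> V" using ne(1) by blast
      then obtain y where p: "y \<in> A i" "c y = C1" "dist y p < R i"
        unfolding D_def by force
      obtain q where "q \<in> D i C2" and qV: "q \<in> V" using ne(2) by blast
      then obtain z where q: "z \<in> A i" "c z = C2" "dist z q < R i"
        unfolding D_def by force
      have d: "dist y z < 3 * R i" by (rule close[OF i p(3) q(3) pV qV])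
      from tot[OF neq] show False
      proof
        assume "(C1, C2) \<in> r - Id"
        then show False using far[OF p(1) q(1)] d p q by simp
      next
        assume "(C2, C1) \<in> r - Id"
        then show False using far[OF q(1) p(1)] d p q by (simp add: dist_commute)
      qed
    qed
    have "{U \<in> {D n C |n C. C \<in> \<C>}. U \<inter> V \<noteq> {}} \<subseteq> (\<lambda>i. D i (THE C. D i C \<inter> V \<noteq> {})) ` {..<N}"
    proof
      fix U assume "U \<in> {U \<in> {D n C |n C. C \<in> \<C>}. U \<inter> V \<noteq> {}}"
      then obtain i C' where U: "U = D i C'" "D i C' \<inter> V \<noteq> {}" by blast
      have i: "i < N" using high[of i C'] U(2) by (meson not_le)
      have "(THE C. D i C \<inter> V \<noteq> {}) = C'"
        using uniq[OF i _ U(2)] U(2) by (intro the_equality)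
      then show "U \<in> (\<lambda>i. D i (THE C. D i C \<inter> V \<noteq> {})) ` {..<N}"
        using U(1) i by (intro image_eqI[of _ _ i]) simp_all
    qed
    then have "finite {U \<in> {D n C |n C. C \<in> \<C>}. U \<inter> V \<noteq> {}}" by (rule finite_subset) simp
    moreover have "open V" "x \<in> V" using R(1) by (auto simp: V_def)
    ultimately show ?thesis by blast
  qed
  have D_sub: "D n C \<subseteq> C" for n C
  proof
    fix p assume "p \<in> D n C"
    then obtain x where x: "x \<in> A n" "c x = C" "p \<in> ball x (R n)" unfolding D_def by blast
    have "ball x (R n) \<subseteq> ball x (3 * R n)" using R(1)[of n] by (intro subset_ball) simp
    with x show "p \<in> C" unfolding A_def by blast
  qed
  have D_empty: "D n C = {}" if "C \<notin> \<C>" for n C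
  proof -
    have "{x \<in> A n. c x = C} = {}" using c(1) that by blast
    then show ?thesis unfolding D_def by (simp only: UN_empty)
  qed
  have "locally_finite_open_cover {D n C |n C. C \<in> \<C>}"
    unfolding locally_finite_open_cover_def locally_finite_in_def
  proof (intro conjI ballI subset_UNIV)
    fix x show "\<exists>V. openin euclidean V \<and> x \<in> V \<and> finite {U \<in> {D n C |n C. C \<in> \<C>}. U \<inter> V \<noteq> {}}"
      using loc[of x] by simp
  next
    show "\<Union> {D n C |n C. C \<in> \<C>} = UNIV"
    proof (rule UNIV_eq_I[symmetric])
      fix x
      obtain j C where "x \<in> D j C" using D_cover by blast
      moreover from this have "C \<in> \<C>" using D_empty[of C j] by blast
      ultimately show "x \<in> \<Union> {D n C |n C. C \<in> \<C>}" by blast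
    qed
  qed (use open_D in auto)
  moreover have "\<forall>U\<in>{D n C |n C. C \<in> \<C>}. \<exists>C\<in>\<C>. U \<subseteq> C" using D_sub by blast
  ultimately show ?thesis by blast
qed

lemma compact_closure_subset: "compact K \<Longrightarrow> closure U \<subseteq> K \<Longrightarrow> compact (closure U)"
  using compact_Int_closed[of K "closure U"] by (simp add: Int_absorb1)

lemma locally_compact_UNIV_nbhd:
  assumes "locally compact (UNIV :: 'a::metric_space set)"
  obtains U where "open U" "(x::'a) \<in> U" "compact (closure U)"
proof -
  obtain U K where U: "openin (top_of_set UNIV) U" "compact K" "x \<in> U" "U \<subseteq> K"
    using assms unfolding locally_def by (elim allE[of _ UNIV] allE[of _ x]) auto
  have "closure U \<subseteq> K" using U by (intro closure_minimal compact_imp_closed)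
  then have "compact (closure U)" by (rule compact_closure_subset[OF U(2)])
  then show ?thesis using U that by simp
qed

lemma precompact_locally_finite_cover:
  assumes "locally compact (UNIV :: 'a::metric_space set)"
  shows "\<exists>\<U>. locally_finite_open_cover \<U> \<and> (\<forall>U\<in>\<U>. compact (closure (U :: 'a set)))"
proof -
  let ?\<C> = "{U :: 'a set. open U \<and> compact (closure U)}"
  have "\<Union>?\<C> = UNIV"
  proof (rule UNIV_eq_I[symmetric])
    fix x :: 'a
    obtain U where "open U" "x \<in> U" "compact (closure U)"
      by (rule locally_compact_UNIV_nbhd[OF assms])
    then show "x \<in> \<Union>?\<C>" by blast
  qed
  then have "\<exists>\<U>. locally_finite_open_cover \<U> \<and> (\<forall>U\<in>\<U>. \<exists>C\<in>?\<C>. U \<subseteq> C)"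
    by (intro stone_locally_finite_refinement) simp_all
  then obtain \<U> where \<U>: "locally_finite_open_cover \<U>" "\<forall>U\<in>\<U>. \<exists>C\<in>?\<C>. U \<subseteq> C"
    by (elim exE conjE)
  have "compact (closure U)" if U: "U \<in> \<U>" for U
  proof -
    obtain C where C: "compact (closure C)" "U \<subseteq> C" using \<U>(2) U by blast
    show ?thesis by (rule compact_closure_subset[OF C(1) closure_mono[OF C(2)]])
  qed
  then show ?thesis using \<U>(1) by blast
qed

section \<open>Evaluating the extension on a global series\<close>

abbreviation pcls where "pcls k U \<equiv> ct_class k (LIP_inf U) (LIP_inf U)"
abbreviation pcauchy where "pcauchy k U \<equiv> ct_cauchy k (LIP_inf U) (LIP_inf U)"
abbreviation ptuples where "ptuples k U \<equiv> tuples k (LIP_inf U) (LIP_inf U)"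
abbreviation pcross where "pcross U \<equiv> cross (LIP_inf U) (LIP_inf U)"

abbreviation quot :: "'a set \<Rightarrow> 'a ptuple \<Rightarrow> ('a \<Rightarrow> real) \<times> ('a \<Rightarrow> real) set list" where
  "quot U \<equiv> (\<lambda>(f, gs). (id f, map (qmap U) gs))"

abbreviation pres :: "'a set \<Rightarrow> 'a ptuple \<Rightarrow> 'a ptuple" where
  "pres W \<equiv> (\<lambda>(f, gs). (restrict f W, map (\<lambda>g. restrict g W) gs))"

text \<open>
  The sum of the series \<open>s\<^sub>j\<^sub>0 \<otimes> [s\<^sub>j\<^sub>1] \<otimes> \<dots> \<otimes> [s\<^sub>j\<^sub>k]\<close>, given by the Cauchy sequence of its partial sums.
\<close>

definition bseries :: "nat \<Rightarrow> 'a::metric_space set \<Rightarrow> (nat \<Rightarrow> 'a ptuple) \<Rightarrow> 'a bpoly_elt" where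
  "bseries k U s = bcls k U (\<lambda>n. \<Sum>j<n. pure (quot U (s j)))"

definition summable_series :: "nat \<Rightarrow> 'a::metric_space set \<Rightarrow> (nat \<Rightarrow> 'a ptuple) \<Rightarrow> bool" where
  "summable_series k U s \<longleftrightarrow> (\<forall>j. s j \<in> ptuples k U) \<and> summable (\<lambda>j. pcross U (s j))"

lemma bseries_eq_Qmap:
  assumes "summable_series k U s"
  shows "Qmap k U (pcls k U (\<lambda>n. \<Sum>j<n. pure (s j))) = bseries k U s"
    "(\<lambda>n. \<Sum>j<n. pure (quot U (s j))) \<in> bcauchy k U"
proof -
  have c: "(\<lambda>n. \<Sum>j<n. pure (s j)) \<in> pcauchy k U"
    using assms by (intro poly.cauchy_partial_sums) (simp_all add: summable_series_def)
  show "Qmap k U (pcls k U (\<lambda>n. \<Sum>j<n. pure (s j))) = bseries k U s"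
    unfolding Qmap_def bseries_def Q.ct_map_cls[OF c] push_sum push_pure ..
  show "(\<lambda>n. \<Sum>j<n. pure (quot U (s j))) \<in> bcauchy k U"
    using Q.cauchy_push[OF c] unfolding push_sum push_pure .
qed

lemma bseries_bPoly: "summable_series k U s \<Longrightarrow> bseries k U s \<in> bPoly k U"
  unfolding bseries_def by (intro bcls_bPoly bseries_eq_Qmap)

lemma ptuples_restrict:
  assumes "t \<in> ptuples k V" "W \<subseteq> V"
  shows "pres W t \<in> ptuples k W" "pcross W (pres W t) \<le> pcross V t"
    "quot W (pres W t) = res W (quot V t)"
proof -
  obtain f gs where t: "t = (f, gs)" "f \<in> vecs (LIP_inf V)" "set gs \<subseteq> vecs (LIP_inf V)" "length gs = k"
    using assms(1) by (auto simp: tuples_def)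
  have gs: "g \<in> set gs \<Longrightarrow> g \<in> vecs (LIP_inf V)" for g using t(3) by blast
  have sub: "set (map (\<lambda>g. restrict g W) gs) \<subseteq> vecs (LIP_inf W)"
    using gs LIP_inf_restrict(1)[OF _ assms(2)] by force
  then show m: "pres W t \<in> ptuples k W"
    using t LIP_inf_restrict(1)[OF t(2) assms(2)] by (simp add: tuples_def)
  have "Lnorm W (restrict f W) * prod_list (map (Lnorm W) (map (\<lambda>g. restrict g W) gs)) \<le>
      Lnorm V f * prod_list (map (Lnorm V) gs)"
    unfolding map_map o_def
  proof (intro mult_mono prod_list_map_mono conjI)
    show "0 \<le> prod_list (map (\<lambda>g. Lnorm W (restrict g W)) gs)"
      by (rule prod_list_nonneg) (use sub LIP_infD(5) in auto)
  qed (use gs t(2) LIP_inf_restrict[OF _ assms(2)] LIP_infD(5) in blast)+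
  then show "pcross W (pres W t) \<le> pcross V t" by (simp add: cross_def t(1))
  show "quot W (pres W t) = res W (quot V t)"
    by (simp add: t(1) qmap_restrict[OF assms(2)])
qed

lemma summable_series_restrict:
  assumes "summable_series k V s" "W \<subseteq> V"
  shows "summable_series k W (\<lambda>j. pres W (s j))"
    "bres k W (bseries k V s) = bseries k W (\<lambda>j. pres W (s j))"
proof -
  have s: "s j \<in> ptuples k V" for j using assms by (simp add: summable_series_def)
  have "summable (\<lambda>j. pcross W (pres W (s j)))"
  proof (rule summable_comparison_test_ev)
    show "\<forall>\<^sub>F j in sequentially. norm (pcross W (pres W (s j))) \<le> pcross V (s j)"
      by (intro always_eventually allI)
        (simp only: real_norm_def abs_of_nonneg[OF poly.cross_nonneg[OF ptuples_restrict(1)[OF s assms(2)]]]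
          ptuples_restrict(2)[OF s assms(2)])
    show "summable (\<lambda>j. pcross V (s j))" using assms(1) by (simp add: summable_series_def)
  qed
  then show "summable_series k W (\<lambda>j. pres W (s j))"
    unfolding summable_series_def using ptuples_restrict(1)[OF s assms(2)] by blast
  show "bres k W (bseries k V s) = bseries k W (\<lambda>j. pres W (s j))"
    unfolding bseries_def bres_bcls(1)[OF assms(2) bseries_eq_Qmap(2)[OF assms(1)]] push_sum push_pure
      ptuples_restrict(3)[OF s assms(2)] ..
qed

text \<open>
  The first factor equals \<open>0\<close> times itself, and scalars can be pulled out.
\<close>

lemma pure_zero_factor:
  assumes "(f, As) \<in> btuples k W" "\<And>x. x \<in> W \<Longrightarrow> f x = 0"
  shows "pure (f, As) \<in> brel k W"
proof -
  have f: "f \<in> vecs (LIP_inf W)" using assms(1) by (simp add: tuples_def)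
  have "(\<lambda>x\<in>W. 0 * f x) = f"
    using LIP_infD(1)[OF f] assms(2) by (auto simp: extensional_def restrict_def)
  then have eq: "bpoly.scale_tuple W 0 (f, As) = (f, As)"
    by (simp add: bpoly.scale_tuple_def)
  have "0 *\<^sub>R pure (f, As) - pure (f, As) \<in> brel k W"
    using bpoly.scale_tuple(3)[OF assms(1), of 0] unfolding eq .
  from span_neg[OF this] show ?thesis by simp
qed

lemma zero_cauchy: "(\<lambda>_. 0) \<in> bcauchy k U"
  by (rule bpoly.cauchy_const) simp

lemma bPoly_zero_bcls: "bPoly_zero k U = bcls k U (\<lambda>_. 0)"
  unfolding bPoly_zero_def ct_zero_def ..

lemma bPoly_zero_bPoly: "bPoly_zero k U \<in> bPoly k U"
  unfolding bPoly_zero_bcls by (rule bcls_bPoly[OF zero_cauchy])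

lemma bres_zero: "W \<subseteq> V \<Longrightarrow> bres k W (bPoly_zero k V) = bPoly_zero k W"
  unfolding bPoly_zero_bcls by (simp add: bres_bcls(1)[OF _ zero_cauchy] linear_0[OF linear_push])

lemma quot_btuples: "t \<in> ptuples k U \<Longrightarrow> quot U t \<in> btuples k U"
  by (rule Q.tmap_tuples)

lemma bseries_vanishing:
  assumes s: "summable_series k W s" and z: "\<And>j x. x \<in> W \<Longrightarrow> fst (s j) x = 0"
  shows "bseries k W s = bPoly_zero k W"
  unfolding bseries_def bPoly_zero_bcls
proof (rule bpoly.cls_eqI[OF bseries_eq_Qmap(2)[OF s] zero_cauchy], rule bpoly.equivalentI_R)
  fix n
  have "pure (quot W (s j)) \<in> brel k W" for j
  proof -
    have "quot W (s j) = (fst (s j), map (qmap W) (snd (s j)))" by (simp add: case_prod_beta)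
    moreover have "quot W (s j) \<in> btuples k W"
      using s by (intro quot_btuples) (simp add: summable_series_def)
    ultimately show ?thesis using z by (simp add: pure_zero_factor)
  qed
  then show "(\<Sum>j<n. pure (quot W (s j))) - 0 \<in> brel k W"
    by (simp add: span_sum)
qed

lemma global_section_support:
  assumes b: "b \<in> bPoly k UNIV" and C: "closed C" "bres k (- C) b = bPoly_zero k (- C)"
  shows "spt_section k (global_section k b) \<subseteq> C"
  unfolding spt_section_def
proof (rule closure_minimal[OF _ C(1)], rule subsetI, rule ccontr)
  fix x assume x: "x \<in> {x. global_section k b x \<noteq> germ_zero k x}" "x \<notin> C"
  have "germ k x UNIV b = germ k x UNIV (bPoly_zero k UNIV)"
    by (rule germ_eqI[of _ _ _ _ _ "- C", OF b bPoly_zero_bPoly])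
      (use x(2) C bres_zero[of "- C" UNIV k] in auto)
  then show False using x(1) by (simp add: global_section_def germ_zero_def)
qed

lemma global_section_bGamma_c:
  assumes b: "b \<in> bPoly k UNIV" and C: "compact C" "bres k (- C) b = bPoly_zero k (- C)"
  shows "global_section k b \<in> bGamma_c k"
proof -
  have "spt_section k (global_section k b) \<subseteq> C"
    by (rule global_section_support[OF b compact_imp_closed[OF C(1)] C(2)])
  then have "compact (spt_section k (global_section k b))"
    unfolding spt_section_def by (rule compact_closure_subset[OF C(1)])
  then show ?thesis
    unfolding bGamma_c_def using global_section_bGamma[OF b] by simp
qed

lemma not_in_spt: "x \<notin> spt f \<Longrightarrow> f x = 0"
  using closure_subset[of "{x. f x \<noteq> 0}"] unfolding spt_def by blast

lemma bres_bseries_off_support: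
  assumes s: "summable_series k UNIV s" and C: "\<And>j. spt (fst (s j)) \<subseteq> C"
  shows "bres k (- C) (bseries k UNIV s) = bPoly_zero k (- C)"
  unfolding summable_series_restrict(2)[OF s subset_UNIV]
proof (rule bseries_vanishing[OF summable_series_restrict(1)[OF s subset_UNIV]])
  fix j x assume "x \<in> - C"
  then have "fst (s j) x = 0" using C[of j] by (intro not_in_spt) blast
  then show "fst (pres (- C) (s j)) x = 0" using \<open>x \<in> - C\<close> by (simp add: case_prod_beta)
qed

lemma LIP_c_LIP_inf:
  assumes "f \<in> LIP_c"
  shows "f \<in> vecs (LIP_inf UNIV)"
proof -
  obtain C where C: "C-lipschitz_on UNIV f" "compact (spt f)" using assms by (auto simp: LIP_c_def)
  have "continuous_on (spt f) f"
    by (rule continuous_on_subset[OF lipschitz_on_continuous_on[OF C(1)] subset_UNIV])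
  then have "bounded (f ` spt f)"
    using C(2) by (intro compact_imp_bounded compact_continuous_image)
  then obtain B where B: "\<And>x. x \<in> spt f \<Longrightarrow> \<bar>f x\<bar> \<le> B"
    unfolding bounded_iff by fastforce
  have "\<bar>f x\<bar> \<le> max B 0" for x
  proof (cases "f x = 0")
    case False
    then have "x \<in> spt f" using not_in_spt[of x f] by blast
    from B[OF this] show ?thesis by simp
  qed simp
  then show ?thesis by (intro LIP_infI[OF _ C(1), of "max B 0"]) auto
qed

lemma Dform_ptuples: "t \<in> Dform k \<Longrightarrow> t \<in> ptuples k UNIV"
  using LIP_c_LIP_inf by (auto simp: Dform_def tuples_def)

lemma iota_eq: "iota k t = global_section k (bcls k UNIV (\<lambda>_. pure (quot UNIV t)))"
  by (simp add: fun_eq_iff iota_def global_section_def ct_pure_def case_prod_beta)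

lemma Dform_support_bound:
  assumes "t \<in> Dform k" "spt (fst t) \<subseteq> C"
  shows "pure (res (- C) (quot UNIV t)) \<in> brel k (- C)"
proof -
  have t: "t \<in> ptuples k UNIV" by (rule Dform_ptuples[OF assms(1)])
  have eq: "res (- C) (quot UNIV t) = (restrict (fst t) (- C), snd (quot (- C) (pres (- C) t)))"
    unfolding ptuples_restrict(3)[OF t subset_UNIV, symmetric] by (simp add: case_prod_beta)
  have m: "quot (- C) (pres (- C) t) \<in> btuples k (- C)"
    by (rule quot_btuples[OF ptuples_restrict(1)[OF t subset_UNIV]])
  then have "(restrict (fst t) (- C), snd (quot (- C) (pres (- C) t))) \<in> btuples k (- C)"
    by (simp add: case_prod_beta)
  then show ?thesis
    unfolding eq using assms(2) by (intro pure_zero_factor) (auto intro: not_in_spt)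
qed

lemma finite_sum_section:
  fixes t :: "nat \<Rightarrow> 'a::metric_space ptuple"
  assumes t: "\<And>j. t j \<in> Dform k" and C: "compact C" "\<And>j. spt (fst (t j)) \<subseteq> C"
  shows "bcls k UNIV (\<lambda>_. \<Sum>j<n. pure (quot UNIV (t j))) \<in> bPoly k UNIV"
    "(\<lambda>_. \<Sum>j<n. pure (quot UNIV (t j))) \<in> bcauchy k UNIV"
    "global_section k (bcls k UNIV (\<lambda>_. \<Sum>j<n. pure (quot UNIV (t j)))) \<in> bGamma_c k"
proof -
  let ?u = "\<lambda>_::nat. \<Sum>j<n. pure (quot UNIV (t j))"
  show u: "?u \<in> bcauchy k UNIV"
    by (intro bpoly.cauchy_const bpoly.formal_sum bpoly.formal_pure quot_btuples Dform_ptuples t)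
  then show b: "bcls k UNIV ?u \<in> bPoly k UNIV" by (rule bcls_bPoly)
  have "bres k (- C) (bcls k UNIV ?u) = bPoly_zero k (- C)"
    unfolding bres_bcls(1)[OF subset_UNIV u] bPoly_zero_bcls
  proof (rule bpoly.cls_eqI[OF bres_bcls(2)[OF subset_UNIV u] zero_cauchy], rule bpoly.equivalentI_R)
    show "push (res (- C)) (?u m) - 0 \<in> brel k (- C)" for m :: nat
      unfolding push_sum push_pure diff_zero
      by (intro span_sum Dform_support_bound t C)
  qed
  then show "global_section k (bcls k UNIV ?u) \<in> bGamma_c k"
    by (rule global_section_bGamma_c[OF b C(1)])
qed

lemma zero_section:
  fixes S :: "('a::metric_space \<Rightarrow> 'a germ) \<Rightarrow> real"
  shows "global_section k (bPoly_zero k (UNIV :: 'a set)) \<in> bGamma_c k"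
    "is_extension k T S \<Longrightarrow> S (global_section k (bPoly_zero k (UNIV :: 'a set))) = 0"
proof -
  show *: "global_section k (bPoly_zero k (UNIV :: 'a set)) \<in> bGamma_c k"
    by (rule global_section_bGamma_c[OF bPoly_zero_bPoly compact_empty bres_zero]) simp
  assume "is_extension k T S"
  then have "S (sec_add k (global_section k (bPoly_zero k (UNIV :: 'a set))) (global_section k (bPoly_zero k (UNIV :: 'a set)))) =
      S (global_section k (bPoly_zero k (UNIV :: 'a set))) + S (global_section k (bPoly_zero k (UNIV :: 'a set)))"
    using * unfolding is_extension_def linear_on_sections_def by blast
  moreover have "badd k UNIV (bPoly_zero k (UNIV :: 'a set)) (bPoly_zero k (UNIV :: 'a set)) =
      bPoly_zero k (UNIV :: 'a set)"
    unfolding bPoly_zero_bcls bpoly.ct_add_cls[OF zero_cauchy zero_cauchy] by simp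
  ultimately show "S (global_section k (bPoly_zero k (UNIV :: 'a set))) = 0"
    unfolding sec_add_global_section[OF bPoly_zero_bPoly bPoly_zero_bPoly] by simp
qed

lemma sec_diff_zero:
  assumes "b \<in> bPoly k UNIV"
  shows "sec_diff k (global_section k b) (global_section k (bPoly_zero k UNIV)) = global_section k b"
proof -
  obtain u where u: "u \<in> bcauchy k UNIV" "b = bcls k UNIV u" using bPolyE[OF assms] .
  have z: "bscale k UNIV (- 1) (bPoly_zero k UNIV) = bPoly_zero k UNIV"
    unfolding bPoly_zero_bcls bpoly.ct_scale_cls[OF zero_cauchy] by simp
  have "badd k UNIV b (bPoly_zero k UNIV) = b"
    unfolding u(2) bPoly_zero_bcls bpoly.ct_add_cls[OF u(1) zero_cauchy] by simp
  then show ?thesis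
    unfolding sec_diff_def sec_scale_global_section[OF bPoly_zero_bPoly] z
      sec_add_global_section[OF assms bPoly_zero_bPoly] by simp
qed

definition zero_tuple :: "nat \<Rightarrow> 'a ptuple" where
  "zero_tuple k = (\<lambda>_. 0, replicate k (\<lambda>_. 0))"

lemma zero_tuple:
  fixes k :: nat
  defines "z \<equiv> zero_tuple k :: 'a::metric_space ptuple"
  shows "z \<in> Dform k" "pcross UNIV z = 0" "spt (fst z) = {}"
    "pure (quot UNIV z) \<in> brel k UNIV"
proof -
  have 0: "(\<lambda>_::'a. 0::real) \<in> vecs (LIP_inf UNIV)"
    by (rule LIP_infI[of _ _ 0 0]) (auto simp: lipschitz_on_def)
  show spt: "spt (fst z) = {}" by (simp add: z_def zero_tuple_def spt_def)
  have "fst z \<in> LIP_c"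
    unfolding LIP_c_def mem_Collect_eq spt
    by (auto simp: z_def zero_tuple_def lipschitz_on_def intro: exI[of _ 0])
  then show z: "z \<in> Dform k" using 0 by (auto simp: Dform_def z_def zero_tuple_def)
  have "Lnorm UNIV (\<lambda>_::'a. 0::real) = 0"
    using Lnorm_le[of 0 UNIV "\<lambda>_::'a. 0" 0] LIP_infD(5)[OF 0] by (simp add: lipschitz_on_def)
  then show "pcross UNIV z = 0" by (simp add: cross_def z_def zero_tuple_def)
  have m: "quot UNIV z \<in> btuples k UNIV" by (rule quot_btuples[OF Dform_ptuples[OF z]])
  have "quot UNIV z = (fst z, map (qmap UNIV) (snd z))" by (simp add: case_prod_beta)
  then show "pure (quot UNIV z) \<in> brel k UNIV"
    using m by (auto intro!: pure_zero_factor simp: z_def zero_tuple_def)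
qed

text \<open>
  The first \<open>n\<close> terms are replaced by zero terms instead of being dropped. The \<open>j\<close>-th terms for all
  \<open>n\<close> are then bounded by one number, as the supremum over \<open>n\<close> in the definition of convergence
  requires.
\<close>

definition tail_series :: "nat \<Rightarrow> (nat \<Rightarrow> 'a ptuple) \<Rightarrow> nat \<Rightarrow> nat \<Rightarrow> 'a ptuple" where
  "tail_series k t n j = (if j < n then zero_tuple k else t j)"

lemma tail_series:
  assumes t: "\<And>j. t j \<in> Dform k" "summable (\<lambda>j. pcross UNIV (t j))" "\<And>j. spt (fst (t j)) \<subseteq> C"
  shows "tail_series k t n j \<in> Dform k" "spt (fst (tail_series k t n j)) \<subseteq> C"
    "pcross UNIV (tail_series k t n j) = (if j < n then 0 else pcross UNIV (t j))"
    "summable_series k UNIV (tail_series k t n)"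
proof -
  show 1: "tail_series k t n j \<in> Dform k" "spt (fst (tail_series k t n j)) \<subseteq> C" for j
    using t zero_tuple(1,3)[where k=k] by (auto simp: tail_series_def)
  show 2: "pcross UNIV (tail_series k t n j) = (if j < n then 0 else pcross UNIV (t j))" for j
    by (simp add: tail_series_def zero_tuple(2))
  have "summable (\<lambda>j. pcross UNIV (tail_series k t n j))"
  proof (rule summable_comparison_test_ev[OF _ t(2)], rule always_eventually, rule allI)
    show "norm (pcross UNIV (tail_series k t n j)) \<le> pcross UNIV (t j)" for j
      unfolding 2 using poly.cross_nonneg[OF Dform_ptuples[OF t(1)[of j]]] by simp
  qed
  then show "summable_series k UNIV (tail_series k t n)"
    unfolding summable_series_def using Dform_ptuples[OF 1(1)] by blast
qed

lemma bseries_head_tail: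
  assumes t: "\<And>j. t j \<in> Dform k" "summable (\<lambda>j. pcross UNIV (t j))"
    and C: "compact C" "\<And>j. spt (fst (t j)) \<subseteq> C"
  shows "bseries k UNIV t = badd k UNIV
      (bcls k UNIV (\<lambda>_. \<Sum>j<n. pure (quot UNIV (t j)))) (bseries k UNIV (tail_series k t n))"
proof -
  let ?q = "\<lambda>j. pure (quot UNIV (t j))" and ?r = "\<lambda>j. pure (quot UNIV (tail_series k t n j))"
  have h: "(\<lambda>_::nat. \<Sum>j<n. ?q j) \<in> bcauchy k UNIV" by (rule finite_sum_section(2)[OF t(1) C])
  have r: "(\<lambda>N. \<Sum>j<N. ?r j) \<in> bcauchy k UNIV"
    by (rule bseries_eq_Qmap(2)[OF tail_series(4)[OF t C(2)]])
  have tq: "(\<lambda>N. \<Sum>j<N. ?q j) \<in> bcauchy k UNIV"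
    using t(2) Dform_ptuples[OF t(1)] by (intro bseries_eq_Qmap(2)) (simp add: summable_series_def)
  have "(\<Sum>j<N. ?q j) - ((\<Sum>j<n. ?q j) + (\<Sum>j<N. ?r j)) \<in> brel k UNIV"
    if "n \<le> N" for N
  proof -
    have split: "(\<Sum>j<N. f j) = (\<Sum>j<n. f j) + (\<Sum>j=n..<N. f j)" for f :: "nat \<Rightarrow> ('a \<Rightarrow> real) \<times> ('a \<Rightarrow> real) set list \<Rightarrow>\<^sub>0 real"
      using that by (simp add: lessThan_atLeast0 sum.atLeastLessThan_concat)
    have "(\<Sum>j=n..<N. ?r j) = (\<Sum>j=n..<N. ?q j)" "(\<Sum>j<n. ?r j) = (\<Sum>j<n. pure (quot UNIV (zero_tuple k)))"
      by (intro sum.cong; simp add: tail_series_def)+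
    then have "(\<Sum>j<N. ?q j) - ((\<Sum>j<n. ?q j) + (\<Sum>j<N. ?r j)) = - (\<Sum>j<n. pure (quot UNIV (zero_tuple k)))"
      unfolding split by simp
    also have "\<dots> \<in> brel k UNIV"
      by (intro span_neg span_sum zero_tuple(4))
    finally show ?thesis .
  qed
  then have "\<forall>\<^sub>F N in sequentially. proj_norm k (LIP_inf UNIV) (LIP_bar UNIV)
      ((\<Sum>j<N. ?q j) - ((\<Sum>j<n. ?q j) + (\<Sum>j<N. ?r j))) = 0"
    by (intro eventually_sequentiallyI[of n] bpoly.pnorm_in_R)
  then have "bequiv k UNIV (\<lambda>N. \<Sum>j<N. ?q j) (\<lambda>N. (\<Sum>j<n. ?q j) + (\<Sum>j<N. ?r j))"
    unfolding bpoly.equivalent_def by (rule tendsto_eventually)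
  then show ?thesis
    unfolding bseries_def bpoly.ct_add_cls[OF h r]
    by (rule bpoly.cls_eqI[OF tq bpoly.cauchy_add[OF h r]])
qed

lemma extension_finite_sum:
  fixes t :: "nat \<Rightarrow> 'a::metric_space ptuple"
  assumes S: "is_extension k T S" and t: "\<And>j. t j \<in> Dform k"
    and C: "compact C" "\<And>j. spt (fst (t j)) \<subseteq> C"
  shows "S (global_section k (bcls k UNIV (\<lambda>_. \<Sum>j<n. pure (quot UNIV (t j))))) = (\<Sum>j<n. T (t j))"
proof (induction n)
  case 0
  then show ?case using zero_section(2)[OF S] by (simp add: bPoly_zero_bcls)
next
  case (Suc n)
  let ?q = "\<lambda>j. pure (quot UNIV (t j))"
  have q: "(\<lambda>_::nat. ?q n) \<in> bcauchy k UNIV" "bcls k UNIV (\<lambda>_. ?q n) \<in> bPoly k UNIV"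
    and i: "iota k (t n) \<in> bGamma_c k"
    using finite_sum_section[where t="\<lambda>_. t n" and n=1, OF t C(1) C(2)]
    by (simp_all only: iota_eq lessThan_Suc lessThan_0 One_nat_def sum.insert finite.emptyI
        empty_iff not_False_eq_True sum.empty add_0_right)
  note h = finite_sum_section[where t=t and n=n, OF t C]
  have "global_section k (bcls k UNIV (\<lambda>_. \<Sum>j<Suc n. ?q j)) =
      sec_add k (global_section k (bcls k UNIV (\<lambda>_. \<Sum>j<n. ?q j))) (iota k (t n))"
    unfolding iota_eq sec_add_global_section[OF h(1) q(2)] bpoly.ct_add_cls[OF h(2) q(1)] by simp
  then have "S (global_section k (bcls k UNIV (\<lambda>_. \<Sum>j<Suc n. ?q j))) =
      S (global_section k (bcls k UNIV (\<lambda>_. \<Sum>j<n. ?q j))) + S (iota k (t n))"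
    using S h(3) i unfolding is_extension_def linear_on_sections_def by simp
  also have "S (iota k (t n)) = T (t n)" using S t unfolding is_extension_def by blast
  finally show ?case using Suc.IH by simp
qed

lemma supnorm_cross_le:
  assumes "t \<in> ptuples k U" "V0 \<subseteq> U" "length Vs = k" "\<And>V. V \<in> set Vs \<Longrightarrow> V \<subseteq> U"
  shows "supnorm V0 (fst t) * prod_list (map2 supnorm Vs (snd t)) \<le> pcross U t"
proof -
  obtain f gs where t: "t = (f, gs)" "f \<in> vecs (LIP_inf U)" "set gs \<subseteq> vecs (LIP_inf U)" "length gs = k"
    using assms(1) by (auto simp: tuples_def)
  have sup: "0 \<le> supnorm V g \<and> supnorm V g \<le> Lnorm U g" if "V \<subseteq> U" "g \<in> vecs (LIP_inf U)" for V and g :: "'a \<Rightarrow> real"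
  proof -
    have "\<bar>g x\<bar> \<le> Lnorm U g" if "x \<in> V" for x
      using LIP_infD(7)[OF \<open>g \<in> vecs (LIP_inf U)\<close>] \<open>V \<subseteq> U\<close> that by blast
    then show ?thesis
      using supnorm_ge(1)[of V g "Lnorm U g"] supnorm_le[of "Lnorm U g" V g] LIP_infD(5)[OF that(2)] by simp
  qed
  have "0 \<le> prod_list (map2 supnorm Vs gs) \<and> prod_list (map2 supnorm Vs gs) \<le> prod_list (map (Lnorm U) gs)"
  proof -
    have "length Vs = length gs" using t(4) assms(3) by simp
    then show ?thesis using t(3) assms(4)
    proof (induction Vs gs rule: list_induct2)
      case (Cons V Vs g gs)
      have "0 \<le> prod_list (map2 supnorm Vs gs) \<and> prod_list (map2 supnorm Vs gs) \<le> prod_list (map (Lnorm U) gs)"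
        using Cons by simp
      moreover have "0 \<le> supnorm V g \<and> supnorm V g \<le> Lnorm U g"
        using Cons.prems by (intro sup) simp_all
      ultimately show ?case by (simp add: mult_mono)
    qed simp
  qed
  moreover have "0 \<le> supnorm V0 f \<and> supnorm V0 f \<le> Lnorm U f" by (rule sup[OF assms(2) t(2)])
  ultimately show ?thesis by (simp add: cross_def t(1) mult_mono)
qed

lemma suminf_tail_tendsto_0:
  fixes a :: "nat \<Rightarrow> real"
  assumes "summable a" "\<And>j. 0 \<le> a j"
  shows "(\<lambda>n. suminf (\<lambda>j. ennreal (if j < n then 0 else a j))) \<longlonglongrightarrow> 0"
proof -
  have "suminf (\<lambda>j. ennreal (if j < n then 0 else a j)) = ennreal (suminf a - (\<Sum>j<n. a j))" for n
  proof -
    have "(\<lambda>j. a j - (if j < n then a j else 0)) sums (suminf a - (\<Sum>j\<in>{..<n}. a j))"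
      using sums_If_finite_set[of "{..<n}" a] by (intro sums_diff summable_sums assms) simp
    then have s: "(\<lambda>j. if j < n then 0 else a j) sums (suminf a - (\<Sum>j<n. a j))"
      by (rule sums_cong[THEN iffD1, rotated]) simp
    then show ?thesis
      using suminf_ennreal2[OF _ sums_summable[OF s]] sums_unique[OF s] assms(2) by simp
  qed
  moreover have "(\<lambda>n. suminf a - (\<Sum>j<n. a j)) \<longlonglongrightarrow> suminf a - suminf a"
    by (intro tendsto_diff tendsto_const summable_LIMSEQ assms)
  then have "(\<lambda>n. ennreal (suminf a - (\<Sum>j<n. a j))) \<longlonglongrightarrow> ennreal 0"
    by (intro tendsto_ennrealI) simp
  ultimately show ?thesis by simp
qed

text \<open>
  The tails themselves are admissible representations for every choice of compact sets: their norms
  are dominated by the original series, and their total norm tends to \<open>0\<close>.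
\<close>

lemma tail_series_tendsto_zero:
  fixes t :: "nat \<Rightarrow> 'a::metric_space ptuple"
  assumes t: "\<And>j. t j \<in> Dform k" "summable (\<lambda>j. pcross UNIV (t j))" "\<And>j. spt (fst (t j)) \<subseteq> C"
  shows "tendsto_bPoly k U (\<lambda>n. bres k U (bseries k UNIV (tail_series k t n))) (bPoly_zero k U)"
proof -
  define r where "r n j = pres U (tail_series k t n j)" for n j
  define P where "P n = pcls k U (\<lambda>N. \<Sum>j<N. pure (r n j))" for n
  define Z where "Z = pcls k U (\<lambda>_. 0)"
  note tail = tail_series[OF t]
  have r: "summable_series k U (r n)" "bres k U (bseries k UNIV (tail_series k t n)) = bseries k U (r n)" for n
    unfolding r_def by (rule summable_series_restrict[OF tail(4) subset_UNIV])+
  have r_tuple: "r n j \<in> ptuples k U" for n j using r(1)[of n] by (simp add: summable_series_def)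
  have r_cross: "pcross U (r n j) \<le> (if j < n then 0 else pcross UNIV (t j))" for n j
    using ptuples_restrict(2)[OF Dform_ptuples[OF tail(1)[of n j]] subset_UNIV[of U]]
    unfolding r_def tail(3) .
  have t_nonneg: "0 \<le> pcross UNIV (t j)" for j by (rule poly.cross_nonneg[OF Dform_ptuples[OF t(1)]])
  have Pc: "(\<lambda>N. \<Sum>j<N. pure (r n j)) \<in> pcauchy k U" for n
    using r(1)[of n] by (intro poly.cauchy_partial_sums) (simp_all add: summable_series_def)
  have Zc: "(\<lambda>_. 0) \<in> pcauchy k U" by (rule poly.cauchy_const) simp
  have Pn: "P n \<in> Poly k U" "Qmap k U (P n) = bres k U (bseries k UNIV (tail_series k t n))" for n
    unfolding P_def Poly_def r(2) using poly.cls_in_ctensor[OF Pc] bseries_eq_Qmap(1)[OF r(1)] by simp_all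
  have ZP: "Z \<in> Poly k U" unfolding Z_def Poly_def by (rule poly.cls_in_ctensor[OF Zc])
  have ZQ: "Qmap k U Z = bPoly_zero k U"
    unfolding Z_def Qmap_def Q.ct_map_cls[OF Zc] bPoly_zero_bcls by (simp add: linear_0[OF linear_push])
  have rep: "r n \<in> Rep k U (ct_diff k (LIP_inf U) (LIP_inf U) (P n) Z)" for n
  proof -
    have "ct_diff k (LIP_inf U) (LIP_inf U) (P n) Z = P n"
      unfolding P_def Z_def poly.ct_diff_cls[OF Pc Zc] by simp
    then show ?thesis
      using poly.self_mem_cls[OF Pc, of n] r(1)[of n]
      unfolding Rep_def ct_series_def P_def summable_series_def by simp
  qed
  have "(SUP n. ennreal (pcross U (r n j))) \<le> ennreal (pcross UNIV (t j))" for j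
    using r_cross[of _ j] t_nonneg[of j] by (intro SUP_least ennreal_leI) (smt (verit))
  then have "suminf (\<lambda>j. SUP n. ennreal (pcross U (r n j))) \<le> suminf (\<lambda>j. ennreal (pcross UNIV (t j)))"
    by (intro suminf_le) auto
  also have "\<dots> < \<infinity>"
    using suminf_ennreal2[OF t_nonneg t(2)] by simp
  finally have bound: "suminf (\<lambda>j. SUP n. ennreal (pcross U (r n j))) < \<infinity>" .
  have "tendsto_Poly k U P Z"
    unfolding tendsto_Poly_def
  proof (intro allI impI exI[of _ r] conjI)
    fix V0 :: "'a set" and Vs :: "'a set list"
    assume V: "compact V0 \<and> V0 \<subseteq> U \<and> length Vs = k \<and> (\<forall>V\<in>set Vs. compact V \<and> V \<subseteq> U)"
    show "(\<lambda>n. suminf (\<lambda>j. ennreal (supnorm V0 (fst (r n j)) * prod_list (map2 supnorm Vs (snd (r n j)))))) \<longlonglongrightarrow> 0"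
    proof (rule tendsto_sandwich[OF _ _ tendsto_const suminf_tail_tendsto_0[OF t(2) t_nonneg]])
      show "\<forall>\<^sub>F n in sequentially. suminf (\<lambda>j. ennreal (supnorm V0 (fst (r n j)) * prod_list (map2 supnorm Vs (snd (r n j)))))
          \<le> suminf (\<lambda>j. ennreal (if j < n then 0 else pcross UNIV (t j)))"
      proof (intro always_eventually allI suminf_le ennreal_leI)
        fix n j
        have "supnorm V0 (fst (r n j)) * prod_list (map2 supnorm Vs (snd (r n j))) \<le> pcross U (r n j)"
          using V by (intro supnorm_cross_le[OF r_tuple]) auto
        also note r_cross
        finally show "supnorm V0 (fst (r n j)) * prod_list (map2 supnorm Vs (snd (r n j))) \<le>
            (if j < n then 0 else pcross UNIV (t j))" .
      qed auto
    qed simp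
  qed (use rep bound in auto)
  then show ?thesis
    unfolding tendsto_bPoly_def using Pn ZP ZQ by (intro exI[of _ P] exI[of _ Z]) simp
qed

text \<open>
  Additivity splits the value into a partial sum of the numbers \<open>T (t j)\<close> and the value on a tail.
  The tails tend to \<open>0\<close> as forms: the restrictions of the global tail to the members of any
  locally finite cover by precompact open sets are overlap-compatible, and all supports lie in \<open>C\<close>.
\<close>

theorem extension_series:
  fixes t :: "nat \<Rightarrow> 'a::metric_space ptuple"
  assumes lc: "locally compact (UNIV :: 'a set)" and S: "is_extension k T S"
    and t: "\<And>j. t j \<in> Dform k" "summable (\<lambda>j. pcross UNIV (t j))"
    and C: "compact C" "\<And>j. spt (fst (t j)) \<subseteq> C"
  shows "(\<lambda>j. T (t j)) sums S (global_section k (bseries k UNIV t))"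
proof -
  note tail = tail_series[OF t C(2)]
  define \<tau> where "\<tau> n = global_section k (bseries k UNIV (tail_series k t n))" for n
  let ?o = "global_section k (bPoly_zero k UNIV) :: 'a \<Rightarrow> 'a germ"
  have bP: "bseries k UNIV (tail_series k t n) \<in> bPoly k UNIV" for n by (rule bseries_bPoly[OF tail(4)])
  have bres0: "bres k (- C) (bseries k UNIV (tail_series k t n)) = bPoly_zero k (- C)" for n
    by (rule bres_bseries_off_support[OF tail(4) tail(2)])
  have \<tau>: "\<tau> n \<in> bGamma_c k" for n
    unfolding \<tau>_def by (rule global_section_bGamma_c[OF bP C(1) bres0])
  have diff: "sec_diff k (\<tau> n) ?o = \<tau> n" for n
    unfolding \<tau>_def by (rule sec_diff_zero[OF bP])
  obtain \<U> where \<U>: "locally_finite_open_cover \<U>" "\<forall>U\<in>\<U>. compact (closure (U :: 'a set))"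
    using precompact_locally_finite_cover[OF lc] by (elim exE conjE)
  define b where "b n U = bres k U (bseries k UNIV (tail_series k t n))" for n U
  have "overlap_compatible k \<U> (b n) (\<tau> n)" for n
    unfolding overlap_compatible_def
  proof (intro conjI ballI allI impI)
    show "locally_finite_open_cover \<U>" by (rule \<U>(1))
    show "b n U \<in> bPoly k U" for U unfolding b_def by (rule bres_bPoly[OF subset_UNIV bP])
    show "bres k (U \<inter> V) (b n U) = bres k (U \<inter> V) (b n V)" for U V
      unfolding b_def bres_bres[OF Int_lower1 subset_UNIV bP] bres_bres[OF Int_lower2 subset_UNIV bP] ..
    fix x
    have "x \<in> \<Union>\<U>" using \<U>(1) unfolding locally_finite_open_cover_def by simp
    then obtain U where U: "U \<in> \<U>" "x \<in> U" by blast
    then have "open U" using \<U>(1) unfolding locally_finite_open_cover_def by simp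
    have "\<tau> n x = germ k x U (b n U)"
      unfolding \<tau>_def global_section_def b_def
      by (rule germ_bres[OF bP \<open>open U\<close> U(2) subset_UNIV, symmetric])
    then show "\<exists>U\<in>\<U>. x \<in> U \<and> \<tau> n x = germ k x U (b n U)" using U by blast
  qed
  moreover have "spt_section k (\<tau> n) \<subseteq> C" for n
    unfolding \<tau>_def by (rule global_section_support[OF bP compact_imp_closed[OF C(1)] bres0])
  moreover have "tendsto_bPoly k U (\<lambda>n. b n U) (bPoly_zero k U)" for U
    unfolding b_def by (rule tail_series_tendsto_zero[OF t C(2)])
  ultimately have "tendsto_bGamma_c k \<tau> ?o"
    unfolding tendsto_bGamma_c_def diff using \<U> C(1)
    by (intro exI[of _ C] exI[of _ \<U>] exI[of _ b] conjI allI ballI) auto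
  then have "(\<lambda>n. S (\<tau> n)) \<longlonglongrightarrow> S ?o"
    using S \<tau> zero_section(1)[where 'a='a and k=k]
    unfolding is_extension_def seq_continuous_on_sections_def by blast
  then have lim: "(\<lambda>n. S (\<tau> n)) \<longlonglongrightarrow> 0" using zero_section(2)[OF S] by simp
  have "(\<Sum>j<n. T (t j)) = S (global_section k (bseries k UNIV t)) - S (\<tau> n)" for n
  proof -
    note h = finite_sum_section[where t=t and n=n, OF t(1) C]
    have "global_section k (bseries k UNIV t) =
        sec_add k (global_section k (bcls k UNIV (\<lambda>_. \<Sum>j<n. pure (quot UNIV (t j))))) (\<tau> n)"
      unfolding \<tau>_def sec_add_global_section[OF h(1) bP] bseries_head_tail[OF t C, symmetric] ..
    then have "S (global_section k (bseries k UNIV t)) =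
        S (global_section k (bcls k UNIV (\<lambda>_. \<Sum>j<n. pure (quot UNIV (t j))))) + S (\<tau> n)"
      using S h(3) \<tau>[of n] unfolding is_extension_def linear_on_sections_def by simp
    then show ?thesis unfolding extension_finite_sum[OF S t(1) C] by simp
  qed
  then show ?thesis
    unfolding sums_def using tendsto_diff[OF tendsto_const lim, of "S (global_section k (bseries k UNIV t))"] by simp
qed

section \<open>Cutting off a local series\<close>

text \<open>This is the sum whose supremum over \<open>B\<close> is minimised in the definition of \<open>Lip_k\<close>.\<close>

abbreviation series_norm :: "'a::metric_space set \<Rightarrow> (nat \<Rightarrow> 'a ptuple) \<Rightarrow> 'a \<Rightarrow> ennreal" where
  "series_norm B s x \<equiv> suminf (\<lambda>j. ennreal (\<bar>fst (s j) x\<bar> * prod_list (map (Lip B) (snd (s j)))))"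

text \<open>
  The series \<open>t\<close> represents \<open>\<phi>\<close> times the form given by \<open>s\<close> on \<open>B\<close>. The last \<open>k\<close> factors are only
  prescribed on \<open>B\<close>, outside of which the first factor vanishes.
\<close>

definition cutoff_series ::
    "'a set \<Rightarrow> ('a \<Rightarrow> real) \<Rightarrow> (nat \<Rightarrow> 'a ptuple) \<Rightarrow> (nat \<Rightarrow> 'a ptuple) \<Rightarrow> bool" where
  "cutoff_series B \<phi> s t \<longleftrightarrow> (\<forall>j. fst (t j) = (\<lambda>x. if x \<in> B then \<phi> x * fst (s j) x else 0) \<and>
     list_all2 (\<lambda>g h. \<forall>x\<in>B. g x = h x) (snd (s j)) (snd (t j)))"

lemma tuplesD:
  assumes "t \<in> tuples k E F"
  shows "fst t \<in> vecs E" "y \<in> set (snd t) \<Longrightarrow> y \<in> vecs F" "length (snd t) = k"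
  using assms by (cases t; auto simp: tuples_def)+

lemma LIP_inf_extension:
  fixes B U :: "'a::metric_space set"
  assumes "B \<subseteq> U" "B \<noteq> {}"
  obtains ext where
    "\<And>g. g \<in> vecs (LIP_inf U) \<Longrightarrow> ext g \<in> vecs (LIP_inf UNIV)"
    "\<And>g x. g \<in> vecs (LIP_inf U) \<Longrightarrow> x \<in> B \<Longrightarrow> ext g x = g x"
    "\<And>g. g \<in> vecs (LIP_inf U) \<Longrightarrow> Lip UNIV (ext g) \<le> Lip B g"
    "\<And>g. g \<in> vecs (LIP_inf U) \<Longrightarrow> Lnorm UNIV (ext g) \<le> Lnorm U g"
proof -
  have "\<exists>h. h \<in> vecs (LIP_inf UNIV) \<and> (\<forall>x\<in>B. h x = g x) \<and> Lip UNIV h \<le> Lip B g \<and> Lnorm UNIV h \<le> Lnorm U g"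
    if g: "g \<in> vecs (LIP_inf U)" for g
  proof -
    have gB: "(Lip B g)-lipschitz_on B g"
      by (rule lipschitz_on_Lip[OF lipschitz_on_subset[OF LIP_infD(2)[OF g] assms(1)]])
    have bd: "\<bar>g x\<bar> \<le> Lnorm U g" if "x \<in> B" for x
      using LIP_infD(7)[OF g] assms(1) that by blast
    obtain h where h: "(Lip B g)-lipschitz_on UNIV h" "\<And>x. x \<in> B \<Longrightarrow> h x = g x" "\<And>x. \<bar>h x\<bar> \<le> Lnorm U g"
      by (rule mcshane_extension[OF gB bd assms(2)]) blast+
    have "Lip B g \<le> Lnorm U g"
      using Lip_mono[OF LIP_infD(2)[OF g] assms(1)] LIP_infD(4)[OF g] by simp
    then have "Lnorm UNIV h \<le> Lnorm U g" by (rule Lnorm_le[OF h(1)]) (rule h(3))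
    moreover have "h \<in> vecs (LIP_inf UNIV)"
      by (rule LIP_infI[OF _ h(1), of "Lnorm U g"]) (simp_all add: h(3))
    ultimately show ?thesis using h(2) Lip_le[OF h(1)] by (intro exI[of _ h]) simp
  qed
  then have "\<forall>g\<in>vecs (LIP_inf U). \<exists>h. h \<in> vecs (LIP_inf UNIV) \<and> (\<forall>x\<in>B. h x = g x) \<and>
      Lip UNIV h \<le> Lip B g \<and> Lnorm UNIV h \<le> Lnorm U g" by (rule ballI)
  from bchoice[OF this] obtain ext where e: "\<forall>g\<in>vecs (LIP_inf U). ext g \<in> vecs (LIP_inf UNIV) \<and>
      (\<forall>x\<in>B. ext g x = g x) \<and> Lip UNIV (ext g) \<le> Lip B g \<and> Lnorm UNIV (ext g) \<le> Lnorm U g" by (elim exE)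
  show thesis by (rule that[of ext]) (simp_all add: e)
qed

lemma ex_cutoff_series:
  fixes B U :: "'a::metric_space set"
  assumes s: "summable_series k U s" and B: "B \<subseteq> U" "B \<noteq> {}"
    and \<phi>: "L-lipschitz_on UNIV \<phi>" "\<And>x. \<bar>\<phi> x\<bar> \<le> 1" "\<And>x. x \<notin> B \<Longrightarrow> \<phi> x = 0" "compact (spt \<phi>)"
  obtains t where "cutoff_series B \<phi> s t" "\<And>j. t j \<in> Dform k" "summable (\<lambda>j. pcross UNIV (t j))"
    "\<And>j. spt (fst (t j)) \<subseteq> spt \<phi>"
    "\<And>j. prod_list (map (Lip UNIV) (snd (t j))) \<le> prod_list (map (Lip B) (snd (s j)))"
proof -
  obtain ext where ext:
    "\<And>g. g \<in> vecs (LIP_inf U) \<Longrightarrow> ext g \<in> vecs (LIP_inf UNIV)"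
    "\<And>g x. g \<in> vecs (LIP_inf U) \<Longrightarrow> x \<in> B \<Longrightarrow> ext g x = g x"
    "\<And>g. g \<in> vecs (LIP_inf U) \<Longrightarrow> Lip UNIV (ext g) \<le> Lip B g"
    "\<And>g. g \<in> vecs (LIP_inf U) \<Longrightarrow> Lnorm UNIV (ext g) \<le> Lnorm U g"
    by (rule LIP_inf_extension[OF B]) blast
  define t where "t j = ((\<lambda>x. if x \<in> B then \<phi> x * fst (s j) x else 0), map ext (snd (s j)))" for j
  have "s j \<in> ptuples k U" for j using s unfolding summable_series_def by blast
  note s_mem = tuplesD[OF this]
  have lip: "(L * Lnorm U (fst (s j)) + 1 * Lnorm U (fst (s j)))-lipschitz_on UNIV (fst (t j))" for j
    unfolding t_def fst_conv
    by (rule lipschitz_on_cutoff[OF \<phi>(1,2,3)])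
      (use LIP_infD(7)[OF s_mem(1)[of j]] LIP_infD(5)[OF s_mem(1)[of j]] B(1)
        lipschitz_on_subset[OF LIP_infD(9)[OF s_mem(1)[of j]] B(1)] in auto)
  have L: "0 \<le> L" by (rule lipschitz_on_nonneg[OF \<phi>(1)])
  have supp: "spt (fst (t j)) \<subseteq> spt \<phi>" for j
    unfolding spt_def by (intro closure_mono) (auto simp: t_def)
  have "fst (t j) \<in> LIP_c" for j
    unfolding LIP_c_def using lip[of j] compact_closure_subset[OF \<phi>(4)] supp[of j]
    unfolding spt_def by blast
  moreover have "set (snd (t j)) \<subseteq> vecs (LIP_inf UNIV)" for j
    using ext(1) s_mem(2) by (auto simp: t_def)
  ultimately have D: "t j \<in> Dform k" for j
    using s_mem(3) by (simp add: Dform_def split_beta t_def)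
  have norm0: "Lnorm UNIV (fst (t j)) \<le> (L + 1) * Lnorm U (fst (s j))" for j
  proof (rule Lnorm_le[OF lip])
    fix x
    have "0 \<le> Lnorm U (fst (s j))" by (rule LIP_infD(5)[OF s_mem(1)])
    moreover have "\<bar>\<phi> x * fst (s j) x\<bar> \<le> 1 * Lnorm U (fst (s j))" if "x \<in> B"
      unfolding abs_mult using \<phi>(2) LIP_infD(7)[OF s_mem(1)] that B(1) by (intro mult_mono) auto
    ultimately have "\<bar>fst (t j) x\<bar> \<le> 1 * Lnorm U (fst (s j))" by (simp add: t_def)
    also have "\<dots> \<le> (L + 1) * Lnorm U (fst (s j))"
      using L LIP_infD(5)[OF s_mem(1)] by (intro mult_right_mono) auto
    finally show "\<bar>fst (t j) x\<bar> \<le> (L + 1) * Lnorm U (fst (s j))" .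
  qed (simp add: algebra_simps)
  have cr: "pcross UNIV (t j) \<le> (L + 1) * pcross U (s j)" for j
  proof -
    have "prod_list (map (Lnorm UNIV \<circ> ext) (snd (s j))) \<le> prod_list (map (Lnorm U) (snd (s j)))"
      using ext(4) s_mem(2) LIP_infD(5)[OF ext(1)[OF s_mem(2)]] by (intro prod_list_map_mono) simp
    moreover have "0 \<le> prod_list (map (Lnorm UNIV \<circ> ext) (snd (s j)))"
      using LIP_infD(5)[OF ext(1)[OF s_mem(2)]] by (intro prod_list_nonneg) auto
    moreover have "0 \<le> (L + 1) * Lnorm U (fst (s j))" using L LIP_infD(5)[OF s_mem(1)] by simp
    ultimately have "Lnorm UNIV (fst (t j)) * prod_list (map (Lnorm UNIV \<circ> ext) (snd (s j))) \<le>
        (L + 1) * Lnorm U (fst (s j)) * prod_list (map (Lnorm U) (snd (s j)))"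
      using norm0[of j] by (intro mult_mono)
    then show ?thesis by (simp add: cross_def t_def mult.assoc)
  qed
  have "summable (\<lambda>j. pcross UNIV (t j))"
  proof (rule summable_comparison_test_ev[OF always_eventually])
    show "summable (\<lambda>j. (L + 1) * pcross U (s j))"
      using s unfolding summable_series_def by (intro summable_mult) simp
    show "\<forall>j. norm (pcross UNIV (t j)) \<le> (L + 1) * pcross U (s j)"
      by (simp only: real_norm_def abs_of_nonneg[OF poly.cross_nonneg[OF Dform_ptuples[OF D]]] cr simp_thms)
  qed
  moreover have "prod_list (map (Lip UNIV) (snd (t j))) \<le> prod_list (map (Lip B) (snd (s j)))" for j
  proof -
    have "prod_list (map (Lip UNIV \<circ> ext) (snd (s j))) \<le> prod_list (map (Lip B) (snd (s j)))"
      using ext(3) s_mem(2) LIP_infD(3)[OF ext(1)[OF s_mem(2)]] by (intro prod_list_map_mono) simp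
    then show ?thesis by (simp add: t_def)
  qed
  moreover have "cutoff_series B \<phi> s t"
    unfolding cutoff_series_def using ext(2) s_mem(2)
    by (auto simp: t_def list_all2_map2 list_all2_same intro!: list.rel_refl_strong)
  ultimately show thesis using that D supp by blast
qed

text \<open>
  The extension is evaluated term by term. The mass bounds are summed under the integral, where the
  cutoff factors out and the remaining sum is at most \<open>c\<close> on \<open>B\<close>.
\<close>

lemma extension_cutoff_bound:
  fixes B U :: "'a::metric_space set"
  assumes lc: "locally compact (UNIV :: 'a set)" and S: "is_extension k T S"
    and \<mu>: "sets \<mu> = sets borel" "mass_bound k T \<mu>"
    and t: "cutoff_series B \<phi> s t" "\<And>j. t j \<in> Dform k" "summable (\<lambda>j. pcross UNIV (t j))"
      "\<And>j. spt (fst (t j)) \<subseteq> spt \<phi>"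
      "\<And>j. prod_list (map (Lip UNIV) (snd (t j))) \<le> prod_list (map (Lip B) (snd (s j)))"
    and \<phi>: "compact (spt \<phi>)" "\<And>x. 0 \<le> \<phi> x"
    and c: "\<And>x. x \<in> B \<Longrightarrow> series_norm B s x \<le> c"
  shows "ennreal \<bar>S (global_section k (bseries k UNIV t))\<bar> \<le> (\<integral>\<^sup>+x. ennreal (\<phi> x) * c \<partial>\<mu>)"
proof -
  let ?p = "\<lambda>j. prod_list (map (Lip UNIV) (snd (t j)))"
  have sums: "(\<lambda>j. T (t j)) sums S (global_section k (bseries k UNIV t))"
    by (rule extension_series[OF lc S t(2,3) \<phi>(1) t(4)])
  have p_nonneg: "0 \<le> ?p j" for j
  proof -
    have "set (snd (t j)) \<subseteq> vecs (LIP_inf UNIV)" using t(2)[of j] by (auto simp: Dform_def)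
    then show ?thesis using LIP_infD(3) by (intro prod_list_nonneg) auto
  qed
  have meas: "(\<lambda>x. ennreal \<bar>fst (t j) x\<bar>) \<in> borel_measurable \<mu>" for j
  proof -
    have "fst (t j) \<in> LIP_c" using t(2)[of j] by (auto simp: Dform_def)
    then obtain C where "C-lipschitz_on UNIV (fst (t j))" unfolding LIP_c_def by blast
    then have "continuous_on UNIV (fst (t j))" by (rule lipschitz_on_continuous_on)
    then have "fst (t j) \<in> borel_measurable borel" by (rule borel_measurable_continuous_onI)
    then have "fst (t j) \<in> borel_measurable \<mu>" using measurable_cong_sets[OF \<mu>(1) refl] by blast
    then show ?thesis by measurable
  qed
  have T: "ennreal \<bar>T (t j)\<bar> \<le> (\<integral>\<^sup>+x. ennreal (?p j) * ennreal \<bar>fst (t j) x\<bar> \<partial>\<mu>)" for j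
  proof -
    have "(fst (t j), snd (t j)) \<in> Dform k" using t(2)[of j] by simp
    then have "ennreal \<bar>T (fst (t j), snd (t j))\<bar> \<le> ennreal (?p j) * (\<integral>\<^sup>+x. ennreal \<bar>fst (t j) x\<bar> \<partial>\<mu>)"
      using \<mu>(2) unfolding mass_bound_def by blast
    then show ?thesis by (simp add: nn_integral_cmult[OF meas])
  qed
  have "ennreal \<bar>S (global_section k (bseries k UNIV t))\<bar> \<le> suminf (\<lambda>j. ennreal \<bar>T (t j)\<bar>)"
  proof (rule LIMSEQ_le_const2)
    show "(\<lambda>n. ennreal \<bar>\<Sum>j<n. T (t j)\<bar>) \<longlonglongrightarrow> ennreal \<bar>S (global_section k (bseries k UNIV t))\<bar>"
      using sums unfolding sums_def by (intro tendsto_ennrealI tendsto_rabs)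
    have "ennreal \<bar>\<Sum>j<n. T (t j)\<bar> \<le> suminf (\<lambda>j. ennreal \<bar>T (t j)\<bar>)" for n
    proof -
      have "ennreal \<bar>\<Sum>j<n. T (t j)\<bar> \<le> ennreal (\<Sum>j<n. \<bar>T (t j)\<bar>)" by (intro ennreal_leI sum_abs)
      also have "\<dots> = (\<Sum>j<n. ennreal \<bar>T (t j)\<bar>)" by simp
      also have "\<dots> \<le> suminf (\<lambda>j. ennreal \<bar>T (t j)\<bar>)" by (rule sum_le_suminf) auto
      finally show ?thesis .
    qed
    then show "\<exists>N. \<forall>n\<ge>N. ennreal \<bar>\<Sum>j<n. T (t j)\<bar> \<le> suminf (\<lambda>j. ennreal \<bar>T (t j)\<bar>)" by blast
  qed
  also have "\<dots> \<le> suminf (\<lambda>j. \<integral>\<^sup>+x. ennreal (?p j) * ennreal \<bar>fst (t j) x\<bar> \<partial>\<mu>)"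
    by (intro suminf_le T) auto
  also have "\<dots> = (\<integral>\<^sup>+x. suminf (\<lambda>j. ennreal (?p j) * ennreal \<bar>fst (t j) x\<bar>) \<partial>\<mu>)"
    using meas by (intro nn_integral_suminf[symmetric]) simp
  also have "\<dots> \<le> (\<integral>\<^sup>+x. ennreal (\<phi> x) * c \<partial>\<mu>)"
  proof (rule nn_integral_mono)
    fix x
    have ft: "fst (t j) x = (if x \<in> B then \<phi> x * fst (s j) x else 0)" for j
      using t(1) unfolding cutoff_series_def by simp
    show "suminf (\<lambda>j. ennreal (?p j) * ennreal \<bar>fst (t j) x\<bar>) \<le> ennreal (\<phi> x) * c"
    proof (cases "x \<in> B")
      case True
      have "ennreal (?p j) * ennreal \<bar>fst (t j) x\<bar> \<le>
          ennreal (\<phi> x) * ennreal (\<bar>fst (s j) x\<bar> * prod_list (map (Lip B) (snd (s j))))" for j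
      proof -
        have "?p j * \<bar>fst (t j) x\<bar> \<le> prod_list (map (Lip B) (snd (s j))) * (\<phi> x * \<bar>fst (s j) x\<bar>)"
          using t(5)[of j] p_nonneg[of j] \<phi>(2)[of x] True
          by (intro mult_mono) (auto simp: ft abs_mult)
        then have "ennreal (?p j * \<bar>fst (t j) x\<bar>) \<le>
            ennreal (\<phi> x * (\<bar>fst (s j) x\<bar> * prod_list (map (Lip B) (snd (s j)))))"
          by (intro ennreal_leI) (simp add: mult.commute mult.left_commute)
        then show ?thesis using p_nonneg[of j] \<phi>(2)[of x] order_trans[OF p_nonneg t(5)]
          by (simp add: ennreal_mult)
      qed
      then have "suminf (\<lambda>j. ennreal (?p j) * ennreal \<bar>fst (t j) x\<bar>) \<le>
          suminf (\<lambda>j. ennreal (\<phi> x) * ennreal (\<bar>fst (s j) x\<bar> * prod_list (map (Lip B) (snd (s j)))))"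
        by (intro suminf_le) auto
      also have "\<dots> \<le> ennreal (\<phi> x) * c"
        unfolding ennreal_suminf_cmult using c[OF True] by (rule mult_left_mono) simp
      finally show ?thesis .
    qed (simp add: ft)
  qed
  finally show ?thesis .
qed

section \<open>Gluing with a partition of unity\<close>

abbreviation mul :: "'a set \<Rightarrow> ('a \<Rightarrow> real) \<Rightarrow> ('a \<Rightarrow> real) \<times> ('a \<Rightarrow> real) set list \<Rightarrow>
    ('a \<Rightarrow> real) \<times> ('a \<Rightarrow> real) set list" where
  "mul W \<phi> \<equiv> (\<lambda>(f, As). ((\<lambda>x\<in>W. \<phi> x * f x), map id As))"

text \<open>
  On subsets of \<open>B\<close> the extended factors agree with the original ones, hence so do their classes modulo
  constants, and only the factor \<open>\<phi>\<close> remains.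
\<close>

lemma cutoff_series_restrict:
  assumes ct: "cutoff_series B \<phi> s t" and W: "W \<subseteq> B" "B \<subseteq> U"
    and s: "s j \<in> ptuples k U" and t: "t j \<in> ptuples k UNIV"
  shows "res W (quot UNIV (t j)) = mul W \<phi> (res W (quot U (s j)))"
proof -
  have 1: "fst (t j) = (\<lambda>x. if x \<in> B then \<phi> x * fst (s j) x else 0)"
    and 2: "list_all2 (\<lambda>g h. \<forall>x\<in>B. g x = h x) (snd (s j)) (snd (t j))"
    using ct unfolding cutoff_series_def by blast+
  have "map (\<lambda>g. restrict g W) (snd (t j)) = map (\<lambda>g. restrict g W) (snd (s j))"
    using 2
  proof (induction rule: list_all2_induct)
    case (Cons g gs h hs)
    have "restrict h W = restrict g W"
      using Cons.hyps W(1) by (intro restrict_ext) auto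
    then show ?case by (simp only: list.map Cons.IH)
  qed simp
  moreover have "restrict (fst (t j)) W = (\<lambda>x\<in>W. \<phi> x * restrict (fst (s j)) W x)"
    unfolding 1 using W(1) by (intro restrict_ext) auto
  ultimately have "quot W (pres W (t j)) = mul W \<phi> (quot W (pres W (s j)))"
    by (simp add: split_beta)
  then show ?thesis
    unfolding ptuples_restrict(3)[OF t subset_UNIV] ptuples_restrict(3)[OF s subset_trans[OF W]] .
qed

text \<open>
  By additivity in the first factor, a finite sum of multiplications acts as multiplication by the sum.
\<close>

lemma sum_mul_pure:
  assumes "finite I" and t: "(f, As) \<in> btuples k W"
    and \<phi>: "\<And>i. i \<in> I \<Longrightarrow> (L i)-lipschitz_on W (\<phi> i)" "\<And>i x. i \<in> I \<Longrightarrow> x \<in> W \<Longrightarrow> \<bar>\<phi> i x\<bar> \<le> 1"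
  shows "(\<Sum>i\<in>I. pure (mul W (\<phi> i) (f, As))) - pure (\<lambda>x\<in>W. (\<Sum>i\<in>I. \<phi> i x) * f x, As)
      \<in> brel k W \<and>
    (\<lambda>x\<in>W. (\<Sum>i\<in>I. \<phi> i x) * f x) \<in> vecs (LIP_inf W)"
  using assms(1) \<phi>
proof (induction I rule: finite_induct)
  case empty
  have f: "f \<in> vecs (LIP_inf W)" using t by (simp add: tuples_def)
  have 0: "(\<lambda>x\<in>W. 0 * f x) \<in> vecs (LIP_inf W)" by (rule LIP_inf_scale(1)[OF f])
  then have "(\<lambda>x\<in>W. 0 * f x, As) \<in> btuples k W" using t by (simp add: tuples_def)
  then have "pure (\<lambda>x\<in>W. 0 * f x, As) \<in> brel k W"
    by (rule pure_zero_factor) simp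
  from span_neg[OF this] 0 show ?case unfolding sum.empty diff_0 by (rule conjI)
next
  case (insert i I)
  let ?g = "\<lambda>x\<in>W. (\<Sum>i\<in>I. \<phi> i x) * f x" and ?h = "\<lambda>x\<in>W. \<phi> i x * f x"
  have f: "f \<in> vecs (LIP_inf W)" using t by (simp add: tuples_def)
  have prems: "\<And>i. i \<in> I \<Longrightarrow> (L i)-lipschitz_on W (\<phi> i)" "\<And>i x. i \<in> I \<Longrightarrow> x \<in> W \<Longrightarrow> \<bar>\<phi> i x\<bar> \<le> 1"
    using insert.prems by simp_all
  note IH = insert.IH[OF prems, THEN conjunct1] insert.IH[OF prems, THEN conjunct2]
  have h: "?h \<in> vecs (LIP_inf W)"
    by (rule LIP_inf_times(1)[OF f, of "L i" _ 1]) (use insert.prems in auto)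
  have eq: "(\<lambda>x\<in>W. (\<Sum>i\<in>insert i I. \<phi> i x) * f x) = (\<lambda>x\<in>W. ?h x + ?g x)"
    using insert.hyps by (intro restrict_ext) (simp add: distrib_right)
  have "(?h, As) \<in> btuples k W" using t h by (simp add: tuples_def)
  from bpoly.pure_add_first[OF this IH(2)]
  have r: "pure (vadd (LIP_inf W) ?h ?g, As) - (pure (?h, As) + pure (?g, As))
      \<in> brel k W" .
  have "(\<Sum>i\<in>insert i I. pure (mul W (\<phi> i) (f, As))) - pure (\<lambda>x\<in>W. ?h x + ?g x, As) =
      ((\<Sum>i\<in>I. pure (mul W (\<phi> i) (f, As))) - pure (?g, As)) -
      (pure (vadd (LIP_inf W) ?h ?g, As) - (pure (?h, As) + pure (?g, As)))"
    using insert.hyps by simp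
  also have "\<dots> \<in> brel k W"
    by (rule span_diff[OF IH(1) r])
  finally show ?case unfolding eq using LIP_inf_vadd[OF h IH(2)] by (rule conjI)
qed

lemma bcauchy_sum:
  assumes "finite I" "\<And>i. i \<in> I \<Longrightarrow> u i \<in> bcauchy k U"
  shows "(\<lambda>n. \<Sum>i\<in>I. u i n) \<in> bcauchy k U"
  using assms by (induction I rule: finite_induct) (simp_all add: zero_cauchy bpoly.cauchy_add)

text \<open>
  The germs at a given \<open>x\<close> are compared on a small neighbourhood \<open>W\<close>. Let \<open>P\<close> represent \<open>\<omega>\<close> there.
  If \<open>x\<close> lies in the support of \<open>\<phi> i\<close>, then \<open>s i\<close> represents \<open>\<omega>\<close> on \<open>W\<close>, so the \<open>i\<close>-th cutoff series is \<open>\<phi> i\<close> times \<open>P\<close>;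
  otherwise \<open>\<phi> i\<close> vanishes on \<open>W\<close> and both are \<open>0\<close>. The sum over \<open>i\<close> is therefore \<open>(\<Sum>\<^sub>i \<phi> i) P\<close>. This
  equals \<open>P\<close> if \<open>x\<close> lies in \<open>N\<close>, where the functions add up to \<open>1\<close>, and also outside the support of \<open>\<omega>\<close>,
  where \<open>P\<close> is equivalent to \<open>0\<close>.
\<close>

lemma partition_of_unity_section:
  fixes \<omega> :: "'a::metric_space \<Rightarrow> 'a germ" and I :: "nat set"
  assumes \<omega>: "\<omega> \<in> bGamma k" and I: "finite I"
    and B: "\<And>i. i \<in> I \<Longrightarrow> open (B i)" "\<And>i. i \<in> I \<Longrightarrow> B i \<subseteq> U i" "\<And>i. i \<in> I \<Longrightarrow> open (U i)"
    and s: "\<And>i. i \<in> I \<Longrightarrow> summable_series k (U i) (s i)"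
    and germ: "\<And>i x. i \<in> I \<Longrightarrow> x \<in> B i \<Longrightarrow> \<omega> x = germ k x (U i) (bseries k (U i) (s i))"
    and \<phi>: "\<And>i. i \<in> I \<Longrightarrow> (L i)-lipschitz_on UNIV (\<phi> i)" "\<And>i x. i \<in> I \<Longrightarrow> \<bar>\<phi> i x\<bar> \<le> 1"
      "\<And>i. i \<in> I \<Longrightarrow> spt (\<phi> i) \<subseteq> B i"
    and t: "\<And>i. i \<in> I \<Longrightarrow> cutoff_series (B i) (\<phi> i) (s i) (t i)"
      "\<And>i. i \<in> I \<Longrightarrow> summable_series k UNIV (t i)"
    and N: "open N" "spt_section k \<omega> \<subseteq> N" "\<And>x. x \<in> N \<Longrightarrow> (\<Sum>i\<in>I. \<phi> i x) = 1"
  shows "global_section k (bcls k UNIV (\<lambda>n. \<Sum>i\<in>I. \<Sum>j<n. pure (quot UNIV (t i j)))) = \<omega>"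
proof
  fix x
  let ?T = "\<lambda>n. \<Sum>i\<in>I. \<Sum>j<n. pure (quot UNIV (t i j))"
  have Tc: "?T \<in> bcauchy k UNIV"
    using I bseries_eq_Qmap(2)[OF t(2)] by (rule bcauchy_sum)
  obtain U0 b0 where U0: "open U0" "x \<in> U0" "b0 \<in> bPoly k U0" "\<omega> x = germ k x U0 b0"
    using \<omega> unfolding bGamma_def stalk_def by blast
  obtain u0 where u0: "u0 \<in> bcauchy k U0" "b0 = bcls k U0 u0" using bPolyE[OF U0(3)] .
  have "\<exists>W. open W \<and> x \<in> W \<and> W \<subseteq> U0 \<and> ((\<forall>y\<in>W. (\<Sum>i\<in>I. \<phi> i y) = 1) \<or> bres k W b0 = bPoly_zero k W)"
  proof (cases "x \<in> N")
    case True
    then show ?thesis using N(1,3) U0(1,2) by (intro exI[of _ "N \<inter> U0"]) auto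
  next
    case False
    then have "x \<notin> {x. \<omega> x \<noteq> germ_zero k x}"
      using N(2) closure_subset[of "{x. \<omega> x \<noteq> germ_zero k x}"] unfolding spt_section_def by blast
    then have "germ k x U0 b0 = germ k x UNIV (bPoly_zero k UNIV)"
      using U0(4) by (simp add: germ_zero_def)
    then obtain W where W: "open W" "x \<in> W" "W \<subseteq> U0" "bres k W b0 = bres k W (bPoly_zero k UNIV)"
      using germ_eqD[OF _ open_UNIV UNIV_I bPoly_zero_bPoly] by metis
    then have "bres k W b0 = bPoly_zero k W" using bres_zero[of W UNIV k] by simp
    with W show ?thesis by blast
  qed
  then obtain W0 where W0: "open W0" "x \<in> W0" "W0 \<subseteq> U0"
    "(\<forall>y\<in>W0. (\<Sum>i\<in>I. \<phi> i y) = 1) \<or> bres k W0 b0 = bPoly_zero k W0" by blast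
  have "\<exists>W. open W \<and> x \<in> W \<and> W \<subseteq> U0 \<and> ((\<forall>y\<in>W. \<phi> i y = 0) \<or>
      (W \<subseteq> B i \<and> bres k W b0 = bres k W (bseries k (U i) (s i))))" if i: "i \<in> I" for i
  proof (cases "x \<in> spt (\<phi> i)")
    case True
    then have xB: "x \<in> B i" using \<phi>(3)[OF i] by blast
    then have "germ k x U0 b0 = germ k x (U i) (bseries k (U i) (s i))" using germ[OF i] U0(4) by simp
    then obtain W where W: "open W" "x \<in> W" "W \<subseteq> U0" "W \<subseteq> U i" "bres k W b0 = bres k W (bseries k (U i) (s i))"
      by (rule germ_eqD[OF _ B(3)[OF i] subsetD[OF B(2)[OF i] xB] bseries_bPoly[OF s[OF i]]])
    have "bres k (W \<inter> B i) b0 = bres k (W \<inter> B i) (bseries k (U i) (s i))"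
      by (rule bres_eq_subset[OF W(5) Int_lower1 W(3,4) U0(3) bseries_bPoly[OF s[OF i]]])
    then show ?thesis using W(1-3) xB B(1)[OF i] by (intro exI[of _ "W \<inter> B i"]) auto
  next
    case False
    have "open (- spt (\<phi> i))" by (simp add: spt_def open_Compl)
    then show ?thesis using False U0(1,2) not_in_spt[of _ "\<phi> i"]
      by (intro exI[of _ "U0 \<inter> - spt (\<phi> i)"]) auto
  qed
  then obtain Wi where Wi: "\<And>i. i \<in> I \<Longrightarrow> open (Wi i)" "\<And>i. i \<in> I \<Longrightarrow> x \<in> Wi i" "\<And>i. i \<in> I \<Longrightarrow> Wi i \<subseteq> U0"
    "\<And>i. i \<in> I \<Longrightarrow> (\<forall>y\<in>Wi i. \<phi> i y = 0) \<or> (Wi i \<subseteq> B i \<and> bres k (Wi i) b0 = bres k (Wi i) (bseries k (U i) (s i)))"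
    by metis
  define W where "W = W0 \<inter> (\<Inter>i\<in>I. Wi i)"
  have W: "open W" "x \<in> W" "W \<subseteq> U0" "W \<subseteq> W0" "\<And>i. i \<in> I \<Longrightarrow> W \<subseteq> Wi i"
    unfolding W_def using W0 Wi I by (auto intro: open_INT)
  define P where "P n = push (res W) (u0 n)" for n
  have P: "P \<in> bcauchy k W" "bres k W b0 = bcls k W P"
    unfolding P_def u0(2) using bres_bcls[OF W(3) u0(1)] by simp_all
  note Pf = bpoly.cauchyD[OF P(1)]
  define a where "a i n = (\<Sum>j<n. pure (res W (quot UNIV (t i j))))" for i n
  have ac: "a i \<in> bcauchy k W" if i: "i \<in> I" for i
    using bres_bcls(2)[OF subset_UNIV bseries_eq_Qmap(2)[OF t(2)[OF i]], of W]
    unfolding a_def push_sum push_pure .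
  have \<phi>W: "(L i)-lipschitz_on W (\<phi> i)" if i: "i \<in> I" for i
    by (rule lipschitz_on_subset[OF \<phi>(1)[OF i] subset_UNIV])
  have M: "tensor_map (LIP_inf W) (LIP_bar W) (LIP_inf W) (LIP_bar W) (\<lambda>f. \<lambda>x\<in>W. \<phi> i x * f x) id (L i + 1)"
    if i: "i \<in> I" for i
    by (rule tensor_map_times[OF \<phi>W[OF i]]) (use \<phi>(2)[OF i] in auto)
  have mul_formal: "push (mul W (\<phi> i)) (P n) \<in> bformal k W" if i: "i \<in> I" for i n
  proof -
    interpret m: tensor_map k "LIP_inf W" "LIP_bar W" "LIP_inf W" "LIP_bar W" "\<lambda>f. \<lambda>x\<in>W. \<phi> i x * f x" id "L i + 1"
      by (rule M[OF i])
    show ?thesis by (rule m.push_formal[OF Pf])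
  qed
  have a_equiv: "bequiv k W (a i) (\<lambda>n. push (mul W (\<phi> i)) (P n))" if i: "i \<in> I" for i
  proof -
    interpret m: tensor_map k "LIP_inf W" "LIP_bar W" "LIP_inf W" "LIP_bar W" "\<lambda>f. \<lambda>x\<in>W. \<phi> i x * f x" id "L i + 1"
      by (rule M[OF i])
    have tt: "t i j \<in> ptuples k UNIV" for j using t(2)[OF i] unfolding summable_series_def by blast
    from Wi(4)[OF i] show ?thesis
    proof
      assume z: "\<forall>y\<in>Wi i. \<phi> i y = 0"
      then have z: "\<phi> i y = 0" if "y \<in> W" for y using W(5)[OF i] that by blast
      show ?thesis
      proof (rule bpoly.equivalentI_R, rule span_diff)
        fix n
        have "pure (res W (quot UNIV (t i j))) \<in> brel k W" for j
        proof -
          have eq: "res W (quot UNIV (t i j)) = (restrict (fst (t i j)) W, map ((\<lambda>A. (\<lambda>f. restrict f W) ` A) \<circ> qmap UNIV) (snd (t i j)))"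
            by (simp add: split_beta)
          have "res W (quot UNIV (t i j)) \<in> btuples k W"
            unfolding ptuples_restrict(3)[OF tt subset_UNIV, symmetric]
            by (rule quot_btuples[OF ptuples_restrict(1)[OF tt subset_UNIV]])
          then show ?thesis
            unfolding eq using t(1)[OF i] z by (intro pure_zero_factor) (auto simp: cutoff_series_def)
        qed
        then show "a i n \<in> brel k W"
          unfolding a_def by (intro span_sum)
        show "push (mul W (\<phi> i)) (P n) \<in> brel k W"
        proof (rule linear_on_pure_in_span[OF linear_push, of _ "btuples k W"])
          show "Poly_Mapping.keys (P n) \<subseteq> btuples k W" using Pf[of n] unfolding bpoly.formal_def by simp
          fix p assume p: "p \<in> btuples k W"
          obtain f As where fA: "p = (f, As)" by (cases p)
          have "mul W (\<phi> i) p \<in> btuples k W" by (rule m.tmap_tuples[OF p])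
          then show "push (mul W (\<phi> i)) (pure p) \<in> brel k W"
            unfolding push_pure fA prod.case by (rule pure_zero_factor) (simp add: z)
        qed
      qed
    next
      assume "Wi i \<subseteq> B i \<and> bres k (Wi i) b0 = bres k (Wi i) (bseries k (U i) (s i))"
      then have WB: "Wi i \<subseteq> B i" and eq: "bres k (Wi i) b0 = bres k (Wi i) (bseries k (U i) (s i))" by simp_all
      have WU: "Wi i \<subseteq> U i" by (rule subset_trans[OF WB B(2)[OF i]])
      have WB': "W \<subseteq> B i" by (rule subset_trans[OF W(5)[OF i] WB])
      have WU': "W \<subseteq> U i" by (rule subset_trans[OF W(5)[OF i] WU])
      have ss: "s i j \<in> ptuples k (U i)" for j using s[OF i] unfolding summable_series_def by blast
      define \<sigma> where "\<sigma> n = (\<Sum>j<n. pure (res W (quot (U i) (s i j))))" for n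
      have \<sigma>: "\<sigma> \<in> bcauchy k W" "bres k W (bseries k (U i) (s i)) = bcls k W \<sigma>"
        using bres_bcls[OF WU' bseries_eq_Qmap(2)[OF s[OF i]]]
        unfolding \<sigma>_def bseries_def push_sum push_pure by simp_all
      have "bres k W b0 = bres k W (bseries k (U i) (s i))"
        by (rule bres_eq_subset[OF eq W(5)[OF i] Wi(3)[OF i] WU U0(3) bseries_bPoly[OF s[OF i]]])
      then have "bequiv k W \<sigma> P"
        unfolding P(2) \<sigma>(2) using bpoly.cls_eq_iff[OF \<sigma>(1) P(1)] by simp
      then have "bequiv k W (\<lambda>n. push (mul W (\<phi> i)) (\<sigma> n)) (\<lambda>n. push (mul W (\<phi> i)) (P n))"
        by (intro m.equivalent_push bpoly.cauchyD[OF \<sigma>(1)] Pf)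
      moreover have "a i n = push (mul W (\<phi> i)) (\<sigma> n)" for n
        unfolding a_def \<sigma>_def push_sum push_pure
        by (intro sum.cong refl arg_cong[where f=pure] cutoff_series_restrict[OF t(1)[OF i] WB' B(2)[OF i] ss tt])
      ultimately show ?thesis by presburger
    qed
  qed
  have sum_equiv: "bequiv k W (\<lambda>n. \<Sum>i\<in>I. push (mul W (\<phi> i)) (P n)) P"
    using W0(4)
  proof
    assume one: "\<forall>y\<in>W0. (\<Sum>i\<in>I. \<phi> i y) = 1"
    show ?thesis
    proof (rule bpoly.equivalentI_R)
      fix n
      \<comment> \<open>The defect is linear, so it suffices to treat pure tensors.\<close>
      let ?h = "\<lambda>v. (\<Sum>i\<in>I. push (mul W (\<phi> i)) v) - v"
      have "linear ?h"
        by (intro linear_compose_sub linear_compose_sum ballI linear_push linear_ident)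
      then show "?h (P n) \<in> brel k W"
      proof (rule linear_on_pure_in_span[of _ _ "btuples k W"])
        show "Poly_Mapping.keys (P n) \<subseteq> btuples k W" using Pf[of n] unfolding bpoly.formal_def by simp
        fix p assume p: "p \<in> btuples k W"
        obtain f As where fA: "p = (f, As)" by (cases p)
        have "f \<in> vecs (LIP_inf W)" using p by (simp add: fA tuples_def)
        then have "(\<lambda>x\<in>W. (\<Sum>i\<in>I. \<phi> i x) * f x) = f"
          using LIP_infD(1) one W(4) by (intro extensionalityI[of _ W]) auto
        moreover have "(\<Sum>i\<in>I. pure (mul W (\<phi> i) (f, As))) - pure (\<lambda>x\<in>W. (\<Sum>i\<in>I. \<phi> i x) * f x, As)
            \<in> brel k W"
          by (rule sum_mul_pure[THEN conjunct1, OF I p[unfolded fA] \<phi>W \<phi>(2)])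
        ultimately show "?h (pure p) \<in> brel k W"
          unfolding push_pure fA by simp
      qed
    qed
  next
    assume "bres k W0 b0 = bPoly_zero k W0"
    then have "bres k W (bres k W0 b0) = bPoly_zero k W" using bres_zero[OF W(4), of k] by simp
    then have "bcls k W P = bcls k W (\<lambda>_. 0)"
      unfolding bres_bres[OF W(4) W0(3) U0(3)] P(2) bPoly_zero_bcls .
    then have P0: "bequiv k W P (\<lambda>_. 0)" using bpoly.cls_eq_iff[OF P(1) zero_cauchy] by simp
    have "bequiv k W (\<lambda>n. push (mul W (\<phi> i)) (P n)) (\<lambda>_. 0)" if i: "i \<in> I" for i
    proof -
      interpret m: tensor_map k "LIP_inf W" "LIP_bar W" "LIP_inf W" "LIP_bar W" "\<lambda>f. \<lambda>x\<in>W. \<phi> i x * f x" id "L i + 1"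
        by (rule M[OF i])
      have "bequiv k W (\<lambda>n. push (mul W (\<phi> i)) (P n)) (\<lambda>n. push (mul W (\<phi> i)) 0)"
        by (intro m.equivalent_push Pf P0) simp
      then show ?thesis by (simp only: linear_0[OF linear_push])
    qed
    then have "bequiv k W (\<lambda>n. \<Sum>i\<in>I. push (mul W (\<phi> i)) (P n)) (\<lambda>n. \<Sum>i\<in>I. 0)"
      by (intro bpoly.equivalent_sum mul_formal) simp_all
    then have "bequiv k W (\<lambda>n. \<Sum>i\<in>I. push (mul W (\<phi> i)) (P n)) (\<lambda>n. 0)" by simp
    moreover have "bequiv k W (\<lambda>_. 0) P"
      by (rule bpoly.equivalent_sym_cauchy[OF P(1) zero_cauchy P0])
    ultimately show ?thesis
      by (rule bpoly.equivalent_trans[rotated 3])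
        (rule bpoly.formal_sum bpoly.formal_0 mul_formal Pf; assumption?)+
  qed
  have "bequiv k W (\<lambda>n. \<Sum>i\<in>I. a i n) (\<lambda>n. \<Sum>i\<in>I. push (mul W (\<phi> i)) (P n))"
    by (intro bpoly.equivalent_sum a_equiv mul_formal bpoly.cauchyD[OF ac])
  then have "bequiv k W (\<lambda>n. \<Sum>i\<in>I. a i n) P"
    by (rule bpoly.equivalent_trans[rotated 3, OF _ sum_equiv])
      (rule bpoly.formal_sum mul_formal Pf bpoly.cauchyD[OF ac]; assumption?)+
  then have "bcls k W (\<lambda>n. \<Sum>i\<in>I. a i n) = bcls k W P"
    by (intro bpoly.cls_eqI bcauchy_sum I ac P(1))
  then have "bres k W (bcls k UNIV ?T) = bres k W b0"
    unfolding bres_bcls(1)[OF subset_UNIV Tc] P(2) a_def push_sum push_pure .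
  then have "germ k x UNIV (bcls k UNIV ?T) = germ k x U0 b0"
    by (rule germ_eqI[OF bcls_bPoly[OF Tc] U0(3) W(1,2) subset_UNIV W(3)])
  then show "global_section k (bcls k UNIV ?T) x = \<omega> x"
    unfolding global_section_def U0(4) .
qed

lemma extension_sum:
  fixes u :: "nat \<Rightarrow> nat \<Rightarrow> ('a::metric_space \<Rightarrow> real) \<times> ('a \<Rightarrow> real) set list \<Rightarrow>\<^sub>0 real"
  assumes S: "is_extension k T S" and "finite I" and C: "compact C"
    and u: "\<And>i. i \<in> I \<Longrightarrow> u i \<in> bcauchy k UNIV"
      "\<And>i. i \<in> I \<Longrightarrow> bres k (- C) (bcls k UNIV (u i)) = bPoly_zero k (- C)"
  shows "S (global_section k (bcls k UNIV (\<lambda>n. \<Sum>i\<in>I. u i n))) =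
      (\<Sum>i\<in>I. S (global_section k (bcls k UNIV (u i)))) \<and>
    bres k (- C) (bcls k UNIV (\<lambda>n. \<Sum>i\<in>I. u i n)) = bPoly_zero k (- C)"
  using assms(2) u
proof (induction I rule: finite_induct)
  case empty
  show ?case using zero_section(2)[OF S] bres_zero[of "- C" UNIV k] by (simp add: bPoly_zero_bcls)
next
  case (insert i I)
  let ?v = "\<lambda>n. \<Sum>i\<in>I. u i n"
  have IH: "S (global_section k (bcls k UNIV ?v)) = (\<Sum>i\<in>I. S (global_section k (bcls k UNIV (u i))))"
    "bres k (- C) (bcls k UNIV ?v) = bPoly_zero k (- C)"
    using insert by simp_all
  have c: "u i \<in> bcauchy k UNIV" "?v \<in> bcauchy k UNIV"
    using insert.prems(1) by (simp_all add: bcauchy_sum[OF insert.hyps(1)])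
  have z: "bres k (- C) (bcls k UNIV (u i)) = bPoly_zero k (- C)" using insert.prems(2) by simp
  have G: "global_section k (bcls k UNIV (u i)) \<in> bGamma_c k" "global_section k (bcls k UNIV ?v) \<in> bGamma_c k"
    by (intro global_section_bGamma_c[OF bcls_bPoly C] c z IH(2))+
  have eq: "bcls k UNIV (\<lambda>n. \<Sum>i\<in>insert i I. u i n) =
      badd k UNIV (bcls k UNIV (u i)) (bcls k UNIV ?v)"
    unfolding bpoly.ct_add_cls[OF c] using insert.hyps by simp
  have "S (global_section k (bcls k UNIV (\<lambda>n. \<Sum>i\<in>insert i I. u i n))) =
      S (global_section k (bcls k UNIV (u i))) + S (global_section k (bcls k UNIV ?v))"
    unfolding eq sec_add_global_section[OF bcls_bPoly[OF c(1)] bcls_bPoly[OF c(2)], symmetric]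
    using S G unfolding is_extension_def linear_on_sections_def by blast
  moreover have "bres k (- C) (bcls k UNIV (\<lambda>n. \<Sum>i\<in>insert i I. u i n)) = bPoly_zero k (- C)"
    unfolding eq bPoly_add(2)[OF bcls_bPoly[OF c(1)] bcls_bPoly[OF c(2)] subset_UNIV] z IH(2)
    unfolding bPoly_zero_bcls bpoly.ct_add_cls[OF zero_cauchy zero_cauchy] by simp
  ultimately show ?case using IH(1) insert.hyps by simp
qed

theorem extension_partition_bound:
  fixes \<omega> :: "'a::metric_space \<Rightarrow> 'a germ" and I :: "nat set" and c :: "nat \<Rightarrow> ennreal"
  assumes lc: "locally compact (UNIV :: 'a set)" and S: "is_extension k T S"
    and \<mu>: "sets \<mu> = sets borel" "mass_bound k T \<mu>"
    and \<omega>: "\<omega> \<in> bGamma k" and I: "finite I"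
    and B: "\<And>i. i \<in> I \<Longrightarrow> open (B i)" "\<And>i. i \<in> I \<Longrightarrow> B i \<noteq> {}" "\<And>i. i \<in> I \<Longrightarrow> B i \<subseteq> U i"
      "\<And>i. i \<in> I \<Longrightarrow> open (U i)"
    and s: "\<And>i. i \<in> I \<Longrightarrow> summable_series k (U i) (s i)"
    and germ: "\<And>i x. i \<in> I \<Longrightarrow> x \<in> B i \<Longrightarrow> \<omega> x = germ k x (U i) (bseries k (U i) (s i))"
    and c: "\<And>i x. i \<in> I \<Longrightarrow> x \<in> B i \<Longrightarrow>
      series_norm (B i) (s i) x \<le> c i"
    and \<phi>: "\<And>i. i \<in> I \<Longrightarrow> (L i)-lipschitz_on UNIV (\<phi> i)" "\<And>i x. i \<in> I \<Longrightarrow> 0 \<le> \<phi> i x"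
      "\<And>i x. i \<in> I \<Longrightarrow> \<phi> i x \<le> 1" "\<And>i. i \<in> I \<Longrightarrow> spt (\<phi> i) \<subseteq> B i" "\<And>i. i \<in> I \<Longrightarrow> compact (spt (\<phi> i))"
    and N: "open N" "spt_section k \<omega> \<subseteq> N" "\<And>x. x \<in> N \<Longrightarrow> (\<Sum>i\<in>I. \<phi> i x) = 1"
  shows "ennreal \<bar>S \<omega>\<bar> \<le> (\<Sum>i\<in>I. \<integral>\<^sup>+x. ennreal (\<phi> i x) * c i \<partial>\<mu>)"
proof -
  have abs: "\<bar>\<phi> i x\<bar> \<le> 1" if "i \<in> I" for i x using \<phi>(2,3)[OF that, of x] by simp
  have out: "\<phi> i x = 0" if "i \<in> I" "x \<notin> B i" for i x
    using \<phi>(4)[OF that(1)] that(2) not_in_spt[of x "\<phi> i"] by blast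
  have "\<exists>t. cutoff_series (B i) (\<phi> i) (s i) t \<and> (\<forall>j. t j \<in> Dform k) \<and> summable (\<lambda>j. pcross UNIV (t j)) \<and>
      (\<forall>j. spt (fst (t j)) \<subseteq> spt (\<phi> i)) \<and>
      (\<forall>j. prod_list (map (Lip UNIV) (snd (t j))) \<le> prod_list (map (Lip (B i)) (snd (s i j))))"
    if i: "i \<in> I" for i
    by (rule ex_cutoff_series[OF s[OF i] B(3)[OF i] B(2)[OF i] \<phi>(1)[OF i] abs[OF i] out[OF i] \<phi>(5)[OF i]]) blast+
  then have "\<forall>i\<in>I. \<exists>t. cutoff_series (B i) (\<phi> i) (s i) t \<and> (\<forall>j. t j \<in> Dform k) \<and> summable (\<lambda>j. pcross UNIV (t j)) \<and>
      (\<forall>j. spt (fst (t j)) \<subseteq> spt (\<phi> i)) \<and>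
      (\<forall>j. prod_list (map (Lip UNIV) (snd (t j))) \<le> prod_list (map (Lip (B i)) (snd (s i j))))"
    by (rule ballI)
  from bchoice[OF this] obtain t where "\<forall>i\<in>I. cutoff_series (B i) (\<phi> i) (s i) (t i) \<and>
      (\<forall>j. t i j \<in> Dform k) \<and> summable (\<lambda>j. pcross UNIV (t i j)) \<and> (\<forall>j. spt (fst (t i j)) \<subseteq> spt (\<phi> i)) \<and>
      (\<forall>j. prod_list (map (Lip UNIV) (snd (t i j))) \<le> prod_list (map (Lip (B i)) (snd (s i j))))"
    by (elim exE)
  then have t: "cutoff_series (B i) (\<phi> i) (s i) (t i)" "\<And>j. t i j \<in> Dform k"
      "summable (\<lambda>j. pcross UNIV (t i j))" "\<And>j. spt (fst (t i j)) \<subseteq> spt (\<phi> i)"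
      "\<And>j. prod_list (map (Lip UNIV) (snd (t i j))) \<le> prod_list (map (Lip (B i)) (snd (s i j)))"
    if "i \<in> I" for i
    using that by simp_all
  have ts: "summable_series k UNIV (t i)" if i: "i \<in> I" for i
    unfolding summable_series_def using Dform_ptuples[OF t(2)[OF i]] t(3)[OF i] by blast
  define C where "C = (\<Union>i\<in>I. spt (\<phi> i))"
  have C: "compact C" unfolding C_def using I \<phi>(5) by (intro compact_UN)
  let ?u = "\<lambda>i n. \<Sum>j<n. pure (quot UNIV (t i j))"
  have z: "bres k (- C) (bcls k UNIV (?u i)) = bPoly_zero k (- C)" if i: "i \<in> I" for i
  proof -
    have "spt (fst (t i j)) \<subseteq> C" for j using t(4)[OF i, of j] i unfolding C_def by blast
    from bres_bseries_off_support[OF ts[OF i] this] show ?thesis unfolding bseries_def .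
  qed
  have "\<omega> = global_section k (bcls k UNIV (\<lambda>n. \<Sum>i\<in>I. ?u i n))"
    by (rule partition_of_unity_section[OF \<omega> I B(1,3,4) s germ \<phi>(1) abs \<phi>(4) t(1) ts N, symmetric])
  then have "S \<omega> = (\<Sum>i\<in>I. S (global_section k (bseries k UNIV (t i))))"
    using extension_sum[where u="?u", OF S I C bseries_eq_Qmap(2)[OF ts] z] unfolding bseries_def by simp
  then have "ennreal \<bar>S \<omega>\<bar> \<le> ennreal (\<Sum>i\<in>I. \<bar>S (global_section k (bseries k UNIV (t i)))\<bar>)"
    by (intro ennreal_leI) (simp only: sum_abs)
  also have "\<dots> = (\<Sum>i\<in>I. ennreal \<bar>S (global_section k (bseries k UNIV (t i)))\<bar>)" by simp
  also have "\<dots> \<le> (\<Sum>i\<in>I. \<integral>\<^sup>+x. ennreal (\<phi> i x) * c i \<partial>\<mu>)"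
    by (intro sum_mono extension_cutoff_bound[OF lc S \<mu> t \<phi>(5,2) c])
  finally show ?thesis .
qed

section \<open>Majorants and partitions of unity\<close>

text \<open>
  The Lipschitz envelopes \<open>g\<^sub>n x = sup\<^sub>y (h y - n dist x y)\<close> decrease to \<open>h\<close>: points \<open>y\<close> close to \<open>x\<close> are
  controlled by semicontinuity, and distant ones by the penalty \<open>n dist x y\<close>. Monotone convergence
  then makes the integrals converge.
\<close>

lemma usc_lipschitz_majorant:
  fixes h :: "'a::metric_space \<Rightarrow> real"
  assumes \<mu>: "sets \<mu> = sets borel" and N: "open N" "emeasure \<mu> N < \<infinity>"
    and h: "\<And>x. x \<in> N \<Longrightarrow> 0 \<le> h x" "\<And>x. x \<in> N \<Longrightarrow> h x \<le> M"
    and usc: "\<And>x a. x \<in> N \<Longrightarrow> h x < a \<Longrightarrow> \<exists>d>0. \<forall>y\<in>N. dist x y < d \<longrightarrow> h y < a"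
    and e: "0 < (e::real)"
  obtains g where "continuous_on N g" "\<And>x. x \<in> N \<Longrightarrow> h x \<le> g x"
    "(\<integral>\<^sup>+x. ennreal (g x) * indicator N x \<partial>\<mu>) \<le> (\<integral>\<^sup>+x. ennreal (h x) * indicator N x \<partial>\<mu>) + ennreal e"
proof -
  have nd: "0 \<le> real n * dist x y" for n and x y :: 'a by simp
  define g where "g n x = (SUP y\<in>N. h y - real n * dist x y)" for n x
  have bdd: "bdd_above ((\<lambda>y. h y - real n * dist x y) ` N)" for n x
  proof (rule bdd_aboveI2)
    fix y assume "y \<in> N"
    from h(2)[OF this] show "h y - real n * dist x y \<le> M"
      using nd[of n x y] by linarith
  qed
  have g_ge: "h x \<le> g n x" if "x \<in> N" for n x
    using cSUP_upper[OF that bdd[of n x]] by (simp add: g_def)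
  have g_le: "g n x \<le> M" if x: "x \<in> N" for n x
    unfolding g_def
  proof (rule cSUP_least)
    fix y assume "y \<in> N"
    from h(2)[OF this] show "h y - real n * dist x y \<le> M"
      using nd[of n x y] by linarith
  qed (use x in auto)
  have g_lip: "g n x \<le> g n x' + real n * dist x x'" if x: "x \<in> N" for n x x'
    unfolding g_def[of n x]
  proof (rule cSUP_least)
    fix y assume y: "y \<in> N"
    have "real n * dist x' y \<le> real n * (dist x x' + dist x y)"
      using dist_triangle[of x' y x] by (intro mult_left_mono) (simp_all add: dist_commute)
    then have "h y - real n * dist x y \<le> (h y - real n * dist x' y) + real n * dist x x'"
      by (simp add: algebra_simps)
    also have "h y - real n * dist x' y \<le> g n x'"
      unfolding g_def by (rule cSUP_upper[OF y bdd])
    finally show "h y - real n * dist x y \<le> g n x' + real n * dist x x'" by simp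
  qed (use x in auto)
  have g_cont: "continuous_on N (g n)" for n
  proof (rule lipschitz_on_continuous_on[of "real n"], rule lipschitz_onI)
    fix x y assume "x \<in> N" "y \<in> N"
    then show "dist (g n x) (g n y) \<le> real n * dist x y"
      using g_lip[of x n y] g_lip[of y n x] by (simp add: dist_real_def abs_le_iff dist_commute)
  qed simp
  have g_dec: "g n x \<le> g m x" if "m \<le> n" "x \<in> N" for m n x
    unfolding g_def[of n x]
  proof (rule cSUP_least)
    fix y assume y: "y \<in> N"
    have "real m * dist x y \<le> real n * dist x y" using that(1) by (intro mult_right_mono) simp_all
    moreover have "h y - real m * dist x y \<le> g m x" unfolding g_def by (rule cSUP_upper[OF y bdd])
    ultimately show "h y - real n * dist x y \<le> g m x" by simp
  qed (use that in auto)
  have g_lim: "\<exists>n. g n x \<le> h x + d" if x: "x \<in> N" and d: "0 < d" for x d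
  proof -
    obtain r where r: "0 < r" "\<forall>y\<in>N. dist x y < r \<longrightarrow> h y < h x + d"
      using usc[OF x, of "h x + d"] d by auto
    obtain n where n: "M / r \<le> real n" using real_arch_simple by blast
    have "g n x \<le> h x + d"
      unfolding g_def
    proof (rule cSUP_least)
      fix y assume y: "y \<in> N"
      show "h y - real n * dist x y \<le> h x + d"
      proof (cases "dist x y < r")
        case True
        then have "h y < h x + d" using r y by blast
        then show ?thesis using nd[of n x y] by linarith
      next
        case False
        have "M \<le> real n * r" using n r(1) by (simp add: divide_le_eq)
        also have "\<dots> \<le> real n * dist x y" using False by (intro mult_left_mono) simp_all
        finally show ?thesis using h(2)[OF y] h(1)[OF x] d by simp
      qed
    qed (use x in auto)
    then show ?thesis by blast
  qed
  define f where "f n x = ennreal (g n x) * indicator N x" for n x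
  have N_sets: "N \<in> sets \<mu>" using N(1) \<mu> by simp
  have f_meas: "f n \<in> borel_measurable \<mu>" for n
  proof -
    have "(\<lambda>x. indicator N x *\<^sub>R g n x) \<in> borel_measurable borel"
      using N(1) g_cont by (intro borel_measurable_continuous_on_indicator) simp_all
    then have "(\<lambda>x. ennreal (indicator N x *\<^sub>R g n x)) \<in> borel_measurable borel" by measurable
    moreover have "ennreal (indicator N x *\<^sub>R g n x) = f n x" for x
      by (simp add: f_def indicator_def)
    ultimately show ?thesis unfolding measurable_cong_sets[OF \<mu> refl] by simp
  qed
  have f_dec: "decseq f"
  proof (rule decseq_SucI, rule le_funI)
    show "f (Suc n) x \<le> f n x" for n x
      unfolding f_def using g_dec[of n "Suc n" x]
      by (cases "x \<in> N") (simp_all add: ennreal_leI)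
  qed
  have f_fin: "(\<integral>\<^sup>+x. f n x \<partial>\<mu>) < \<infinity>" for n
  proof -
    have "(\<integral>\<^sup>+x. f n x \<partial>\<mu>) \<le> (\<integral>\<^sup>+x. ennreal M * indicator N x \<partial>\<mu>)"
    proof (rule nn_integral_mono)
      show "f n x \<le> ennreal M * indicator N x" for x
        unfolding f_def using g_le[of x n] by (cases "x \<in> N") (simp_all add: ennreal_leI)
    qed
    also have "\<dots> < \<infinity>" using N(2) N_sets by (simp add: nn_integral_cmult_indicator ennreal_mult_less_top)
    finally show ?thesis .
  qed
  have f_inf: "(INF n. f n x) = ennreal (h x) * indicator N x" for x
  proof (cases "x \<in> N")
    case True
    show ?thesis
    proof (rule antisym)
      show "(INF n. f n x) \<le> ennreal (h x) * indicator N x"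
      proof (rule ennreal_le_epsilon)
        fix d :: real assume "0 < d"
        then obtain n where n: "g n x \<le> h x + d" using g_lim[OF True] by blast
        have "(INF n. f n x) \<le> f n x" by (rule INF_lower) simp
        also have "\<dots> \<le> ennreal (h x + d)" using True n by (simp add: f_def ennreal_leI)
        also have "\<dots> = ennreal (h x) * indicator N x + ennreal d"
          using True h(1)[OF True] \<open>0 < d\<close> by simp
        finally show "(INF n. f n x) \<le> ennreal (h x) * indicator N x + ennreal d" .
      qed
      show "ennreal (h x) * indicator N x \<le> (INF n. f n x)"
        using g_ge[OF True] True by (intro INF_greatest) (simp add: f_def ennreal_leI)
    qed
  qed (simp add: f_def)
  have "(\<integral>\<^sup>+x. ennreal (h x) * indicator N x \<partial>\<mu>) = (INF n. \<integral>\<^sup>+x. f n x \<partial>\<mu>)"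
    unfolding f_inf[symmetric]
    by (rule nn_integral_monotone_convergence_INF_decseq[OF f_dec f_meas f_fin])
  moreover have "(INF n. \<integral>\<^sup>+x. f n x \<partial>\<mu>) \<le> (\<integral>\<^sup>+x. f 0 x \<partial>\<mu>)" by (rule INF_lower) simp
  ultimately have eq: "(\<integral>\<^sup>+x. ennreal (h x) * indicator N x \<partial>\<mu>) = (INF n. \<integral>\<^sup>+x. f n x \<partial>\<mu>)"
    and "(\<integral>\<^sup>+x. ennreal (h x) * indicator N x \<partial>\<mu>) < top" using f_fin[of 0] by simp_all
  then obtain a where "0 \<le> a" "(\<integral>\<^sup>+x. ennreal (h x) * indicator N x \<partial>\<mu>) = ennreal a"
    by (cases "(\<integral>\<^sup>+x. ennreal (h x) * indicator N x \<partial>\<mu>)" rule: ennreal_cases) simp_all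
  then have "(\<integral>\<^sup>+x. ennreal (h x) * indicator N x \<partial>\<mu>) < (\<integral>\<^sup>+x. ennreal (h x) * indicator N x \<partial>\<mu>) + ennreal e"
    using e by (simp add: ennreal_plus[symmetric] ennreal_less_iff del: ennreal_plus)
  then have "(INF n. \<integral>\<^sup>+x. f n x \<partial>\<mu>) < (\<integral>\<^sup>+x. ennreal (h x) * indicator N x \<partial>\<mu>) + ennreal e"
    by (simp only: eq)
  then obtain n where "(\<integral>\<^sup>+x. f n x \<partial>\<mu>) < (\<integral>\<^sup>+x. ennreal (h x) * indicator N x \<partial>\<mu>) + ennreal e"
    by (auto simp: INF_less_iff)
  then show thesis
    using g_cont[of n] g_ge by (intro that[of "g n"]) (simp_all add: f_def less_imp_le)
qed

lemma lipschitz_bump: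
  fixes x :: "'a::metric_space"
  assumes "0 < R"
  obtains \<psi> where "(3 / R)-lipschitz_on UNIV \<psi>" "\<And>y. 0 \<le> \<psi> y" "\<And>y. \<psi> y \<le> (1::real)"
    "\<And>y. dist x y < R / 3 \<Longrightarrow> \<psi> y = 1" "\<And>y. 2 * R / 3 \<le> dist x y \<Longrightarrow> \<psi> y = 0"
proof
  let ?\<psi> = "\<lambda>y. max 0 (min 1 (2 - 3 / R * dist x y))"
  show "(3 / R)-lipschitz_on UNIV ?\<psi>"
  proof (rule lipschitz_onI)
    fix y z
    have "\<bar>?\<psi> y - ?\<psi> z\<bar> \<le> \<bar>3 / R * dist x z - 3 / R * dist x y\<bar>" by auto
    also have "\<dots> = 3 / R * \<bar>dist x z - dist x y\<bar>"
      unfolding right_diff_distrib[symmetric] abs_mult using assms by simp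
    also have "\<dots> \<le> 3 / R * dist y z"
      using assms abs_dist_diff_le[of z x y] by (intro mult_left_mono) (simp_all add: dist_commute)
    finally show "dist (?\<psi> y) (?\<psi> z) \<le> 3 / R * dist y z" by (simp only: dist_real_def)
  qed (use assms in simp)
  show "?\<psi> y = 1" if "dist x y < R / 3" for y
  proof -
    have "3 / R * dist x y \<le> 3 / R * (R / 3)" using that assms by (intro mult_left_mono) simp_all
    then show ?thesis using assms by simp
  qed
  show "?\<psi> y = 0" if "2 * R / 3 \<le> dist x y" for y
  proof -
    have "3 / R * (2 * R / 3) \<le> 3 / R * dist x y" using that assms by (intro mult_left_mono) simp_all
    then show ?thesis using assms by simp
  qed
qed simp_all

text \<open>
  With bumps \<open>\<psi>\<^sub>i\<close>, the products \<open>\<phi>\<^sub>i = \<psi>\<^sub>i \<Prod>\<^bsub>j < i\<^esub> (1 - \<psi>\<^sub>j)\<close> telescope to the sum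
  \<open>1 - \<Prod>\<^sub>i (1 - \<psi>\<^sub>i)\<close>, which is \<open>1\<close> as soon as one bump is \<open>1\<close>. This avoids dividing by a sum of
  bumps.
\<close>

lemma lipschitz_partition:
  fixes x :: "nat \<Rightarrow> 'a::metric_space" and R :: "nat \<Rightarrow> real"
  assumes R: "\<And>i. 0 < R i"
  obtains \<phi> :: "nat \<Rightarrow> 'a \<Rightarrow> real" and L where
    "\<And>i. (L i)-lipschitz_on UNIV (\<phi> i)" "\<And>i y. 0 \<le> \<phi> i y" "\<And>i y. \<phi> i y \<le> 1"
    "\<And>i y. 2 * R i / 3 \<le> dist (x i) y \<Longrightarrow> \<phi> i y = 0"
    "\<And>m y. (\<Sum>i<m. \<phi> i y) \<le> 1"
    "\<And>m y i. i < m \<Longrightarrow> dist (x i) y < R i / 3 \<Longrightarrow> (\<Sum>i<m. \<phi> i y) = 1"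
proof -
  have "\<exists>\<psi>. (3 / R i)-lipschitz_on UNIV \<psi> \<and> (\<forall>y. 0 \<le> \<psi> y) \<and> (\<forall>y. \<psi> y \<le> (1::real)) \<and>
    (\<forall>y. dist (x i) y < R i / 3 \<longrightarrow> \<psi> y = 1) \<and> (\<forall>y. 2 * R i / 3 \<le> dist (x i) y \<longrightarrow> \<psi> y = 0)" for i
    by (rule lipschitz_bump[OF R[of i], of "x i"]) blast
  then obtain \<psi> where \<psi>: "\<And>i. (3 / R i)-lipschitz_on UNIV (\<psi> i)" "\<And>i y. 0 \<le> \<psi> i y" "\<And>i y. \<psi> i y \<le> (1::real)"
    "\<And>i y. dist (x i) y < R i / 3 \<Longrightarrow> \<psi> i y = 1" "\<And>i y. 2 * R i / 3 \<le> dist (x i) y \<Longrightarrow> \<psi> i y = 0"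
    by metis
  define D where "D m y = (\<Prod>j<m. 1 - \<psi> j y)" for m y
  have D01: "0 \<le> D m y" "D m y \<le> 1" for m y
    unfolding D_def using \<psi>(2,3) by (auto intro!: prod_nonneg prod_le_1)
  have "\<exists>L. L-lipschitz_on UNIV (D m)" for m
  proof (induction m)
    case 0
    show ?case by (rule exI[of _ 0]) (simp add: D_def lipschitz_on_def)
  next
    case (Suc m)
    then obtain L where L: "L-lipschitz_on UNIV (D m)" by blast
    have 1: "(0 + 3 / R m)-lipschitz_on UNIV (\<lambda>y. 1 - \<psi> m y)"
      by (intro lipschitz_on_diff \<psi>(1)) (simp add: lipschitz_on_def)
    have "(L * 1 + 1 * (0 + 3 / R m))-lipschitz_on UNIV (\<lambda>y. D m y * (1 - \<psi> m y))"
      by (intro lipschitz_on_times L 1) (use D01 \<psi>(2,3) in \<open>simp_all add: abs_le_iff\<close>)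
    then show ?case by (intro exI) (simp add: D_def cong: lipschitz_on_cong)
  qed
  then obtain LD where LD: "\<And>m. (LD m)-lipschitz_on UNIV (D m)" by metis
  define \<phi> where "\<phi> i y = \<psi> i y * D i y" for i y
  have sum: "(\<Sum>i<m. \<phi> i y) = 1 - D m y" for m y
    by (induction m) (simp_all add: \<phi>_def D_def algebra_simps)
  show thesis
  proof (rule that[of "\<lambda>i. 3 / R i * 1 + 1 * LD i" \<phi>])
    show "(3 / R i * 1 + 1 * LD i)-lipschitz_on UNIV (\<phi> i)" for i
      unfolding \<phi>_def
      by (intro lipschitz_on_times \<psi>(1) LD) (use D01 \<psi>(2,3) in \<open>simp_all add: abs_le_iff\<close>)
    show "0 \<le> \<phi> i y" for i y unfolding \<phi>_def using \<psi>(2) D01 by simp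
    show "\<phi> i y \<le> 1" for i y unfolding \<phi>_def using \<psi>(2,3) D01 by (simp add: mult_le_one)
    show "\<phi> i y = 0" if "2 * R i / 3 \<le> dist (x i) y" for i y
      unfolding \<phi>_def using \<psi>(5)[OF that] by simp
    show "(\<Sum>i<m. \<phi> i y) \<le> 1" for m y unfolding sum using D01 by simp
    show "(\<Sum>i<m. \<phi> i y) = 1" if "i < m" "dist (x i) y < R i / 3" for m y i
    proof -
      have "D m y = 0" unfolding D_def using \<psi>(4)[OF that(2)] that(1) by (intro prod_zero bexI[of _ i]) simp_all
      then show ?thesis unfolding sum by simp
    qed
  qed
qed

section \<open>An upper semicontinuous pointwise norm\<close>

text \<open>
  The constant \<open>c\<close> bounds the norm of some series that represents \<open>\<omega>\<close> on the whole ball. The condition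
  passes to smaller balls, including those with other centres.
\<close>

definition local_bound :: "nat \<Rightarrow> ('a::metric_space \<Rightarrow> 'a germ) \<Rightarrow> 'a \<Rightarrow> real \<Rightarrow> ennreal \<Rightarrow> bool" where
  "local_bound k \<omega> x r c \<longleftrightarrow> (\<exists>U s. open U \<and> ball x r \<subseteq> U \<and> summable_series k U s \<and>
     (\<forall>y\<in>ball x r. \<omega> y = germ k y U (bseries k U s)) \<and>
     (\<forall>y\<in>ball x r. series_norm (ball x r) s y \<le> c))"

text \<open>
  All local representations of \<open>\<omega>\<close> compete here, so no choice of a representative is involved.
\<close>

definition relaxed_norm :: "nat \<Rightarrow> ('a::metric_space \<Rightarrow> 'a germ) \<Rightarrow> 'a \<Rightarrow> ennreal" where
  "relaxed_norm k \<omega> x = Inf {c. \<exists>r>0. local_bound k \<omega> x r c}"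

lemma prod_Lip_mono:
  assumes "t \<in> ptuples k U" "B' \<subseteq> B" "B \<subseteq> U"
  shows "0 \<le> prod_list (map (Lip B') (snd t))"
    "prod_list (map (Lip B') (snd t)) \<le> prod_list (map (Lip B) (snd t))"
proof -
  have l: "(Lip U g)-lipschitz_on B g" if "g \<in> set (snd t)" for g
    using lipschitz_on_subset[OF LIP_infD(2)[OF tuplesD(2)[OF assms(1) that]] assms(3)] .
  have "0 \<le> Lip B' g \<and> Lip B' g \<le> Lip B g" if "g \<in> set (snd t)" for g
    using Lip_nonneg[OF lipschitz_on_subset[OF l[OF that] assms(2)]] Lip_mono[OF l[OF that] assms(2)] by simp
  then show "0 \<le> prod_list (map (Lip B') (snd t))"
    "prod_list (map (Lip B') (snd t)) \<le> prod_list (map (Lip B) (snd t))"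
    by (auto intro!: prod_list_nonneg prod_list_map_mono)
qed

lemma series_seminorm_mono:
  assumes s: "summable_series k U s" and B: "B' \<subseteq> B" "B \<subseteq> U"
  shows "series_norm B' s y \<le>
    series_norm B s y"
proof (intro suminf_le ennreal_leI mult_left_mono)
  show "prod_list (map (Lip B') (snd (s j))) \<le> prod_list (map (Lip B) (snd (s j)))" for j
    using s unfolding summable_series_def by (intro prod_Lip_mono(2)[OF _ B]) blast
qed auto

lemma local_bound_shrink:
  assumes "local_bound k \<omega> x r c" "ball y r' \<subseteq> ball x r"
  shows "local_bound k \<omega> y r' c"
proof -
  obtain U s where U: "open U" "ball x r \<subseteq> U" "summable_series k U s"
    "\<And>y. y \<in> ball x r \<Longrightarrow> \<omega> y = germ k y U (bseries k U s)"
    "\<And>y. y \<in> ball x r \<Longrightarrow> series_norm (ball x r) s y \<le> c"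
    using assms(1) unfolding local_bound_def by blast
  show ?thesis
    unfolding local_bound_def
  proof (intro exI[of _ U] exI[of _ s] conjI ballI)
    fix z assume "z \<in> ball y r'"
    then have z: "z \<in> ball x r" using assms(2) by blast
    then show "\<omega> z = germ k z U (bseries k U s)" by (rule U(4))
    show "series_norm (ball y r') s z \<le> c"
      by (rule order_trans[OF series_seminorm_mono[OF U(3) assms(2) U(2)] U(5)[OF z]])
  qed (use U assms(2) in blast)+
qed

lemma local_bound_usc:
  assumes "local_bound k \<omega> x r c" "0 < r" "dist x y < r / 2"
  shows "local_bound k \<omega> y (r / 2) c"
proof (rule local_bound_shrink[OF assms(1)])
  show "ball y (r / 2) \<subseteq> ball x r"
  proof
    fix z assume "z \<in> ball y (r / 2)"
    then show "z \<in> ball x r" using assms(3) dist_triangle[of x z y] by simp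
  qed
qed

lemma bPoly_series:
  assumes "b \<in> bPoly k U"
  obtains s where "summable_series k U s" "bseries k U s = b"
proof -
  obtain s where "\<forall>j. s j \<in> ptuples k U" "summable (\<lambda>j. pcross U (s j))"
    "b = bcls k U (\<lambda>n. \<Sum>j<n. pure (quot U (s j)))"
    using Q.ctensor_series_lift[of b k U] assms unfolding bPoly_def by blast
  then show thesis using that[of s] unfolding summable_series_def bseries_def by blast
qed

lemma local_bound_of_germ:
  assumes \<omega>: "\<omega> \<in> bGamma k" "\<omega> x = germ k x U (bseries k U s)"
    and U: "open U" "x \<in> U" "summable_series k U s"
  obtains d where "0 < d" "\<And>r. r \<le> d \<Longrightarrow> ball x r \<subseteq> U"
    "\<And>r. r \<le> d \<Longrightarrow> local_bound k \<omega> x r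
       (SUP y\<in>ball x r. series_norm (ball x r) s y)"
proof -
  obtain W where W: "open W" "x \<in> W" "W \<subseteq> U" "\<And>y. y \<in> W \<Longrightarrow> \<omega> y = germ k y U (bseries k U s)"
    by (rule section_locally[OF \<omega> U(1,2) bseries_bPoly[OF U(3)]]) blast
  obtain d where d: "0 < d" "ball x d \<subseteq> W" by (rule openE[OF W(1,2)])
  have sub: "ball x r \<subseteq> W" if "r \<le> d" for r using subset_ball[OF that] d(2) by blast
  show thesis
  proof (rule that[OF d(1)])
    fix r assume r: "r \<le> d"
    show "ball x r \<subseteq> U" using sub[OF r] W(3) by blast
    show "local_bound k \<omega> x r
       (SUP y\<in>ball x r. series_norm (ball x r) s y)"
      unfolding local_bound_def
    proof (intro exI[of _ U] exI[of _ s] conjI ballI)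
      show "ball x r \<subseteq> U" using sub[OF r] W(3) by blast
      show "\<omega> y = germ k y U (bseries k U s)" if "y \<in> ball x r" for y
        using W(4) sub[OF r] that by blast
    qed (use U in \<open>auto intro: SUP_upper\<close>)
  qed
qed

text \<open>
  A local series exists, and its norm is at most the sum of the products of the full norms.
\<close>

lemma relaxed_norm_finite:
  assumes \<omega>: "\<omega> \<in> bGamma k"
  shows "relaxed_norm k \<omega> x < top"
proof -
  obtain U b where U: "open U" "x \<in> U" "b \<in> bPoly k U" "\<omega> x = germ k x U b"
    using \<omega> unfolding bGamma_def stalk_def by blast
  obtain s where s: "summable_series k U s" "bseries k U s = b" using bPoly_series[OF U(3)] .
  obtain d where d: "0 < d" "\<And>r. r \<le> d \<Longrightarrow> ball x r \<subseteq> U"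
    "\<And>r. r \<le> d \<Longrightarrow> local_bound k \<omega> x r
       (SUP y\<in>ball x r. series_norm (ball x r) s y)"
    by (rule local_bound_of_germ[OF \<omega> _ U(1,2) s(1)]) (use U(4) s(2) in blast)+
  have st: "s j \<in> ptuples k U" for j using s(1) unfolding summable_series_def by blast
  have "series_norm (ball x d) s y \<le>
      suminf (\<lambda>j. ennreal (pcross U (s j)))" if y: "y \<in> ball x d" for y
  proof (intro suminf_le ennreal_leI)
    fix j
    have "Lip U g \<le> Lnorm U g \<and> 0 \<le> Lip U g" if "g \<in> set (snd (s j))" for g
      using LIP_infD(3,4)[OF tuplesD(2)[OF st that]] by simp
    then have "prod_list (map (Lip U) (snd (s j))) \<le> prod_list (map (Lnorm U) (snd (s j)))"
      by (intro prod_list_map_mono) simp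
    then have "prod_list (map (Lip (ball x d)) (snd (s j))) \<le> prod_list (map (Lnorm U) (snd (s j)))"
      by (rule order_trans[OF prod_Lip_mono(2)[OF st d(2)[OF order_refl] order_refl]])
    moreover have "\<bar>fst (s j) y\<bar> \<le> Lnorm U (fst (s j))"
      using LIP_infD(7)[OF tuplesD(1)[OF st]] d(2)[OF order_refl] y by blast
    ultimately show "\<bar>fst (s j) y\<bar> * prod_list (map (Lip (ball x d)) (snd (s j))) \<le> pcross U (s j)"
      unfolding cross_def LIP_inf_simps
      using prod_Lip_mono(1)[OF st d(2)[OF order_refl] order_refl] LIP_infD(5)[OF tuplesD(1)[OF st]]
      by (intro mult_mono)
  qed auto
  then have "(SUP y\<in>ball x d. series_norm (ball x d) s y)
      \<le> suminf (\<lambda>j. ennreal (pcross U (s j)))"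
    by (intro SUP_least)
  also have "\<dots> < top"
    using s(1) suminf_ennreal2[OF poly.cross_nonneg[OF st]] unfolding summable_series_def by simp
  finally show ?thesis
    unfolding relaxed_norm_def using d(1) d(3)[OF order_refl]
    by (intro le_less_trans[OF Inf_lower]) blast+
qed

text \<open>
  The pointwise norm is a limit of infima over the series that represent one chosen preimage under \<open>Qmap\<close>.
  Such a preimage exists by the lifting of series, and each of these series represents \<open>\<omega>\<close> near \<open>x\<close>, so it
  takes part in the infimum that defines \<open>relaxed_norm\<close>. The limit exists because \<open>Lip_k\<close> is
  monotone in the radius.
\<close>

lemma relaxed_norm_le_pointwise_norm:
  fixes \<omega> :: "'a::metric_space \<Rightarrow> 'a germ"
  assumes \<omega>: "\<omega> \<in> bGamma k"
  shows "relaxed_norm k \<omega> x \<le> pointwise_norm k \<omega> x"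
proof -
  let ?P = "\<lambda>(U, b). open U \<and> x \<in> U \<and> b \<in> bPoly k U \<and> germ k x U b = \<omega> x"
  obtain U b where Ub: "(SOME p. ?P p) = (U, b)" by (cases "SOME p. ?P p")
  obtain U' b' where "open U'" "x \<in> U'" "b' \<in> bPoly k U'" "\<omega> x = germ k x U' b'"
    using \<omega> unfolding bGamma_def stalk_def by blast
  then have "?P (U', b')" by simp
  from someI[of ?P, OF this] have U: "open U" "x \<in> U" "b \<in> bPoly k U" "\<omega> x = germ k x U b"
    unfolding Ub by simp_all
  let ?f = "\<lambda>r. Lip_k k U b (ball x r)"
  have norm_eq: "pointwise_norm k \<omega> x = Lim (at_right 0) ?f"
    unfolding pointwise_norm_def Ub Let_def prod.case ..
  define p where "p = (SOME p. p \<in> Poly k U \<and> Qmap k U p = b)"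
  obtain s0 where s0: "summable_series k U s0" "bseries k U s0 = b" using bPoly_series[OF U(3)] .
  have "pcls k U (\<lambda>n. \<Sum>j<n. pure (s0 j)) \<in> Poly k U"
    using s0(1) unfolding Poly_def summable_series_def
    by (intro poly.cls_in_ctensor poly.cauchy_partial_sums) simp_all
  then have "pcls k U (\<lambda>n. \<Sum>j<n. pure (s0 j)) \<in> Poly k U \<and> Qmap k U (pcls k U (\<lambda>n. \<Sum>j<n. pure (s0 j))) = b"
    using bseries_eq_Qmap(1)[OF s0(1)] s0(2) by simp
  from someI[of "\<lambda>p. p \<in> Poly k U \<and> Qmap k U p = b", OF this, folded p_def]
  have p: "p \<in> Poly k U" "Qmap k U p = b" by simp_all
  have Rep: "summable_series k U s \<and> bseries k U s = b" if s: "s \<in> Rep k U p" for s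
  proof -
    have ss: "summable_series k U s" and m: "(\<lambda>n. \<Sum>j<n. pure (s j)) \<in> p"
      using s unfolding Rep_def ct_series_def summable_series_def by simp_all
    obtain v where v: "v \<in> pcauchy k U" "p = pcls k U v"
      using poly.ctensorE p(1) unfolding Poly_def by blast
    have "pcls k U v = pcls k U (\<lambda>n. \<Sum>j<n. pure (s j))"
      using m v poly.mem_cls_iff[of "\<lambda>n. \<Sum>j<n. pure (s j)" k U v] by (intro poly.cls_eqI) simp_all
    then show ?thesis using bseries_eq_Qmap(1)[OF ss] ss p(2) v(2) by simp
  qed
  obtain W where W: "open W" "x \<in> W" "W \<subseteq> U" "\<And>y. y \<in> W \<Longrightarrow> \<omega> y = germ k y U b"
    by (rule section_locally[OF \<omega> U(4,1,2,3)]) blast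
  obtain d where d: "0 < d" "ball x d \<subseteq> W" by (rule openE[OF W(1,2)])
  have sub: "ball x r \<subseteq> W" if "r \<le> d" for r using subset_ball[OF that] d(2) by blast
  have f_ge: "relaxed_norm k \<omega> x \<le> ?f r" if r: "0 < r" "r \<le> d" for r
    unfolding Lip_k_def p_def[symmetric]
  proof (rule INF_greatest)
    fix s assume s: "s \<in> Rep k U p"
    let ?c = "SUP y\<in>ball x r. series_norm (ball x r) s y"
    have "local_bound k \<omega> x r ?c"
      unfolding local_bound_def
    proof (intro exI[of _ U] exI[of _ s] conjI ballI)
      show "ball x r \<subseteq> U" using sub[OF r(2)] W(3) by blast
      show "\<omega> y = germ k y U (bseries k U s)" if "y \<in> ball x r" for y
        using W(4) sub[OF r(2)] Rep[OF s] that by blast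
    qed (use U Rep[OF s] in \<open>auto intro: SUP_upper\<close>)
    then show "relaxed_norm k \<omega> x \<le> ?c"
      unfolding relaxed_norm_def using r(1) by (intro Inf_lower) blast
  qed
  have f_mono: "?f r \<le> ?f r'" if "r \<le> r'" "r' \<le> d" for r r'
    unfolding Lip_k_def p_def[symmetric]
  proof (rule INF_mono)
    fix s assume s: "s \<in> Rep k U p"
    have B: "ball x r \<subseteq> ball x r'" "ball x r' \<subseteq> U"
      using subset_ball[OF that(1)] sub[OF that(2)] W(3) by blast+
    have "(SUP y\<in>ball x r. series_norm (ball x r) s y) \<le>
        (SUP y\<in>ball x r'. series_norm (ball x r') s y)"
      using series_seminorm_mono[OF conjunct1[OF Rep[OF s]] B] B(1) by (intro SUP_mono) blast
    with s show "\<exists>s'\<in>Rep k U p. (SUP y\<in>ball x r. series_norm (ball x r) s' y) \<le>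
        (SUP y\<in>ball x r'. series_norm (ball x r') s y)"
      by blast
  qed
  define l where "l = (INF r\<in>{0<..d}. ?f r)"
  have "(?f \<longlongrightarrow> l) (at_right 0)"
  proof (rule order_tendstoI)
    fix a assume a: "a < l"
    have "a < ?f r" if "r \<in> {0<..d}" for r
      using a INF_lower[OF that, of ?f] unfolding l_def by (rule less_le_trans)
    then show "\<forall>\<^sub>F r in at_right 0. a < ?f r"
      using d(1) by (intro eventually_at_rightI[of 0 d]) auto
  next
    fix a assume "l < a"
    then obtain r0 where r0: "0 < r0" "r0 \<le> d" "?f r0 < a" unfolding l_def by (auto simp: INF_less_iff)
    have "?f r < a" if "r \<in> {0<..<r0}" for r
      using f_mono[of r r0] r0 that by (auto intro: le_less_trans)
    then show "\<forall>\<^sub>F r in at_right 0. ?f r < a"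
      using r0(1) by (intro eventually_at_rightI[of 0 r0]) auto
  qed
  then have "Lim (at_right 0) ?f = l" by (intro tendsto_Lim) simp_all
  moreover have "relaxed_norm k \<omega> x \<le> l" unfolding l_def using f_ge by (intro INF_greatest) simp
  ultimately show ?thesis unfolding norm_eq by simp
qed

section \<open>The mass estimate\<close>

lemma compact_precompact_nbhd:
  fixes K :: "'a::metric_space set"
  assumes lc: "locally compact (UNIV :: 'a set)" and K: "compact K"
  obtains N where "open N" "K \<subseteq> N" "compact (closure N)"
proof -
  have "\<exists>U. open U \<and> x \<in> U \<and> compact (closure U)" for x :: 'a
    by (rule locally_compact_UNIV_nbhd[OF lc, of x]) blast
  then obtain U where U: "\<And>x. open (U x)" "\<And>x :: 'a. x \<in> U x" "\<And>x. compact (closure (U x))" by metis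
  have "K \<subseteq> (\<Union>x\<in>K. U x)" using U(2) by blast
  then obtain F where F: "F \<subseteq> K" "finite F" "K \<subseteq> (\<Union>x\<in>F. U x)"
    using compactE_image[OF K, of K U] U(1) by blast
  have c: "compact (\<Union>x\<in>F. closure (U x))" using F(2) U(3) by (intro compact_UN)
  have "(\<Union>x\<in>F. U x) \<subseteq> (\<Union>x\<in>F. closure (U x))" by (intro UN_mono closure_subset order_refl)
  then have "compact (closure (\<Union>x\<in>F. U x))"
    by (intro compact_closure_subset[OF c] closure_minimal compact_imp_closed[OF c])
  moreover have "open (\<Union>x\<in>F. U x)" using U(1) by blast
  ultimately show thesis using that F(3) by blast
qed

text \<open>
  An admissible constant at \<open>x\<close> for radius \<open>r\<close> is admissible for radius \<open>r / 2\<close> at all points within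
  distance \<open>r / 2\<close>.
\<close>

lemma relaxed_norm_usc:
  assumes "relaxed_norm k \<omega> x < a"
  obtains d where "0 < d" "\<And>y. dist x y < d \<Longrightarrow> relaxed_norm k \<omega> y < a"
proof -
  obtain c r where c: "0 < r" "local_bound k \<omega> x r c" "c < a"
    using assms unfolding relaxed_norm_def Inf_less_iff by blast
  have "relaxed_norm k \<omega> y < a" if "dist x y < r / 2" for y
  proof -
    have "local_bound k \<omega> y (r / 2) c" by (rule local_bound_usc[OF c(2,1) that])
    then have "relaxed_norm k \<omega> y \<le> c"
      unfolding relaxed_norm_def using c(1) by (intro Inf_lower CollectI exI[of _ "r / 2"]) simp
    then show ?thesis using c(3) by (rule le_less_trans)
  qed
  then show thesis using that[of "r / 2"] c(1) by simp
qed

lemma relaxed_norm_bounded: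
  fixes \<omega> :: "'a::metric_space \<Rightarrow> 'a germ"
  assumes \<omega>: "\<omega> \<in> bGamma k" and K: "compact K"
  obtains M where "\<And>x. x \<in> K \<Longrightarrow> enn2real (relaxed_norm k \<omega> x) \<le> M"
proof -
  let ?h = "\<lambda>x. enn2real (relaxed_norm k \<omega> x)"
  have "\<exists>d>0. \<forall>y. dist x y < d \<longrightarrow> ?h y \<le> ?h x + 1" for x
  proof -
    have "relaxed_norm k \<omega> x = ennreal (?h x)" using relaxed_norm_finite[OF \<omega>, of x] by simp
    then have "relaxed_norm k \<omega> x < ennreal (?h x + 1)" by (metis ennreal_less_iff enn2real_nonneg less_add_one)
    then obtain d where d: "0 < d" "\<And>y. dist x y < d \<Longrightarrow> relaxed_norm k \<omega> y < ennreal (?h x + 1)"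
      by (rule relaxed_norm_usc) blast
    have "?h y \<le> ?h x + 1" if "dist x y < d" for y
      by (rule enn2real_leI[OF _ less_imp_le[OF d(2)[OF that]]]) simp
    with d(1) show ?thesis by blast
  qed
  then obtain d where d: "\<And>x. 0 < d x" "\<And>x y. dist x y < d x \<Longrightarrow> ?h y \<le> ?h x + 1" by metis
  have "K \<subseteq> (\<Union>x\<in>K. ball x (d x))" using d(1) by force
  then obtain F where F: "F \<subseteq> K" "finite F" "K \<subseteq> (\<Union>x\<in>F. ball x (d x))"
    using compactE_image[OF K, of K "\<lambda>x. ball x (d x)"] open_ball by blast
  have "?h y \<le> Max (insert 0 (?h ` F)) + 1" if y: "y \<in> K" for y
  proof -
    obtain x where x: "x \<in> F" "dist x y < d x" using F(3) y by auto
    have "?h x \<le> Max (insert 0 (?h ` F))" using F(2) x(1) by (intro Max_ge) auto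
    with d(2)[OF x(2)] show ?thesis by simp
  qed
  then show thesis by (rule that)
qed

text \<open>
  Around each point \<open>x\<close> of the support there is a ball with an admissible constant below \<open>g x + e\<close>, on
  which \<open>g\<close> varies by less than \<open>e\<close>. Finitely many of these balls suffice, and the partition of unity
  turns the constants into an integral of \<open>g + 2 e\<close>.
\<close>

lemma extension_bound_majorant:
  fixes \<omega> :: "'a::metric_space \<Rightarrow> 'a germ" and g :: "'a \<Rightarrow> real"
  assumes lc: "locally compact (UNIV :: 'a set)" and S: "is_extension k T S"
    and \<mu>: "sets \<mu> = sets borel" "mass_bound k T \<mu>"
    and \<omega>: "\<omega> \<in> bGamma_c k"
    and N: "open N" "spt_section k \<omega> \<subseteq> N" "compact (closure N)"
    and g: "continuous_on N g" "\<And>x. x \<in> N \<Longrightarrow> enn2real (relaxed_norm k \<omega> x) \<le> g x"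
    and e: "0 < e"
  shows "ennreal \<bar>S \<omega>\<bar> \<le> (\<integral>\<^sup>+x. ennreal (g x + 2 * e) * indicator N x \<partial>\<mu>)"
proof -
  let ?K = "spt_section k \<omega>"
  have K: "compact ?K" and \<omega>': "\<omega> \<in> bGamma k" using \<omega> unfolding bGamma_c_def by simp_all
  have "\<exists>r c. 0 < r \<and> local_bound k \<omega> x r c \<and> ball x r \<subseteq> N \<and> (\<forall>y\<in>ball x r. c \<le> ennreal (g y + 2 * e))"
    if x: "x \<in> ?K" for x
  proof -
    have xN: "x \<in> N" using N(2) x by blast
    let ?h = "enn2real (relaxed_norm k \<omega> x)"
    have "relaxed_norm k \<omega> x = ennreal ?h" using relaxed_norm_finite[OF \<omega>', of x] by simp
    then have "relaxed_norm k \<omega> x < ennreal (?h + e)" using e by (metis ennreal_less_iff enn2real_nonneg less_add_same_cancel1)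
    then obtain c r where c: "0 < r" "local_bound k \<omega> x r c" "c < ennreal (?h + e)"
      unfolding relaxed_norm_def Inf_less_iff by blast
    obtain d where d: "0 < d" "\<forall>y\<in>N. dist y x < d \<longrightarrow> dist (g y) (g x) < e"
      using g(1) xN e unfolding continuous_on_iff by blast
    obtain d' where d': "0 < d'" "ball x d' \<subseteq> N" by (rule openE[OF N(1) xN])
    define r' where "r' = min r (min d d')"
    have r': "0 < r'" "ball x r' \<subseteq> ball x r" "ball x r' \<subseteq> ball x d" "ball x r' \<subseteq> N"
      using c(1) d(1) d' subset_ball[of r' d' x] by (auto simp: r'_def)
    have "c \<le> ennreal (g y + 2 * e)" if y: "y \<in> ball x r'" for y
    proof -
      have "y \<in> N" "dist y x < d" using r'(3,4) y by (auto simp: dist_commute)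
      then have "dist (g y) (g x) < e" using d(2) by blast
      then have "?h + e \<le> g y + 2 * e" using g(2)[OF xN] by (simp add: dist_real_def abs_less_iff)
      then show ?thesis using c(3) by (meson ennreal_leI less_imp_le order_trans)
    qed
    then show ?thesis using r' local_bound_shrink[OF c(2) r'(2)] by blast
  qed
  then have "\<forall>x\<in>?K. \<exists>r. \<exists>c. 0 < r \<and> local_bound k \<omega> x r c \<and> ball x r \<subseteq> N \<and> (\<forall>y\<in>ball x r. c \<le> ennreal (g y + 2 * e))"
    by (rule ballI)
  from bchoice[OF this] obtain \<rho> where "\<forall>x\<in>?K. \<exists>c. 0 < \<rho> x \<and> local_bound k \<omega> x (\<rho> x) c \<and> ball x (\<rho> x) \<subseteq> N \<and>
      (\<forall>y\<in>ball x (\<rho> x). c \<le> ennreal (g y + 2 * e))" by (elim exE)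
  from bchoice[OF this] obtain \<gamma> where \<rho>\<gamma>: "\<forall>x\<in>?K. 0 < \<rho> x \<and> local_bound k \<omega> x (\<rho> x) (\<gamma> x) \<and> ball x (\<rho> x) \<subseteq> N \<and>
      (\<forall>y\<in>ball x (\<rho> x). \<gamma> x \<le> ennreal (g y + 2 * e))" by (elim exE)
  have "?K \<subseteq> (\<Union>x\<in>?K. ball x (\<rho> x / 3))" using \<rho>\<gamma> by fastforce
  then obtain F where F: "F \<subseteq> ?K" "finite F" "?K \<subseteq> (\<Union>x\<in>F. ball x (\<rho> x / 3))"
    using compactE_image[OF K, of ?K "\<lambda>x. ball x (\<rho> x / 3)"] open_ball by blast
  obtain xs where xs: "set xs = F" using finite_list[OF F(2)] by blast
  define m where "m = length xs"
  define X where "X i = xs ! i" for i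
  have XK: "X i \<in> ?K" if "i < m" for i using F(1) xs nth_mem that unfolding X_def m_def by blast
  \<comment> \<open>The value \<open>1\<close> for \<open>i \<ge> m\<close> is arbitrary; it keeps all radii positive.\<close>
  define R where "R i = (if i < m then \<rho> (X i) else 1)" for i
  have R: "0 < R i" for i using XK \<rho>\<gamma> unfolding R_def by simp
  have lb: "local_bound k \<omega> (X i) (R i) (\<gamma> (X i))" and BN: "ball (X i) (R i) \<subseteq> N"
    and \<gamma>: "\<And>y. y \<in> ball (X i) (R i) \<Longrightarrow> \<gamma> (X i) \<le> ennreal (g y + 2 * e)" if "i < m" for i
    using XK[OF that] \<rho>\<gamma> that unfolding R_def by simp_all
  obtain \<phi> :: "nat \<Rightarrow> 'a \<Rightarrow> real" and L where \<phi>: "\<And>i. (L i)-lipschitz_on UNIV (\<phi> i)" "\<And>i y. 0 \<le> \<phi> i y" "\<And>i y. \<phi> i y \<le> 1"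
    "\<And>i y. 2 * R i / 3 \<le> dist (X i) y \<Longrightarrow> \<phi> i y = 0" "\<And>m y. (\<Sum>i<m. \<phi> i y) \<le> 1"
    "\<And>m y i. i < m \<Longrightarrow> dist (X i) y < R i / 3 \<Longrightarrow> (\<Sum>i<m. \<phi> i y) = 1"
    by (rule lipschitz_partition[where R=R and x=X, OF R]) blast
  have "\<forall>i\<in>{..<m}. \<exists>U. \<exists>s. open U \<and> ball (X i) (R i) \<subseteq> U \<and> summable_series k U s \<and>
     (\<forall>y\<in>ball (X i) (R i). \<omega> y = germ k y U (bseries k U s)) \<and>
     (\<forall>y\<in>ball (X i) (R i). series_norm (ball (X i) (R i)) s y \<le> \<gamma> (X i))"
    using lb unfolding local_bound_def by blast
  from bchoice[OF this] obtain U where "\<forall>i\<in>{..<m}. \<exists>s. open (U i) \<and> ball (X i) (R i) \<subseteq> U i \<and> summable_series k (U i) s \<and>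
     (\<forall>y\<in>ball (X i) (R i). \<omega> y = germ k y (U i) (bseries k (U i) s)) \<and>
     (\<forall>y\<in>ball (X i) (R i). series_norm (ball (X i) (R i)) s y \<le> \<gamma> (X i))" by (elim exE)
  from bchoice[OF this] obtain s where Us: "\<forall>i\<in>{..<m}. open (U i) \<and> ball (X i) (R i) \<subseteq> U i \<and> summable_series k (U i) (s i) \<and>
     (\<forall>y\<in>ball (X i) (R i). \<omega> y = germ k y (U i) (bseries k (U i) (s i))) \<and>
     (\<forall>y\<in>ball (X i) (R i). series_norm (ball (X i) (R i)) (s i) y \<le> \<gamma> (X i))" by (elim exE)
  have spt_cball: "spt (\<phi> i) \<subseteq> cball (X i) (2 * R i / 3)" for i
    unfolding spt_def
  proof (rule closure_minimal[OF _ closed_cball], rule subsetI)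
    fix y assume "y \<in> {y. \<phi> i y \<noteq> 0}"
    then have "\<not> 2 * R i / 3 \<le> dist (X i) y" using \<phi>(4)[of i y] by blast
    then show "y \<in> cball (X i) (2 * R i / 3)" by simp
  qed
  have "cball (X i) (2 * R i / 3) \<subseteq> ball (X i) (R i)" for i using R[of i] by auto
  then have spt_ball: "spt (\<phi> i) \<subseteq> ball (X i) (R i)" for i using spt_cball[of i] by blast
  have spt_compact: "compact (spt (\<phi> i))" if i: "i < m" for i
  proof -
    have "spt (\<phi> i) \<subseteq> closure N" using spt_ball[of i] BN[OF i] closure_subset[of N] by blast
    then show ?thesis unfolding spt_def by (rule compact_closure_subset[OF N(3)])
  qed
  define N' where "N' = (\<Union>i<m. ball (X i) (R i / 3))"
  have N': "open N'" "?K \<subseteq> N'" "\<And>y. y \<in> N' \<Longrightarrow> (\<Sum>i<m. \<phi> i y) = 1"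
  proof -
    show "open N'" unfolding N'_def by (intro open_UN ballI open_ball)
    show "?K \<subseteq> N'"
    proof
      fix y assume "y \<in> ?K"
      then obtain x where x: "x \<in> F" "y \<in> ball x (\<rho> x / 3)" using F(3) by blast
      then obtain i where "i < m" "X i = x" using xs unfolding X_def m_def by (metis in_set_conv_nth)
      with x show "y \<in> N'" unfolding N'_def R_def by auto
    qed
    show "(\<Sum>i<m. \<phi> i y) = 1" if "y \<in> N'" for y
      using that \<phi>(6)[of _ m y] unfolding N'_def by auto
  qed
  define G where "G y = ennreal (g y + 2 * e) * indicator N y" for y
  have meas: "G \<in> borel_measurable \<mu>"
  proof -
    have "(\<lambda>x. indicator N x *\<^sub>R (g x + 2 * e)) \<in> borel_measurable borel"
      using N(1) g(1) by (intro borel_measurable_continuous_on_indicator continuous_intros) simp_all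
    then have "(\<lambda>x. ennreal (indicator N x *\<^sub>R (g x + 2 * e))) \<in> borel_measurable borel" by measurable
    moreover have "ennreal (indicator N x *\<^sub>R (g x + 2 * e)) = G x" for x
      by (cases "x \<in> N") (simp_all add: G_def)
    ultimately show ?thesis unfolding measurable_cong_sets[OF \<mu>(1) refl] by simp
  qed
  have \<phi>_meas: "(\<lambda>y. ennreal (\<phi> i y)) \<in> borel_measurable \<mu>" for i
  proof -
    have "\<phi> i \<in> borel_measurable borel"
      by (rule borel_measurable_continuous_onI[OF lipschitz_on_continuous_on[OF \<phi>(1)]])
    then show ?thesis unfolding measurable_cong_sets[OF \<mu>(1) refl] by measurable
  qed
  have "ennreal \<bar>S \<omega>\<bar> \<le> (\<Sum>i\<in>{..<m}. \<integral>\<^sup>+y. ennreal (\<phi> i y) * \<gamma> (X i) \<partial>\<mu>)"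
  proof (rule extension_partition_bound[OF lc S \<mu> \<omega>', where B="\<lambda>i. ball (X i) (R i)" and U=U and s=s and L=L and N=N'])
    fix i y assume i: "i \<in> {..<m}" and y: "y \<in> ball (X i) (R i)"
    show "\<omega> y = germ k y (U i) (bseries k (U i) (s i))"
      "series_norm (ball (X i) (R i)) (s i) y \<le> \<gamma> (X i)"
      using Us i y by blast+
  next
    fix i assume i: "i \<in> {..<m}"
    show "open (U i)" "ball (X i) (R i) \<subseteq> U i" "summable_series k (U i) (s i)" using Us i by blast+
    show "ball (X i) (R i) \<noteq> {}" using R[of i] by simp
    show "compact (spt (\<phi> i))" using spt_compact i by simp
  qed (use \<phi> spt_ball N' in simp_all)
  also have "\<dots> \<le> (\<Sum>i\<in>{..<m}. \<integral>\<^sup>+y. ennreal (\<phi> i y) * G y \<partial>\<mu>)"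
  proof (intro sum_mono nn_integral_mono)
    fix i y assume i: "i \<in> {..<m}"
    show "ennreal (\<phi> i y) * \<gamma> (X i) \<le> ennreal (\<phi> i y) * G y"
    proof (cases "y \<in> ball (X i) (R i)")
      case True
      then have "\<gamma> (X i) \<le> G y" using \<gamma>[of i y] BN[of i] i unfolding G_def by (simp add: subsetD)
      then show ?thesis by (rule mult_left_mono) simp
    next
      case False
      then have "\<phi> i y = 0" using spt_ball[of i] not_in_spt[of y "\<phi> i"] by blast
      then show ?thesis by simp
    qed
  qed
  also have "\<dots> = (\<integral>\<^sup>+y. (\<Sum>i\<in>{..<m}. ennreal (\<phi> i y) * G y) \<partial>\<mu>)"
    using \<phi>_meas meas by (intro nn_integral_sum[symmetric] borel_measurable_times_ennreal)
  also have "\<dots> \<le> (\<integral>\<^sup>+y. G y \<partial>\<mu>)"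
  proof (rule nn_integral_mono)
    fix y
    have "(\<Sum>i\<in>{..<m}. ennreal (\<phi> i y) * G y) = ennreal (\<Sum>i\<in>{..<m}. \<phi> i y) * G y"
      using \<phi>(2) by (simp add: sum_distrib_right[symmetric])
    also have "\<dots> \<le> 1 * G y" using \<phi>(5)[of y m] by (intro mult_right_mono) simp_all
    finally show "(\<Sum>i\<in>{..<m}. ennreal (\<phi> i y) * G y) \<le> G y" by simp
  qed
  finally show ?thesis unfolding G_def .
qed

theorem theorem1p3:
  fixes k :: nat
    and T :: "('a::metric_space \<Rightarrow> real) \<times> ('a \<Rightarrow> real) list \<Rightarrow> real"
    and T_hat :: "('a \<Rightarrow> 'a germ) \<Rightarrow> real"
    and T_mass :: "'a measure"
    and \<omega> :: "'a \<Rightarrow> 'a germ"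
  assumes "locally compact (UNIV :: 'a set)"
    and "T \<in> M_loc k"
    and "is_mass_measure k T T_mass"
    and "is_extension k T T_hat"
    and "\<omega> \<in> bGamma_c k"
  shows "ennreal \<bar>T_hat \<omega>\<bar> \<le> (\<integral>\<^sup>+x. pointwise_norm k \<omega> x \<partial>T_mass)"
proof -
  have \<mu>: "sets T_mass = sets borel" "mass_bound k T T_mass" "\<And>K. compact K \<Longrightarrow> emeasure T_mass K < \<infinity>"
    using assms(3) unfolding is_mass_measure_def radon_measure_def by simp_all
  have \<omega>: "\<omega> \<in> bGamma k" and K: "compact (spt_section k \<omega>)"
    using assms(5) unfolding bGamma_c_def by simp_all
  obtain N where N: "open N" "spt_section k \<omega> \<subseteq> N" "compact (closure N)"
    by (rule compact_precompact_nbhd[OF assms(1) K])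
  let ?h = "\<lambda>x. enn2real (relaxed_norm k \<omega> x)"
  have h: "relaxed_norm k \<omega> x = ennreal (?h x)" for x using relaxed_norm_finite[OF \<omega>, of x] by simp
  obtain M where "\<And>x. x \<in> closure N \<Longrightarrow> ?h x \<le> M" by (rule relaxed_norm_bounded[OF \<omega> N(3)]) blast
  then have M: "?h x \<le> M" if "x \<in> N" for x using closure_subset[of N] that by blast
  have usc: "\<exists>d>0. \<forall>y\<in>N. dist x y < d \<longrightarrow> ?h y < a" if a: "?h x < a" for x a
  proof -
    have "0 < a" using a enn2real_nonneg[of "relaxed_norm k \<omega> x"] by linarith
    have "relaxed_norm k \<omega> x < ennreal a" using a by (subst h) (simp add: ennreal_less_iff)
    then obtain d where d: "0 < d" "\<And>y. dist x y < d \<Longrightarrow> relaxed_norm k \<omega> y < ennreal a"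
      by (rule relaxed_norm_usc) blast
    have "?h y < a" if "dist x y < d" for y
    proof -
      have "ennreal (?h y) < ennreal a" using d(2)[OF that] by (simp only: h[symmetric])
      then show ?thesis by (simp add: ennreal_less_iff)
    qed
    with d(1) show ?thesis by blast
  qed
  have N_sets: "N \<in> sets T_mass" "closure N \<in> sets T_mass" using N(1) \<mu>(1) by simp_all
  have N_fin: "emeasure T_mass N < \<infinity>"
    using emeasure_mono[OF closure_subset N_sets(2)] \<mu>(3)[OF N(3)] by (rule le_less_trans)
  let ?A = "\<integral>\<^sup>+x. ennreal (?h x) * indicator N x \<partial>T_mass"
  have bound: "ennreal \<bar>T_hat \<omega>\<bar> \<le> ?A + ennreal e + ennreal (2 * e) * emeasure T_mass N" if e: "0 < e" for e
  proof -
    obtain g where g: "continuous_on N g" "\<And>x. x \<in> N \<Longrightarrow> ?h x \<le> g x"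
      "(\<integral>\<^sup>+x. ennreal (g x) * indicator N x \<partial>T_mass) \<le> ?A + ennreal e"
      by (rule usc_lipschitz_majorant[OF \<mu>(1) N(1) N_fin enn2real_nonneg M usc e]) blast+
    have g0: "0 \<le> g x" if "x \<in> N" for x using g(2)[OF that] enn2real_nonneg order_trans by blast
    have "ennreal \<bar>T_hat \<omega>\<bar> \<le> (\<integral>\<^sup>+x. ennreal (g x + 2 * e) * indicator N x \<partial>T_mass)"
      by (rule extension_bound_majorant[OF assms(1,4) \<mu>(1,2) assms(5) N g(1,2) e])
    also have "\<dots> = (\<integral>\<^sup>+x. ennreal (g x) * indicator N x + ennreal (2 * e) * indicator N x \<partial>T_mass)"
    proof (rule nn_integral_cong)
      show "ennreal (g x + 2 * e) * indicator N x = ennreal (g x) * indicator N x + ennreal (2 * e) * indicator N x" for x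
        using g0[of x] e by (cases "x \<in> N") simp_all
    qed
    also have "\<dots> = (\<integral>\<^sup>+x. ennreal (g x) * indicator N x \<partial>T_mass) + (\<integral>\<^sup>+x. ennreal (2 * e) * indicator N x \<partial>T_mass)"
    proof (rule nn_integral_add)
      have "(\<lambda>x. indicator N x *\<^sub>R g x) \<in> borel_measurable borel"
        using N(1) g(1) by (intro borel_measurable_continuous_on_indicator) simp_all
      then have "(\<lambda>x. ennreal (indicator N x *\<^sub>R g x)) \<in> borel_measurable T_mass"
        unfolding measurable_cong_sets[OF \<mu>(1) refl] by measurable
      moreover have "ennreal (indicator N x *\<^sub>R g x) = ennreal (g x) * indicator N x" for x
        by (cases "x \<in> N") simp_all
      ultimately show "(\<lambda>x. ennreal (g x) * indicator N x) \<in> borel_measurable T_mass" by simp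
    qed (use N_sets in simp)
    also have "(\<integral>\<^sup>+x. ennreal (2 * e) * indicator N x \<partial>T_mass) = ennreal (2 * e) * emeasure T_mass N"
      by (rule nn_integral_cmult_indicator[OF N_sets(1)])
    finally show ?thesis using g(3) by (meson add_right_mono order_trans)
  qed
  have "ennreal \<bar>T_hat \<omega>\<bar> \<le> ?A"
  proof (rule ennreal_le_epsilon)
    fix d :: real assume d: "0 < d"
    define m where "m = measure T_mass N"
    have m: "emeasure T_mass N = ennreal m" "0 \<le> m"
      using N_fin by (simp_all add: m_def emeasure_eq_ennreal_measure)
    \<comment> \<open>This value makes the total error \<open>e + 2 * e * m\<close> equal to \<open>d\<close>.\<close>
    define e where "e = d / (1 + 2 * m)"
    have "e * (1 + 2 * m) = d" using m(2) by (simp add: e_def)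
    then have e2: "e + 2 * e * m = d" by (simp add: algebra_simps)
    have e: "0 < e" using d m(2) by (simp add: e_def)
    have "ennreal e + ennreal (2 * e) * emeasure T_mass N = ennreal d"
      using e e2 m by (simp add: ennreal_mult[symmetric] ennreal_plus[symmetric] del: ennreal_plus)
    then show "ennreal \<bar>T_hat \<omega>\<bar> \<le> ?A + ennreal d" using bound[OF e] by (simp add: add.assoc)
  qed
  also have "?A \<le> (\<integral>\<^sup>+x. pointwise_norm k \<omega> x \<partial>T_mass)"
  proof (rule nn_integral_mono)
    show "ennreal (?h x) * indicator N x \<le> pointwise_norm k \<omega> x" for x
      using relaxed_norm_le_pointwise_norm[OF \<omega>, of x] unfolding h[of x, symmetric]
      by (cases "x \<in> N") simp_all
  qed
  finally show ?thesis .
qed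

end
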